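(* Let $0 < \lambda < 1$ and put $n_0 = \lceil (1-\lambda)^{-2} \rceil$; assume that $\lambda + \frac{1}{\sqrt{n_0\log(n_0)}} < 1$. Define for every $n \in \mathbb{Z}$ the probability measure $\mu_n$ on $\{0,1\}$ given by $$\mu_n(0) = \begin{cases} \lambda + \frac{1}{\sqrt{n \log(n)}} & \text{if } n \geq n_0,\\ \lambda & \text{if } n < n_0.\end{cases}$$ The associated Bernoulli shift $T$ on $(X,\mu) = \prod_{n \in \mathbb{Z}} (\{0,1\},\mu_n)$ is (nonsingular,) essentially free, ergodic, of type III$_1$ and with weakly mixing Maharam extension. Moreover, for all $k \geq 1$ and $a_1,\ldots,a_k \in \mathbb{Z} \setminus \{0\}$, the nonsingular transformation $$T^{a_1} \times \cdots \times T^{a_k} : X^k \to X^k : (x_1,\ldots,x_k) \mapsto (T^{a_1}(x_1),\ldots,T^{a_k}(x_k))$$ remains ergodic, of type III$_1$ and with weakly mixing Maharam extension.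
   Context: The Bernoulli shift is $(T x)_n = x_{n-1}$; it is the transformation given by $1 \in \mathbb{Z}$ in the Bernoulli action $(k\cdot x)_n = x_{n-k}$ of $\mathbb{Z}$. A nonsingular invertible transformation is identified with the nonsingular action of $\mathbb{Z}$ it generates, and $X^k$ carries the measure $\mu^k$. For a nonsingular action $G \curvearrowright (X,\mu)$ of a countable group, the Radon-Nikodym cocycle $\omega : G \times X \to (0,\infty)$ is determined by $\int_X f(x)\,\omega(g,x)\,d\mu(x) = \int_X f(g^{-1}\cdot x)\,d\mu(x)$ for all positive Borel $f$. The Maharam extension is the measure preserving action $G \curvearrowright (X \times \mathbb{R},\mu \times \nu)$ given by $g \cdot (x,s) = (g\cdot x, \log(\omega(g,x)) + s)$, with $d\nu(s) = \exp(-s)\,ds$. An essentially free ergodic nonsingular action is of type III$_1$ if and only if its Maharam extension is ergodic. A nonsingular action $G \curvearrowright (Z,\zeta)$ on a ($\sigma$-finite) measure space is weakly mixing if for every ergodic probability measure preserving action $G \curvearrowright (Y,\eta)$ on a standard probability space, the diagonal action $G \curvearrowright (Y \times Z,\eta\times\zeta)$ is ergodic. *)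

theory Defs
  imports "HOL-Probability.Probability"
begin

section \<open>Nonsingular actions\<close>

text \<open>Discrete groups are written additively. Only the values of an action on the underlying
  space of the measure matter.\<close>

definition nonsingular_action :: "'a measure \<Rightarrow> ('g::{countable,group_add} \<Rightarrow> 'a \<Rightarrow> 'a) \<Rightarrow> bool" where
  "nonsingular_action M act \<longleftrightarrow>
     sigma_finite_measure M \<and>
     (\<forall>g. act g \<in> M \<rightarrow>\<^sub>M M) \<and>
     (\<forall>x\<in>space M. act 0 x = x) \<and>
     (\<forall>g h. \<forall>x\<in>space M. act (g + h) x = act g (act h x)) \<and>
     (\<forall>g. null_sets (distr M M (act g)) = null_sets M)"

definition pmp_action :: "'a measure \<Rightarrow> ('g::{countable,group_add} \<Rightarrow> 'a \<Rightarrow> 'a) \<Rightarrow> bool" where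
  "pmp_action M act \<longleftrightarrow>
     prob_space M \<and> nonsingular_action M act \<and> (\<forall>g. distr M M (act g) = M)"

definition essentially_free :: "'a measure \<Rightarrow> ('g::{countable,group_add} \<Rightarrow> 'a \<Rightarrow> 'a) \<Rightarrow> bool" where
  "essentially_free M act \<longleftrightarrow> (\<forall>g. g \<noteq> 0 \<longrightarrow> (AE x in M. act g x \<noteq> x))"

text \<open>Invariance of a set is understood up to null sets. For an action of a countable group this
  is the same as strict invariance, since an almost invariant set agrees up to a null set with an
  invariant one. It makes the notion insensitive to changing the action on null sets, as is
  needed for the Maharam extension, where the Radon-Nikodym cocycle is only determined almost
  everywhere.\<close>

definition ergodic_action :: "'a measure \<Rightarrow> ('g::{countable,group_add} \<Rightarrow> 'a \<Rightarrow> 'a) \<Rightarrow> bool" where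
  "ergodic_action M act \<longleftrightarrow>
     (\<forall>A\<in>sets M. (\<forall>g. AE x in M. act g x \<in> A \<longleftrightarrow> x \<in> A) \<longrightarrow>
        A \<in> null_sets M \<or> space M - A \<in> null_sets M)"

definition generated_action :: "'a measure \<Rightarrow> ('a \<Rightarrow> 'a) \<Rightarrow> int \<Rightarrow> 'a \<Rightarrow> 'a" where
  "generated_action M T k =
     (if 0 \<le> k then T ^^ nat k else inv_into (space M) T ^^ nat (- k))"


section \<open>The Maharam extension and type III_1\<close>

text \<open>The defining formula says that the cocycle at \<open>g\<close> is the derivative of the push-forward of
  the measure under \<open>-g\<close>; see \<open>rn_cocycle_nn_integral\<close>. It is positive and finite almost
  everywhere (\<open>AE_rn_cocycle\<close>); on the remaining null set \<open>rn_cocycle\<close> may take the value 0.\<close>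

definition rn_cocycle :: "'a measure \<Rightarrow> ('g::{countable,group_add} \<Rightarrow> 'a \<Rightarrow> 'a) \<Rightarrow> 'g \<Rightarrow> 'a \<Rightarrow> real" where
  "rn_cocycle M act g x = enn2real (RN_deriv M (distr M M (act (- g))) x)"

definition maharam_measure :: "'a measure \<Rightarrow> ('a \<times> real) measure" where
  "maharam_measure M = M \<Otimes>\<^sub>M density lborel (\<lambda>s. ennreal (exp (- s)))"

definition maharam_action ::
    "'a measure \<Rightarrow> ('g::{countable,group_add} \<Rightarrow> 'a \<Rightarrow> 'a) \<Rightarrow> 'g \<Rightarrow> 'a \<times> real \<Rightarrow> 'a \<times> real" where
  "maharam_action M act g = (\<lambda>(x, s). (act g x, ln (rn_cocycle M act g x) + s))"

definition type_III1 :: "'a measure \<Rightarrow> ('g::{countable,group_add} \<Rightarrow> 'a \<Rightarrow> 'a) \<Rightarrow> bool" where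
  "type_III1 M act \<longleftrightarrow>
     nonsingular_action M act \<and> essentially_free M act \<and> ergodic_action M act \<and>
     ergodic_action (maharam_measure M) (maharam_action M act)"


section \<open>Weak mixing\<close>

definition standard_borel :: "'a measure \<Rightarrow> bool" where
  "standard_borel M \<longleftrightarrow>
     (\<exists>\<tau>. completely_metrizable_space \<tau> \<and> second_countable \<tau> \<and>
          space M = topspace \<tau> \<and> sets M = sigma_sets (topspace \<tau>) {U. openin \<tau> U})"

definition diagonal_action :: "('g \<Rightarrow> 'b \<Rightarrow> 'b) \<Rightarrow> ('g \<Rightarrow> 'a \<Rightarrow> 'a) \<Rightarrow> 'g \<Rightarrow> 'b \<times> 'a \<Rightarrow> 'b \<times> 'a" where
  "diagonal_action act' act g = (\<lambda>(y, z). (act' g y, act g z))"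

text \<open>A definition cannot quantify over types, so the type carrying the probability spaces is a
  parameter. A statement that is polymorphic in it is about all standard probability spaces.\<close>

definition weakly_mixing ::
    "'b itself \<Rightarrow> 'a measure \<Rightarrow> ('g::{countable,group_add} \<Rightarrow> 'a \<Rightarrow> 'a) \<Rightarrow> bool" where
  "weakly_mixing (_ :: 'b itself) M act \<longleftrightarrow>
     (\<forall>(N :: 'b measure) act'.
        standard_borel N \<and> pmp_action N act' \<and> ergodic_action N act' \<longrightarrow>
        ergodic_action (N \<Otimes>\<^sub>M M) (diagonal_action act' act))"


section \<open>Bernoulli shifts\<close>

text \<open>The two-point set \<open>{0, 1}\<close> is represented by \<^typ>\<open>bool\<close>, with \<^const>\<open>False\<close> for 0.\<close>

definition bernoulli_space :: "(int \<Rightarrow> bool pmf) \<Rightarrow> (int \<Rightarrow> bool) measure" where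
  "bernoulli_space \<mu> = (\<Pi>\<^sub>M n\<in>UNIV. measure_pmf (\<mu> n))"

definition bernoulli_shift :: "(int \<Rightarrow> 'a) \<Rightarrow> int \<Rightarrow> 'a" where
  "bernoulli_shift x = (\<lambda>n. x (n - 1))"

definition power_space :: "nat \<Rightarrow> 'a measure \<Rightarrow> (nat \<Rightarrow> 'a) measure" where
  "power_space k M = (\<Pi>\<^sub>M i\<in>{1..k}. M)"

definition product_map :: "nat \<Rightarrow> (nat \<Rightarrow> 'a \<Rightarrow> 'a) \<Rightarrow> (nat \<Rightarrow> 'a) \<Rightarrow> nat \<Rightarrow> 'a" where
  "product_map k S x = (\<lambda>i\<in>{1..k}. S i (x i))"


section \<open>Relating the definitions to their usual descriptions\<close>

lemma generated_action_bernoulli_shift: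
  "generated_action (bernoulli_space \<mu>) bernoulli_shift k x = (\<lambda>n. x (n - k))"
proof -
  have sp: "space (bernoulli_space \<mu>) = UNIV"
    by (auto simp: bernoulli_space_def space_PiM)
  have pos: "(bernoulli_shift ^^ m) x = (\<lambda>n. x (n - int m))" for m and x :: "int \<Rightarrow> bool"
    by (induction m) (auto simp: bernoulli_shift_def algebra_simps)
  have "inj (bernoulli_shift :: (int \<Rightarrow> bool) \<Rightarrow> _)"
  proof (rule injI)
    fix x y :: "int \<Rightarrow> bool" assume eq: "bernoulli_shift x = bernoulli_shift y"
    show "x = y"
    proof
      fix n show "x n = y n"
        using fun_cong[OF eq, of "n + 1"] by (simp add: bernoulli_shift_def)
    qed
  qed
  then have inv: "inv bernoulli_shift y = (\<lambda>n. y (n + 1))" for y :: "int \<Rightarrow> bool"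
    by (intro inv_f_eq) (auto simp: bernoulli_shift_def)
  have neg: "(inv bernoulli_shift ^^ m) x = (\<lambda>n. x (n + int m))" for m and x :: "int \<Rightarrow> bool"
    by (induction m) (auto simp: inv algebra_simps)
  show ?thesis
    by (simp add: generated_action_def sp pos neg)
qed

context
  fixes M :: "'a measure" and act :: "'g::{countable,group_add} \<Rightarrow> 'a \<Rightarrow> 'a"
  assumes ns: "nonsingular_action M act"
begin

lemma sigma_finite_distr_action: "sigma_finite_measure (distr M M (act g))"
proof -
  interpret sigma_finite_measure M using ns by (simp add: nonsingular_action_def)
  have m[measurable]: "\<And>g. act g \<in> M \<rightarrow>\<^sub>M M" using ns by (simp add: nonsingular_action_def)
  obtain A where A: "range A \<subseteq> sets M" "(\<Union>i::nat. A i) = space M" "\<And>i. emeasure M (A i) \<noteq> \<infinity>"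
    using sigma_finite by blast
  have inv: "act (- g) (act g x) = x" if "x \<in> space M" for x
  proof -
    have "act (- g) (act g x) = act (- g + g) x" "act 0 x = x"
      using ns that by (auto simp only: nonsingular_action_def)
    then show ?thesis by simp
  qed
  define B where "B i = act (- g) -` A i \<inter> space M" for i
  have Bm: "B i \<in> sets M" for i unfolding B_def using A(1) by (auto intro: measurable_sets)
  have "act g -` B i \<inter> space M = A i" for i
    using A(1) sets.sets_into_space[of "A i" M] measurable_space[OF m] by (auto simp: B_def inv)
  then have fin: "emeasure (distr M M (act g)) (B i) \<noteq> \<infinity>" for i
    using A(3)[of i] by (simp add: emeasure_distr Bm)
  have "act (- g) x \<in> (\<Union>i. A i)" if "x \<in> space M" for x
    using measurable_space[OF m that, of "- g"] A(2) by simp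
  then have un: "(\<Union>i. B i) = space M"
    by (auto simp: B_def)
  show ?thesis
    by standard (rule exI[of _ "range B"], use Bm fin un in auto)
qed

lemma density_RN_deriv_action:
  "density M (RN_deriv M (distr M M (act g))) = distr M M (act g)"
  using ns
  by (intro sigma_finite_measure.density_RN_deriv)
    (auto simp: nonsingular_action_def absolutely_continuous_def)

lemma AE_RN_deriv_action_finite: "AE x in M. RN_deriv M (distr M M (act g)) x \<noteq> \<infinity>"
  using ns sigma_finite_distr_action
  by (intro sigma_finite_measure.RN_deriv_finite)
    (auto simp: nonsingular_action_def absolutely_continuous_def)

lemma AE_rn_cocycle:
  "AE x in M. 0 < rn_cocycle M act g x \<and>
     ennreal (rn_cocycle M act g x) = RN_deriv M (distr M M (act (- g))) x"
proof -
  let ?D = "RN_deriv M (distr M M (act (- g)))"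
  let ?Z = "{x\<in>space M. ?D x = 0}"
  have Z: "?Z \<in> sets M" by measurable
  have "emeasure (distr M M (act (- g))) ?Z = (\<integral>\<^sup>+x. ?D x * indicator ?Z x \<partial>M)"
    using Z by (subst density_RN_deriv_action[symmetric]) (simp add: emeasure_density)
  also have "\<dots> = 0"
    by (rule nn_integral_zero') (auto simp: indicator_def)
  finally have "?Z \<in> null_sets (distr M M (act (- g)))" using Z by auto
  then have "?Z \<in> null_sets M" using ns by (simp add: nonsingular_action_def)
  then have "AE x in M. ?D x \<noteq> 0"
    by (auto dest: AE_not_in)
  with AE_RN_deriv_action_finite[of "- g"] show ?thesis
    by eventually_elim (simp add: rn_cocycle_def enn2real_positive_iff less_top zero_less_iff_neq_zero)
qed

lemma rn_cocycle_nn_integral: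
  assumes f[measurable]: "f \<in> borel_measurable M"
  shows "(\<integral>\<^sup>+x. f x * ennreal (rn_cocycle M act g x) \<partial>M) = (\<integral>\<^sup>+x. f (act (- g) x) \<partial>M)"
proof -
  let ?D = "RN_deriv M (distr M M (act (- g)))"
  have m: "act (- g) \<in> M \<rightarrow>\<^sub>M M" using ns by (simp add: nonsingular_action_def)
  have "(\<integral>\<^sup>+x. f x * ennreal (rn_cocycle M act g x) \<partial>M) = (\<integral>\<^sup>+x. ?D x * f x \<partial>M)"
  proof (rule nn_integral_cong_AE)
    show "AE x in M. f x * ennreal (rn_cocycle M act g x) = ?D x * f x"
      using AE_rn_cocycle[of g] by eventually_elim (simp add: mult.commute)
  qed
  also have "\<dots> = (\<integral>\<^sup>+x. f x \<partial>distr M M (act (- g)))"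
    by (subst density_RN_deriv_action[symmetric]) (simp add: nn_integral_density)
  also have "\<dots> = (\<integral>\<^sup>+x. f (act (- g) x) \<partial>M)"
    using m by (simp add: nn_integral_distr)
  finally show ?thesis .
qed

end

end

theory Submission
  imports Defs "HOL-Real_Asymp.Real_Asymp"
begin

text \<open>
Let \<open>N\<close> be an ergodic probability measure preserving system with point \<open>y\<close>, let \<open>x\<close> be the coins of the
Bernoulli space (or of its \<open>k\<close>-th power), and let \<open>s\<close> be the real coordinate of the Maharam extension. All
assertions follow from one: a set \<open>A\<close> of points \<open>(y, x, s)\<close> that is invariant under the diagonal action is,
up to null sets, determined by \<open>y\<close>. It is then null or conull because \<open>N\<close> is ergodic. Permuting independent
coins along free orbits is all that is used about the shift, so the shift and the products of its powers are
treated together: a coin process is a probability space with independent Boolean coordinates, and the integers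
permute its coins.

Nonsingularity and recurrence both come from the energy, the sum over all coins of the squared difference
between the bias of a coin and the bias of the coin that moves to its place. It bounds the squared norm of
finite-dimensional densities, hence \<open>\<nu>(S)\<^sup>2 \<le> K \<mu>(S)\<close> for the law \<open>\<nu>\<close> of the moved coins
(\<open>coin_process_comparison\<close>). The energy of the \<open>n\<close>-th iterate is \<open>o(ln n)\<close>, because
\<open>1 / (n ln n)\<close> is \<open>o(1 / n)\<close> (\<open>square_sum_growth\<close>). So the Radon-Nikodym cocycle of the \<open>n\<close>-th iterate is rarely smaller
than a small negative power of \<open>n\<close>, and integrable weights on the extension have divergent sums along
orbits (\<open>h_divergent\<close>): the measure preserving extension is recurrent in both time directions.

Every coin has, in one of the two time directions, eventually the stationary law. Flip this coin and shift
\<open>s\<close> by the difference of log-odds. The two orbits then have from some time on the same real coordinate, while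
the coin in which they differ moves away from every finite set of coins. As in Hopf's argument, recurrence
forces an invariant set to contain both points or none (\<open>AE_asymptotic_invariance\<close>, \<open>AE_flip_invariant\<close>).

It remains to exploit the invariance under flips. For the coin \<open>i\<close> let \<open>d\<close> be the shift of \<open>s\<close> that goes with its flip. If the set were
smooth in \<open>s\<close>, then its correlation with the centred coin \<open>i\<close> would be \<open>d\<close> times the integral of its derivative
in \<open>s\<close>, up to a factor bounded away from 0 and an error of order \<open>d\<^sup>2\<close>. Centred coins are orthogonal, so by
Bessel's inequality the correlations are square summable, whereas the numbers \<open>d\<^sup>2\<close> are not: for
the coin at \<open>n \<ge> n\<^sub>0\<close> they are at least \<open>1 / (n ln n)\<close>. Hence the derivative vanishes and \<open>A\<close> does not depend on \<open>s\<close> (\<open>U_interval\<close>); this is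
what makes the type III_1. Without \<open>s\<close> the flips make \<open>A\<close> independent of every finite set of coins
(\<open>U_cylinder\<close>), and \<open>A\<close> depends on \<open>y\<close> alone (\<open>flip_invariant_factor\<close>).
\<close>

section \<open>Recurrence and asymptotic pairs for measure preserving actions of the integers\<close>

text \<open>The Radon-Nikodym cocycle is only determined almost everywhere, so the Maharam extension satisfies the laws
of an action only almost everywhere.\<close>

locale near_action = sigma_finite_measure m
  for m :: "'z measure" and \<tau> :: "int \<Rightarrow> 'z \<Rightarrow> 'z" +
  assumes act_measurable [measurable]: "\<tau> g \<in> m \<rightarrow>\<^sub>M m"
    and act_distr: "distr m m (\<tau> g) = m"
    and AE_act_add: "AE z in m. \<forall>g h. \<tau> (g + h) z = \<tau> g (\<tau> h z)"
    and AE_act_0: "AE z in m. \<tau> 0 z = z"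
begin

lemma nn_integral_act:
  assumes [measurable]: "f \<in> borel_measurable m"
  shows "(\<integral>\<^sup>+z. f (\<tau> g z) \<partial>m) = (\<integral>\<^sup>+z. f z \<partial>m)"
  by (subst (2) act_distr[of g, symmetric]) (simp add: nn_integral_distr)

lemma AE_act:
  assumes "AE z in m. P z"
  shows "AE z in m. \<forall>g. P (\<tau> g z)"
proof -
  have "AE z in m. P (\<tau> g z)" for g
  proof -
    have "AE z in distr m m (\<tau> g). P z" using assms by (subst act_distr)
    then show ?thesis by (rule AE_distrD[rotated]) simp
  qed
  then show ?thesis by (simp add: AE_all_countable)
qed

text \<open>The orbit is followed in the time direction \<open>\<sigma> = \<plusminus>1\<close>. Visits to \<open>B\<close> are counted from 0 and the starting
point counts, so a point of \<open>B\<close> makes visit number 0 at time 0.\<close>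

definition visit :: "int \<Rightarrow> 'z set \<Rightarrow> nat \<Rightarrow> nat \<Rightarrow> 'z \<Rightarrow> bool" where
  "visit \<sigma> B k n z \<longleftrightarrow> \<tau> (\<sigma> * int n) z \<in> B \<and> card {i. i < n \<and> \<tau> (\<sigma> * int i) z \<in> B} = k"

text \<open>The points of \<open>B\<close> that never return form a set \<open>W\<close> that no orbit meets twice. As the action preserves the
measure, the sum of the integrals of \<open>h\<close> over the translates of \<open>W\<close> is at most the integral of \<open>h\<close>. The
divergence hypothesis is about positive times only, and still gives returns in both directions, since
meeting \<open>W\<close> once is a symmetric condition.\<close>

lemma wandering_null:
  fixes \<sigma> :: int
  assumes \<sigma>: "\<sigma> \<in> {1, -1}" and B [measurable]: "B \<in> sets m"
    and h [measurable]: "h \<in> borel_measurable m" and hfin: "(\<integral>\<^sup>+z. h z \<partial>m) < \<infinity>"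
    and div: "\<And>W. W \<in> sets m \<Longrightarrow> emeasure m W \<noteq> 0 \<Longrightarrow>
      (\<Sum>n. \<integral>\<^sup>+z. indicator W z * h (\<tau> (int n) z) \<partial>m) = \<infinity>"
  shows "AE z in m. z \<in> B \<longrightarrow> (\<exists>n::nat. 0 < n \<and> \<tau> (\<sigma> * int n) z \<in> B)"
proof -
  define W where "W = {z\<in>space m. z \<in> B \<and> (\<forall>n::nat. 0 < n \<longrightarrow> \<tau> (\<sigma> * int n) z \<notin> B)}"
  have [measurable]: "W \<in> sets m" unfolding W_def by measurable
  have once: "AE z in m. (\<Sum>n. indicator W (\<tau> (- int n) z) :: ennreal) \<le> 1"
    using AE_act_add
  proof eventually_elim
    case (elim z)
    have "g = g'" if "\<tau> g z \<in> W" "\<tau> g' z \<in> W" for g g'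
    proof (rule ccontr)
      assume "g \<noteq> g'"
      have key: False if "\<tau> a z \<in> W" "\<tau> b z \<in> W" "0 < \<sigma> * (b - a)" for a b
      proof -
        define n where "n = nat (\<sigma> * (b - a))"
        have n: "int n = \<sigma> * (b - a)" "0 < n" using that by (auto simp: n_def)
        have "\<sigma> * int n = b - a" using \<sigma> n by auto
        then have "\<tau> (\<sigma> * int n) (\<tau> a z) = \<tau> b z" using elim[rule_format, of "b - a" a] by simp
        moreover have "\<tau> (\<sigma> * int n) (\<tau> a z) \<notin> B" "\<tau> b z \<in> B"
          using that(1,2) n(2) unfolding W_def by blast+
        ultimately show False by simp
      qed
      have "0 < \<sigma> * (g' - g) \<or> 0 < \<sigma> * (g - g')"
        using \<open>g \<noteq> g'\<close> \<sigma> by (elim insertE) (simp_all, linarith+)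
      then show False
        by (rule disjE) (rule key[OF that], assumption, rule key[OF that(2,1)], assumption)
    qed
    then have sub: "\<exists>n0. {n. \<tau> (- int n) z \<in> W} \<subseteq> {n0}"
      by (metis (mono_tags, lifting) mem_Collect_eq neg_equal_iff_equal of_nat_eq_iff singletonI subsetI)
    then obtain n0 where "{n. \<tau> (- int n) z \<in> W} \<subseteq> {n0}" by auto
    then have "(\<Sum>n. indicator W (\<tau> (- int n) z) :: ennreal) = (\<Sum>n\<in>{n0}. indicator W (\<tau> (- int n) z))"
      by (intro suminf_finite) (auto simp: indicator_def)
    also have "\<dots> \<le> 1" by (cases "\<tau> (- int n0) z \<in> W") (simp_all add: indicator_def)
    finally show ?case .
  qed
  have eq: "(\<integral>\<^sup>+z. indicator W z * h (\<tau> (int n) z) \<partial>m) =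
      (\<integral>\<^sup>+z. indicator W (\<tau> (- int n) z) * h z \<partial>m)" for n
  proof -
    have "(\<integral>\<^sup>+z. indicator W z * h (\<tau> (int n) z) \<partial>m) =
        (\<integral>\<^sup>+z. indicator W (\<tau> (- int n) z) * h (\<tau> (int n) (\<tau> (- int n) z)) \<partial>m)"
      by (rule nn_integral_act[symmetric]) measurable
    also have "\<dots> = (\<integral>\<^sup>+z. indicator W (\<tau> (- int n) z) * h z \<partial>m)"
    proof (rule nn_integral_cong_AE)
      show "AE z in m. indicator W (\<tau> (- int n) z) * h (\<tau> (int n) (\<tau> (- int n) z)) =
          indicator W (\<tau> (- int n) z) * h z"
        using AE_act_add AE_act_0
      proof eventually_elim
        case (elim z)
        then show ?case using elim(1)[rule_format, of "int n" "- int n"] by simp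
      qed
    qed
    finally show ?thesis .
  qed
  have "(\<Sum>n. \<integral>\<^sup>+z. indicator W z * h (\<tau> (int n) z) \<partial>m) =
      (\<integral>\<^sup>+z. (\<Sum>n. indicator W (\<tau> (- int n) z) * h z) \<partial>m)"
    unfolding eq by (rule nn_integral_suminf[symmetric]) measurable
  also have "\<dots> = (\<integral>\<^sup>+z. (\<Sum>n. indicator W (\<tau> (- int n) z)) * h z \<partial>m)"
    by (simp add: ennreal_suminf_multc)
  also have "\<dots> \<le> (\<integral>\<^sup>+z. 1 * h z \<partial>m)"
  proof (rule nn_integral_mono_AE)
    show "AE z in m. (\<Sum>n. indicator W (\<tau> (- int n) z)) * h z \<le> 1 * h z"
      using once by eventually_elim (rule mult_right_mono, simp_all)
  qed
  also have "\<dots> < \<infinity>" using hfin by simp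
  finally have "emeasure m W = 0" using div[of W] by fastforce
  then have "W \<in> null_sets m" by auto
  then show ?thesis
    by (rule AE_I') (unfold W_def, blast)
qed

lemma visits_exist:
  fixes \<sigma> :: int
  assumes \<sigma>: "\<sigma> \<in> {1, -1}" and B: "B \<in> sets m"
    and h: "h \<in> borel_measurable m" "(\<integral>\<^sup>+z. h z \<partial>m) < \<infinity>"
    and div: "\<And>W. W \<in> sets m \<Longrightarrow> emeasure m W \<noteq> 0 \<Longrightarrow>
      (\<Sum>n. \<integral>\<^sup>+z. indicator W z * h (\<tau> (int n) z) \<partial>m) = \<infinity>"
  shows "AE z in m. z \<in> B \<longrightarrow> (\<forall>k. \<exists>n. visit \<sigma> B k n z)"
proof -
  have "AE z in m. \<forall>g. \<tau> g z \<in> B \<longrightarrow> (\<exists>n::nat. 0 < n \<and> \<tau> (\<sigma> * int n) (\<tau> g z) \<in> B)"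
    by (rule AE_act, rule wandering_null[OF \<sigma> B h]) (rule div)
  with AE_act_0 AE_act_add show ?thesis
  proof eventually_elim
    case (elim z)
    have "\<exists>n. visit \<sigma> B k n z" if "z \<in> B" for k
    proof (induction k)
      case 0
      have "visit \<sigma> B 0 0 z" using that elim(1) by (simp add: visit_def)
      then show ?case by blast
    next
      case (Suc k)
      then obtain n where n: "visit \<sigma> B k n z" by blast
      then have "\<tau> (\<sigma> * int n) z \<in> B" by (simp add: visit_def)
      then obtain d :: nat where d: "0 < d" "\<tau> (\<sigma> * int d) (\<tau> (\<sigma> * int n) z) \<in> B"
        using elim(3) by blast
      have "\<tau> (\<sigma> * int (n + d)) z \<in> B"
        using d(2) elim(2)[rule_format, of "\<sigma> * int d" "\<sigma> * int n"] by (simp add: algebra_simps)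
      then have ex: "\<exists>i. n < i \<and> \<tau> (\<sigma> * int i) z \<in> B" using d(1) by (intro exI[of _ "n + d"]) auto
      define n' where "n' = (LEAST i. n < i \<and> \<tau> (\<sigma> * int i) z \<in> B)"
      have n': "n < n'" "\<tau> (\<sigma> * int n') z \<in> B"
        using LeastI_ex[OF ex] by (auto simp: n'_def)
      have least: "\<not> (n < i \<and> \<tau> (\<sigma> * int i) z \<in> B)" if "i < n'" for i
        using that not_less_Least unfolding n'_def by blast
      have "{i. i < n' \<and> \<tau> (\<sigma> * int i) z \<in> B} = insert n {i. i < n \<and> \<tau> (\<sigma> * int i) z \<in> B}"
      proof (intro equalityI subsetI)
        fix i assume i: "i \<in> {i. i < n' \<and> \<tau> (\<sigma> * int i) z \<in> B}"
        then have "\<not> n < i" using least[of i] by blast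
        then show "i \<in> insert n {i. i < n \<and> \<tau> (\<sigma> * int i) z \<in> B}" using i by fastforce
      next
        fix i assume "i \<in> insert n {i. i < n \<and> \<tau> (\<sigma> * int i) z \<in> B}"
        then show "i \<in> {i. i < n' \<and> \<tau> (\<sigma> * int i) z \<in> B}"
          using n' n by (auto simp: visit_def)
      qed
      then have "visit \<sigma> B (Suc k) n' z" using n n' by (simp add: visit_def)
      then show ?case by blast
    qed
    then show ?case by blast
  qed
qed

text \<open>The map that sends a point of \<open>B\<close> to its \<open>k\<close>-th visit is injective: the starting point is recovered as the
\<open>k\<close>-th visit of the reversed orbit. It is pieced together from measure preserving maps, so it does not
increase integrals.\<close>

lemma nn_integral_visit_le:
  fixes \<sigma> :: int
  assumes B [measurable]: "B \<in> sets m" and \<rho> [measurable]: "\<rho> \<in> borel_measurable m"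
  shows "(\<integral>\<^sup>+z. indicator B z * (\<Sum>n. indicator {z. visit \<sigma> B k n z} z * \<rho> (\<tau> (\<sigma> * int n) z)) \<partial>m)
    \<le> (\<integral>\<^sup>+z. \<rho> z \<partial>m)"
proof -
  have [measurable]: "Measurable.pred m (visit \<sigma> B k n)" for n
    unfolding visit_def by measurable
  define P where "P n z \<longleftrightarrow> \<tau> (- \<sigma> * int n) z \<in> B \<and> z \<in> B \<and>
      card {i. i < n \<and> \<tau> (- \<sigma> * int (n - i)) z \<in> B} = k" for n z
  have [measurable]: "Measurable.pred m (P n)" for n
    unfolding P_def by measurable
  have "(\<integral>\<^sup>+z. indicator B z * (\<Sum>n. indicator {z. visit \<sigma> B k n z} z * \<rho> (\<tau> (\<sigma> * int n) z)) \<partial>m)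
     = (\<Sum>n. \<integral>\<^sup>+z. indicator B z * (indicator {z. visit \<sigma> B k n z} z * \<rho> (\<tau> (\<sigma> * int n) z)) \<partial>m)"
    by (subst nn_integral_suminf[symmetric]) (auto simp: ennreal_suminf_cmult)
  also have "\<dots> = (\<Sum>n. \<integral>\<^sup>+z. indicator {z. P n z} z * \<rho> z \<partial>m)"
  proof (rule suminf_cong)
    fix n
    have "(\<integral>\<^sup>+z. indicator B z * (indicator {z. visit \<sigma> B k n z} z * \<rho> (\<tau> (\<sigma> * int n) z)) \<partial>m) =
      (\<integral>\<^sup>+z. indicator B (\<tau> (- \<sigma> * int n) z) *
        (indicator {z. visit \<sigma> B k n z} (\<tau> (- \<sigma> * int n) z) * \<rho> (\<tau> (\<sigma> * int n) (\<tau> (- \<sigma> * int n) z))) \<partial>m)"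
      by (rule nn_integral_act[symmetric]) measurable
    also have "\<dots> = (\<integral>\<^sup>+z. indicator {z. P n z} z * \<rho> z \<partial>m)"
    proof (rule nn_integral_cong_AE)
      show "AE z in m. indicator B (\<tau> (- \<sigma> * int n) z) *
        (indicator {z. visit \<sigma> B k n z} (\<tau> (- \<sigma> * int n) z) * \<rho> (\<tau> (\<sigma> * int n) (\<tau> (- \<sigma> * int n) z)))
        = indicator {z. P n z} z * \<rho> z"
        using AE_act_add AE_act_0
      proof eventually_elim
        case (elim z)
        have sh: "\<tau> (\<sigma> * int i) (\<tau> (- \<sigma> * int n) z) = \<tau> (- \<sigma> * int (n - i)) z" if "i \<le> n" for i
          using elim(1)[rule_format, of "\<sigma> * int i" "- \<sigma> * int n"] that
          by (simp add: algebra_simps of_nat_diff)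
        have "{i. i < n \<and> \<tau> (\<sigma> * int i) (\<tau> (- \<sigma> * int n) z) \<in> B} =
            {i. i < n \<and> \<tau> (- \<sigma> * int (n - i)) z \<in> B}" using sh by auto
        moreover have "\<tau> (\<sigma> * int n) (\<tau> (- \<sigma> * int n) z) = z" using sh[of n] elim(2) by simp
        ultimately show ?case by (auto simp: visit_def P_def indicator_def)
      qed
    qed
    finally show "(\<integral>\<^sup>+z. indicator B z * (indicator {z. visit \<sigma> B k n z} z * \<rho> (\<tau> (\<sigma> * int n) z)) \<partial>m)
      = (\<integral>\<^sup>+z. indicator {z. P n z} z * \<rho> z \<partial>m)" .
  qed
  also have "\<dots> = (\<integral>\<^sup>+z. (\<Sum>n. indicator {z. P n z} z) * \<rho> z \<partial>m)"
    by (subst nn_integral_suminf[symmetric]) (auto simp: ennreal_suminf_multc)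
  also have "\<dots> \<le> (\<integral>\<^sup>+z. 1 * \<rho> z \<partial>m)"
  proof (intro nn_integral_mono mult_right_mono)
    fix z
    have card_eq: "card {i. i < n \<and> \<tau> (- \<sigma> * int (n - i)) z \<in> B} = card {i \<in> {1..n}. \<tau> (- \<sigma> * int i) z \<in> B}" for n
      by (rule bij_betw_same_card[of "\<lambda>i. n - i"], rule bij_betw_byWitness[where f' = "\<lambda>i. n - i"]) auto
    have key: False if "P a z" "P b z" "a < b" for a b
    proof -
      have "{i \<in> {1..a}. \<tau> (- \<sigma> * int i) z \<in> B} \<subset> {i \<in> {1..b}. \<tau> (- \<sigma> * int i) z \<in> B}"
      proof -
        have "b \<in> {i \<in> {1..b}. \<tau> (- \<sigma> * int i) z \<in> B}" using that by (auto simp: P_def)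
        moreover have "b \<notin> {1..a}" using that by auto
        moreover have "{i \<in> {1..a}. \<tau> (- \<sigma> * int i) z \<in> B} \<subseteq> {i \<in> {1..b}. \<tau> (- \<sigma> * int i) z \<in> B}"
          using that by auto
        ultimately show ?thesis by blast
      qed
      then have "card {i \<in> {1..a}. \<tau> (- \<sigma> * int i) z \<in> B} < card {i \<in> {1..b}. \<tau> (- \<sigma> * int i) z \<in> B}"
        by (intro psubset_card_mono) auto
      moreover have "card {i \<in> {1..a}. \<tau> (- \<sigma> * int i) z \<in> B} = k" "card {i \<in> {1..b}. \<tau> (- \<sigma> * int i) z \<in> B} = k"
        using that card_eq by (auto simp: P_def)
      ultimately show False by simp
    qed
    have "a = b" if "P a z" "P b z" for a b
      using key[OF that] key[OF that(2,1)] by (meson linorder_neqE_nat)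
    then have "\<exists>n0. {n. P n z} \<subseteq> {n0}" by blast
    then obtain n0 where "{n. P n z} \<subseteq> {n0}" by auto
    then have "(\<Sum>n. indicator {z. P n z} z :: ennreal) = (\<Sum>n\<in>{n0}. indicator {z. P n z} z)"
      by (intro suminf_finite) (auto simp: indicator_def)
    also have "\<dots> \<le> 1" by (cases "P n0 z") (simp_all add: indicator_def)
    finally show "(\<Sum>n. indicator {z. P n z} z :: ennreal) \<le> 1" .
  qed simp
  finally show ?thesis by simp
qed


text \<open>A form of Hopf's argument that needs no ergodic theorem. If the orbits of \<open>z\<close> and \<open>\<theta> z\<close> visit \<open>B\<close> at the same
times from time \<open>N0\<close> on, their counts of visits differ by at most \<open>N0\<close>. Compare both points at a late visit: an approximation
\<open>A'\<close> of \<open>A\<close> does not separate them there, so if \<open>A\<close> does, one of them lies in the small set where \<open>A\<close> and \<open>A'\<close>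
differ. The visit maps do not increase measure, and only \<open>2 * N0 + 1\<close> of them are involved for \<open>\<theta> z\<close>, however
late the visit is.\<close>

lemma AE_asymptotic_invariance:
  fixes \<sigma> :: int
  assumes B [measurable]: "B \<in> sets m"
    and visits: "AE z in m. z \<in> B \<longrightarrow> (\<forall>k. \<exists>n. visit \<sigma> B k n z)"
    and \<theta> [measurable]: "\<theta> \<in> m \<rightarrow>\<^sub>M m" and C: "C < \<infinity>"
    and \<theta>_le: "\<And>R. R \<in> borel_measurable m \<Longrightarrow> (\<integral>\<^sup>+z. R (\<theta> z) \<partial>m) \<le> C * (\<integral>\<^sup>+z. R z \<partial>m)"
    and same: "AE z in m. \<forall>n\<ge>N0. \<tau> (\<sigma> * int n) (\<theta> z) \<in> B \<longleftrightarrow> \<tau> (\<sigma> * int n) z \<in> B"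
    and A [measurable]: "A \<in> sets m" and inv: "\<And>g. AE z in m. \<tau> g z \<in> A \<longleftrightarrow> z \<in> A"
    and approx: "\<And>\<epsilon>::real. 0 < \<epsilon> \<Longrightarrow> \<exists>A'\<in>sets m. emeasure m {z\<in>B. \<not> (z \<in> A \<longleftrightarrow> z \<in> A')} \<le> ennreal \<epsilon> \<and>
      (\<exists>N. AE z in m. \<forall>n\<ge>N. \<tau> (\<sigma> * int n) (\<theta> z) \<in> A' \<longleftrightarrow> \<tau> (\<sigma> * int n) z \<in> A')"
  shows "AE z in m. z \<in> B \<and> \<theta> z \<in> B \<longrightarrow> (\<theta> z \<in> A \<longleftrightarrow> z \<in> A)"
proof -
  have AE_\<theta>: "AE z in m. P (\<theta> z)" if ae: "AE z in m. P z" for P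
  proof -
    from ae obtain N where N: "{z\<in>space m. \<not> P z} \<subseteq> N" "emeasure m N = 0" "N \<in> sets m"
      by (rule AE_E)
    have "(\<integral>\<^sup>+z. indicator N (\<theta> z) \<partial>m) \<le> C * (\<integral>\<^sup>+z. indicator N z \<partial>m)"
      using N by (intro \<theta>_le) simp
    also have "\<dots> = 0" using N by simp
    finally have "AE z in m. indicator N (\<theta> z) = (0::ennreal)"
      using N by (subst nn_integral_0_iff_AE[symmetric]) auto
    with AE_space show ?thesis
    proof eventually_elim
      case (elim z)
      then show ?case using N(1) measurable_space[OF \<theta>, of z] by (auto simp: indicator_def split: if_splits)
    qed
  qed
  have inv': "AE z in m. \<forall>g. \<tau> g z \<in> A \<longleftrightarrow> z \<in> A" using inv by (simp add: AE_all_countable)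
  define Bad where "Bad = {z\<in>space m. z \<in> B \<and> \<theta> z \<in> B \<and> \<not> (\<theta> z \<in> A \<longleftrightarrow> z \<in> A)}"
  have [measurable]: "Bad \<in> sets m" unfolding Bad_def by measurable
  have [measurable]: "Measurable.pred m (visit \<sigma> B k n)" for k n
    unfolding visit_def by measurable
  have bound: "emeasure m Bad \<le> (1 + of_nat (2 * N0 + 1) * C) * ennreal \<epsilon>" if eps: "0 < \<epsilon>" for \<epsilon> :: real
  proof -
    obtain A' N where A' [measurable]: "A' \<in> sets m"
      and small: "emeasure m {z\<in>B. \<not> (z \<in> A \<longleftrightarrow> z \<in> A')} \<le> ennreal \<epsilon>"
      and N: "AE z in m. \<forall>n\<ge>N. \<tau> (\<sigma> * int n) (\<theta> z) \<in> A' \<longleftrightarrow> \<tau> (\<sigma> * int n) z \<in> A'"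
      using approx[OF eps] by blast
    define D where "D = {z\<in>B. \<not> (z \<in> A \<longleftrightarrow> z \<in> A')}"
    have D_eq: "D = B \<inter> (A - A') \<union> B \<inter> (A' - A)" by (auto simp: D_def)
    have [measurable]: "D \<in> sets m" unfolding D_eq by measurable
    define R :: "nat \<Rightarrow> 'z \<Rightarrow> ennreal" where
      "R k z = indicator B z * (\<Sum>n. indicator {z. visit \<sigma> B k n z} z * indicator D (\<tau> (\<sigma> * int n) z))" for k z
    have R_meas [measurable]: "R k \<in> borel_measurable m" for k unfolding R_def by measurable
    have R_le: "(\<integral>\<^sup>+z. R k z \<partial>m) \<le> ennreal \<epsilon>" for k
    proof -
      have "(\<integral>\<^sup>+z. R k z \<partial>m) \<le> (\<integral>\<^sup>+z. indicator D z \<partial>m)"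
        unfolding R_def by (rule nn_integral_visit_le) measurable
      also have "\<dots> \<le> ennreal \<epsilon>" using small unfolding D_def[symmetric] by simp
      finally show ?thesis .
    qed
    have R_ge: "1 \<le> R k z" if "z \<in> B" "visit \<sigma> B k n z" "\<tau> (\<sigma> * int n) z \<in> D" for k n z
    proof -
      have "(\<Sum>i\<in>{n}. indicator {z. visit \<sigma> B k i z} z * indicator D (\<tau> (\<sigma> * int i) z) :: ennreal)
        \<le> (\<Sum>i. indicator {z. visit \<sigma> B k i z} z * indicator D (\<tau> (\<sigma> * int i) z))"
        by (rule sum_le_suminf) auto
      then show ?thesis using that by (simp add: R_def)
    qed
    \<comment> \<open>Visit number \<open>N0 + N\<close> happens no earlier than time \<open>N0 + N\<close>.\<close>
    define K where "K = N0 + N"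
    have pt: "AE z in m. indicator Bad z \<le> R K z + (\<Sum>k\<in>{K-N0..K+N0}. R k (\<theta> z))"
      using visits same inv' AE_\<theta>[OF inv'] N
    proof eventually_elim
      case (elim z)
      show ?case
      proof (cases "z \<in> Bad")
        case True
        then have z: "z \<in> B" "\<theta> z \<in> B" "\<not> (\<theta> z \<in> A \<longleftrightarrow> z \<in> A)" by (auto simp: Bad_def)
        obtain n where n: "visit \<sigma> B K n z" using elim(1) z(1) by blast
        have "card {i. i < n \<and> \<tau> (\<sigma> * int i) z \<in> B} \<le> card {..<n}" by (rule card_mono) auto
        then have nK: "K \<le> n" using n by (simp add: visit_def)
        define S where "S z = {i. i < n \<and> \<tau> (\<sigma> * int i) z \<in> B}" for z
        have fin: "finite (S z)" for z by (simp add: S_def)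
        have "S z \<subseteq> S (\<theta> z) \<union> {..<N0}" "S (\<theta> z) \<subseteq> S z \<union> {..<N0}"
          using elim(2) by (auto simp: S_def)
        then have "card (S z) \<le> card (S (\<theta> z) \<union> {..<N0})" "card (S (\<theta> z)) \<le> card (S z \<union> {..<N0})"
          using fin by (auto intro!: card_mono)
        moreover have "card (S z) = K" using n by (simp add: visit_def S_def)
        moreover have "card (S z \<union> {..<N0}) \<le> card (S z) + N0" "card (S (\<theta> z) \<union> {..<N0}) \<le> card (S (\<theta> z)) + N0"
          using card_Un_le[of "S z" "{..<N0}"] card_Un_le[of "S (\<theta> z)" "{..<N0}"] by simp_all
        ultimately have "K \<le> card (S (\<theta> z)) + N0" "card (S (\<theta> z)) \<le> K + N0"
          by linarith+
        then have k': "card (S (\<theta> z)) \<in> {K-N0..K+N0}" by auto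
        have "\<tau> (\<sigma> * int n) z \<in> B" using n by (simp add: visit_def)
        moreover have "\<tau> (\<sigma> * int n) (\<theta> z) \<in> B" using elim(2) nK calculation by (simp add: K_def)
        ultimately have v': "visit \<sigma> B (card (S (\<theta> z))) n (\<theta> z)" by (simp add: visit_def S_def)
        have "\<tau> (\<sigma> * int n) z \<in> D \<or> \<tau> (\<sigma> * int n) (\<theta> z) \<in> D"
          using elim(3,4,5) nK z n v' by (auto simp: D_def K_def visit_def)
        then have "1 \<le> R K z \<or> 1 \<le> R (card (S (\<theta> z))) (\<theta> z)"
          using R_ge z n v' by blast
        moreover have "R (card (S (\<theta> z))) (\<theta> z) \<le> (\<Sum>k\<in>{K-N0..K+N0}. R k (\<theta> z))"
          using k' by (intro member_le_sum) auto
        ultimately have "1 \<le> R K z + (\<Sum>k\<in>{K-N0..K+N0}. R k (\<theta> z))"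
        proof (elim disjE)
          assume "1 \<le> R K z" then show ?thesis by (rule order_trans) simp
        next
          assume "1 \<le> R (card (S (\<theta> z))) (\<theta> z)"
          also assume "R (card (S (\<theta> z))) (\<theta> z) \<le> (\<Sum>k\<in>{K-N0..K+N0}. R k (\<theta> z))"
          also have "\<dots> \<le> R K z + (\<Sum>k\<in>{K-N0..K+N0}. R k (\<theta> z))" by simp
          finally show ?thesis .
        qed
        then show ?thesis using True by simp
      qed auto
    qed
    have "emeasure m Bad = (\<integral>\<^sup>+z. indicator Bad z \<partial>m)" by simp
    also have "\<dots> \<le> (\<integral>\<^sup>+z. R K z + (\<Sum>k\<in>{K-N0..K+N0}. R k (\<theta> z)) \<partial>m)"
      by (rule nn_integral_mono_AE[OF pt])
    also have "\<dots> = (\<integral>\<^sup>+z. R K z \<partial>m) + (\<Sum>k\<in>{K-N0..K+N0}. \<integral>\<^sup>+z. R k (\<theta> z) \<partial>m)"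
      by (subst nn_integral_add) (auto simp: nn_integral_sum)
    also have "\<dots> \<le> ennreal \<epsilon> + (\<Sum>k\<in>{K-N0..K+N0}. C * ennreal \<epsilon>)"
      by (intro add_mono R_le sum_mono order_trans[OF \<theta>_le] mult_left_mono) auto
    also have "\<dots> = (1 + of_nat (2 * N0 + 1) * C) * ennreal \<epsilon>"
    proof -
      have "card {K-N0..K+N0} = 2 * N0 + 1" by (simp add: K_def)
      then show ?thesis by (simp only: sum_constant distrib_right mult.assoc mult_1_left)
    qed
    finally show ?thesis .
  qed
  define C' where "C' = enn2real (1 + of_nat (2 * N0 + 1) * C)"
  have C': "1 + of_nat (2 * N0 + 1) * C = ennreal C'" "0 \<le> C'"
    using C by (auto simp: C'_def less_top[symmetric] ennreal_mult_eq_top_iff)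
  have "emeasure m Bad \<le> ennreal e" if "0 < e" for e :: real
  proof -
    have "emeasure m Bad \<le> ennreal C' * ennreal (e / (C' + 1))"
      using bound[of "e / (C' + 1)"] that C' by simp
    also have "\<dots> = ennreal (C' * (e / (C' + 1)))" by (rule ennreal_mult[symmetric]) (use C'(2) that in simp_all)
    also have "\<dots> \<le> ennreal e" using C'(2) that by (intro ennreal_leI) (simp add: field_simps)
    finally show ?thesis .
  qed
  then have "emeasure m Bad \<le> 0" by - (rule ennreal_le_epsilon, simp)
  then have "Bad \<in> null_sets m" by auto
  then show ?thesis by (rule AE_I') (unfold Bad_def, blast)
qed

end


section \<open>The Maharam extension as a measure preserving action\<close>

lemma AE_pair_fst:
  assumes "sigma_finite_measure B" and ae: "AE x in A. P x"
  shows "AE z in A \<Otimes>\<^sub>M B. P (fst z)"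
proof -
  interpret B: sigma_finite_measure B by fact
  from ae obtain N where N: "{x\<in>space A. \<not> P x} \<subseteq> N" "emeasure A N = 0" "N \<in> sets A"
    by (rule AE_E)
  have "N \<times> space B \<in> null_sets (A \<Otimes>\<^sub>M B)"
    using N by (auto simp: null_sets_def B.emeasure_pair_measure_Times)
  then show ?thesis
    by (rule AE_I') (use N in \<open>auto simp: space_pair_measure\<close>)
qed

lemma AE_pair_snd:
  assumes "sigma_finite_measure B" and ae: "AE x in B. P x"
  shows "AE z in A \<Otimes>\<^sub>M B. P (snd z)"
proof -
  interpret B: sigma_finite_measure B by fact
  from ae obtain N where N: "{x\<in>space B. \<not> P x} \<subseteq> N" "emeasure B N = 0" "N \<in> sets B"
    by (rule AE_E)
  have "space A \<times> N \<in> null_sets (A \<Otimes>\<^sub>M B)"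
    using N by (auto simp: null_sets_def B.emeasure_pair_measure_Times)
  then show ?thesis
    by (rule AE_I') (use N in \<open>auto simp: space_pair_measure\<close>)
qed

abbreviation (input) "exp_measure \<equiv> density lborel (\<lambda>s. ennreal (exp (- s))) :: real measure"

lemma sigma_finite_exp_measure: "sigma_finite_measure exp_measure"
  by (rule sigma_finite_measure.sigma_finite_iff_density_finite[THEN iffD2, OF lborel.sigma_finite_measure_axioms]) auto

text \<open>Translation scales the measure \<open>exp (- s) ds\<close>; this compensates the Radon-Nikodym cocycle in the Maharam
extension.\<close>

lemma nn_integral_exp_measure_shift:
  assumes [measurable]: "f \<in> borel_measurable borel"
  shows "(\<integral>\<^sup>+s. f (r + s) \<partial>exp_measure) = ennreal (exp r) * (\<integral>\<^sup>+s. f s \<partial>exp_measure)"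
proof -
  have "(\<integral>\<^sup>+s. f s \<partial>exp_measure) = (\<integral>\<^sup>+s. ennreal (exp (- s)) * f s \<partial>lborel)"
    by (simp add: nn_integral_density)
  also have "\<dots> = (\<integral>\<^sup>+s. ennreal (exp (- (r + s))) * f (r + s) \<partial>lborel)"
    by (subst nn_integral_real_affine[where c = 1 and t = r]) auto
  finally have "ennreal (exp r) * (\<integral>\<^sup>+s. f s \<partial>exp_measure) =
      (\<integral>\<^sup>+s. ennreal (exp r) * (ennreal (exp (- (r + s))) * f (r + s)) \<partial>lborel)"
    by (simp add: nn_integral_cmult)
  also have "\<dots> = (\<integral>\<^sup>+s. ennreal (exp (- s)) * f (r + s) \<partial>lborel)"
    by (intro nn_integral_cong)
      (simp add: mult.assoc[symmetric] ennreal_mult[symmetric] exp_add[symmetric])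
  also have "\<dots> = (\<integral>\<^sup>+s. f (r + s) \<partial>exp_measure)"
    by (simp add: nn_integral_density)
  finally show ?thesis ..
qed

context
  fixes M :: "'a measure" and act :: "int \<Rightarrow> 'a \<Rightarrow> 'a"
  assumes ns: "nonsingular_action M act"
begin

interpretation M: sigma_finite_measure M
  using ns by (simp add: nonsingular_action_def)

lemma action_measurable: "act g \<in> M \<rightarrow>\<^sub>M M"
  using ns by (simp add: nonsingular_action_def)

lemma action_add: "x \<in> space M \<Longrightarrow> act (g + h) x = act g (act h x)"
  using ns by (auto simp only: nonsingular_action_def)

lemma action_0: "x \<in> space M \<Longrightarrow> act 0 x = x"
  using ns by (auto simp only: nonsingular_action_def)

lemma action_inverse: "x \<in> space M \<Longrightarrow> act g (act (- g) x) = x" "x \<in> space M \<Longrightarrow> act (- g) (act g x) = x"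
  using action_add[of x g "- g"] action_add[of x "- g" g] action_0 by auto

lemma rn_cocycle_measurable: "rn_cocycle M act g \<in> borel_measurable M"
  unfolding rn_cocycle_def by measurable

lemma AE_action:
  assumes "AE x in M. P x"
  shows "AE x in M. P (act g x)"
proof -
  note [measurable] = action_measurable
  have "absolutely_continuous M (distr M M (act g))"
    using ns by (simp add: nonsingular_action_def absolutely_continuous_def)
  then have "AE x in distr M M (act g). P x"
    by (rule absolutely_continuous_AE[rotated]) (use assms in auto)
  then show ?thesis by (rule AE_distrD[rotated]) simp
qed

lemma AE_rn_cocycle_add:
  "AE x in M. rn_cocycle M act (g + h) x = rn_cocycle M act g (act h x) * rn_cocycle M act h x"
proof -
  note [measurable] = action_measurable rn_cocycle_measurable
  let ?f = "\<lambda>x. ennreal (rn_cocycle M act (g + h) x)"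
  let ?f' = "\<lambda>x. ennreal (rn_cocycle M act g (act h x)) * ennreal (rn_cocycle M act h x)"
  have "density M ?f = density M ?f'"
  proof (rule measure_eqI)
    fix A assume "A \<in> sets (density M ?f)"
    then have [measurable]: "A \<in> sets M" by simp
    let ?F = "\<lambda>x. indicator A (act (- h) x) * ennreal (rn_cocycle M act g x)"
    have "emeasure (density M ?f') A = (\<integral>\<^sup>+x. ?F (act h x) * ennreal (rn_cocycle M act h x) \<partial>M)"
      by (subst emeasure_density) (auto intro!: nn_integral_cong simp: action_inverse ac_simps)
    also have "\<dots> = (\<integral>\<^sup>+x. ?F (act h (act (- h) x)) \<partial>M)"
      by (rule rn_cocycle_nn_integral[OF ns, of "\<lambda>x. ?F (act h x)"]) measurable
    also have "\<dots> = (\<integral>\<^sup>+x. ?F x \<partial>M)"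
      by (intro nn_integral_cong) (simp add: action_inverse)
    also have "\<dots> = (\<integral>\<^sup>+x. indicator A (act (- h) (act (- g) x)) \<partial>M)"
      by (rule rn_cocycle_nn_integral[OF ns]) measurable
    also have "\<dots> = (\<integral>\<^sup>+x. indicator A (act (- (g + h)) x) \<partial>M)"
    proof (rule nn_integral_cong)
      fix x assume "x \<in> space M"
      then show "indicator A (act (- h) (act (- g) x)) = (indicator A (act (- (g + h)) x) :: ennreal)"
        using action_add[of x "- h" "- g"] by (simp only: minus_add_distrib add.commute[of "- g"])
    qed
    also have "\<dots> = (\<integral>\<^sup>+x. indicator A x * ?f x \<partial>M)"
      by (rule rn_cocycle_nn_integral[OF ns, symmetric]) measurable
    also have "\<dots> = emeasure (density M ?f) A"
      by (subst emeasure_density) (auto intro!: nn_integral_cong simp: ac_simps)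
    finally show "emeasure (density M ?f) A = emeasure (density M ?f') A" ..
  qed simp
  then have "AE x in M. ?f x = ?f' x"
    by (subst (asm) M.density_unique_iff) auto
  then show ?thesis
  proof eventually_elim
    case (elim x)
    have nn: "0 \<le> rn_cocycle M act g x" for g x by (simp add: rn_cocycle_def)
    show ?case using elim nn by (simp add: ennreal_mult[symmetric])
  qed
qed

lemma maharam_action_measurable:
  "maharam_action M act g \<in> maharam_measure M \<rightarrow>\<^sub>M maharam_measure M"
proof -
  note [measurable] = action_measurable rn_cocycle_measurable
  show ?thesis unfolding maharam_action_def maharam_measure_def by measurable
qed

lemma sigma_finite_maharam_measure: "sigma_finite_measure (maharam_measure M)"
proof -
  interpret E: sigma_finite_measure exp_measure by (rule sigma_finite_exp_measure)
  interpret pair_sigma_finite M exp_measure ..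
  show ?thesis unfolding maharam_measure_def by (rule sigma_finite_measure_axioms)
qed

lemma distr_maharam_action:
  "distr (maharam_measure M) (maharam_measure M) (maharam_action M act g) = maharam_measure M"
proof (rule measure_eqI)
  note [measurable] = action_measurable rn_cocycle_measurable
  interpret E: sigma_finite_measure exp_measure by (rule sigma_finite_exp_measure)
  fix A assume "A \<in> sets (distr (maharam_measure M) (maharam_measure M) (maharam_action M act g))"
  then have A: "A \<in> sets (maharam_measure M)" by simp
  then have A1 [measurable]: "A \<in> sets (M \<Otimes>\<^sub>M exp_measure)" unfolding maharam_measure_def .
  have A2 [measurable]: "A \<in> sets (M \<Otimes>\<^sub>M borel)"
  proof -
    have "sets (M \<Otimes>\<^sub>M exp_measure) = sets (M \<Otimes>\<^sub>M borel)" by (rule sets_pair_measure_cong) simp_all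
    then show ?thesis using A unfolding maharam_measure_def by blast
  qed
  let ?H = "\<lambda>x. \<integral>\<^sup>+s. indicator A (x, s) \<partial>exp_measure"
  have [measurable]: "?H \<in> borel_measurable M" by measurable
  have m': "maharam_action M act g \<in> M \<Otimes>\<^sub>M exp_measure \<rightarrow>\<^sub>M M \<Otimes>\<^sub>M exp_measure"
    using maharam_action_measurable by (simp add: maharam_measure_def)
  have "emeasure (distr (maharam_measure M) (maharam_measure M) (maharam_action M act g)) A =
      (\<integral>\<^sup>+z. indicator A z \<partial>distr (maharam_measure M) (maharam_measure M) (maharam_action M act g))"
    using A by simp
  also have "\<dots> = (\<integral>\<^sup>+z. indicator A (maharam_action M act g z) \<partial>maharam_measure M)"
    using A by (intro nn_integral_distr maharam_action_measurable) simp
  also have "\<dots> = (\<integral>\<^sup>+z. indicator A (maharam_action M act g z) \<partial>(M \<Otimes>\<^sub>M exp_measure))"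
    unfolding maharam_measure_def ..
  also have "\<dots> = (\<integral>\<^sup>+x. \<integral>\<^sup>+s. indicator A (maharam_action M act g (x, s)) \<partial>exp_measure \<partial>M)"
    by (rule E.nn_integral_fst[symmetric], rule measurable_compose[OF m'], rule borel_measurable_indicator[OF A1])
  also have "\<dots> = (\<integral>\<^sup>+x. ?H (act g x) * ennreal (rn_cocycle M act g x) \<partial>M)"
  proof (rule nn_integral_cong_AE)
    show "AE x in M. (\<integral>\<^sup>+s. indicator A (maharam_action M act g (x, s)) \<partial>exp_measure) =
        ?H (act g x) * ennreal (rn_cocycle M act g x)"
      using AE_rn_cocycle[OF ns, of g] AE_space
    proof eventually_elim
      case (elim x)
      have "act g x \<in> space M" using elim measurable_space[OF action_measurable] by blast
      then have [measurable]: "(\<lambda>s. indicator A (act g x, s) :: ennreal) \<in> borel_measurable borel"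
        by measurable
      show ?case
        unfolding maharam_action_def split_conv
        by (subst nn_integral_exp_measure_shift[where f = "\<lambda>s. indicator A (act g x, s)"])
          (use elim in \<open>auto simp: exp_ln mult.commute\<close>)
    qed
  qed
  also have "\<dots> = (\<integral>\<^sup>+x. ?H (act g (act (- g) x)) \<partial>M)"
    by (rule rn_cocycle_nn_integral[OF ns, of "\<lambda>x. ?H (act g x)"]) measurable
  also have "\<dots> = (\<integral>\<^sup>+x. ?H x \<partial>M)"
    by (intro nn_integral_cong) (simp add: action_inverse)
  also have "\<dots> = emeasure (maharam_measure M) A"
    unfolding maharam_measure_def by (rule E.emeasure_pair_measure[symmetric]) measurable
  finally show "emeasure (distr (maharam_measure M) (maharam_measure M) (maharam_action M act g)) A =
      emeasure (maharam_measure M) A" .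
qed simp

lemma near_action_diagonal_maharam:
  assumes pmp: "pmp_action N act'"
  shows "near_action (N \<Otimes>\<^sub>M maharam_measure M) (diagonal_action act' (maharam_action M act))"
proof -
  note [measurable] = action_measurable rn_cocycle_measurable maharam_action_measurable
  let ?m = "N \<Otimes>\<^sub>M maharam_measure M" and ?\<tau> = "diagonal_action act' (maharam_action M act)"
  interpret N: prob_space N using pmp by (simp add: pmp_action_def)
  interpret mm: sigma_finite_measure "maharam_measure M" by (rule sigma_finite_maharam_measure)
  interpret pair_sigma_finite N "maharam_measure M" ..
  have ns': "nonsingular_action N act'" using pmp by (simp add: pmp_action_def)
  have [measurable]: "act' g \<in> N \<rightarrow>\<^sub>M N" for g using ns' by (simp add: nonsingular_action_def)
  have N_add: "act' (g + h) y = act' g (act' h y)" "act' 0 y = y" if "y \<in> space N" for g h y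
    using ns' that by (auto simp only: nonsingular_action_def)
  have add: "AE x in M. \<forall>g h. 0 < rn_cocycle M act h x \<and> 0 < rn_cocycle M act g (act h x) \<and>
      rn_cocycle M act (g + h) x = rn_cocycle M act g (act h x) * rn_cocycle M act h x"
    unfolding AE_all_countable
  proof (intro allI)
    fix g h
    show "AE x in M. 0 < rn_cocycle M act h x \<and> 0 < rn_cocycle M act g (act h x) \<and>
      rn_cocycle M act (g + h) x = rn_cocycle M act g (act h x) * rn_cocycle M act h x"
      using AE_rn_cocycle[OF ns, of h] AE_action[OF AE_rn_cocycle[OF ns, of g], of h] AE_rn_cocycle_add[of g h]
      by eventually_elim simp
  qed
  have add': "AE z in ?m. \<forall>g h. 0 < rn_cocycle M act h (fst (snd z)) \<and> 0 < rn_cocycle M act g (act h (fst (snd z))) \<and>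
      rn_cocycle M act (g + h) (fst (snd z)) = rn_cocycle M act g (act h (fst (snd z))) * rn_cocycle M act h (fst (snd z))"
    by (intro AE_pair_snd mm.sigma_finite_measure_axioms)
      (unfold maharam_measure_def, intro AE_pair_fst sigma_finite_exp_measure add)
  show ?thesis
  proof
    show "?\<tau> g \<in> ?m \<rightarrow>\<^sub>M ?m" for g
      unfolding diagonal_action_def by measurable
    show "distr ?m ?m (?\<tau> g) = ?m" for g
    proof -
      have "distr N N (act' g) \<Otimes>\<^sub>M distr (maharam_measure M) (maharam_measure M) (maharam_action M act g) =
        distr ?m ?m (\<lambda>(x, y). (act' g x, maharam_action M act g y))"
        by (rule pair_measure_distr)
          (simp_all add: distr_maharam_action mm.sigma_finite_measure_axioms)
      then show ?thesis using pmp by (simp add: distr_maharam_action pmp_action_def diagonal_action_def)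
    qed
    show "AE z in ?m. \<forall>g h. ?\<tau> (g + h) z = ?\<tau> g (?\<tau> h z)"
      using add' AE_space
    proof eventually_elim
      case (elim z)
      obtain y x s where z: "z = (y, x, s)" by (cases z) auto
      have sp: "y \<in> space N" "x \<in> space M"
        using elim(2) by (auto simp: z space_pair_measure maharam_measure_def)
      have "rn_cocycle M act h x \<noteq> 0" "rn_cocycle M act g (act h x) \<noteq> 0" for g h
        using elim(1)[rule_format, of h g] by (simp_all add: z)
      then show ?case
        using elim(1) sp by (auto simp: z diagonal_action_def maharam_action_def N_add action_add ln_mult)
    qed
    show "AE z in ?m. ?\<tau> 0 z = z"
      using add' AE_space
    proof eventually_elim
      case (elim z)
      obtain y x s where z: "z = (y, x, s)" by (cases z) auto
      have sp: "y \<in> space N" "x \<in> space M"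
        using elim(2) by (auto simp: z space_pair_measure maharam_measure_def)
      have "rn_cocycle M act 0 x = 1"
        using elim(1)[rule_format, of 0 0] sp by (auto simp: z action_0)
      then show ?case
        using sp by (auto simp: z diagonal_action_def maharam_action_def N_add action_0)
    qed
  qed
qed

end


section \<open>Families of independent coins\<close>

text \<open>Two measures at once, since the comparison of product measures needs one approximating set that is good for
both.\<close>

lemma approximation_by_algebra:
  assumes fin: "finite_measure P" "finite_measure Q" and sets_Q: "sets Q = sets P"
    and alg: "algebra (space P) \<A>" and sets_P: "sets P = sigma_sets (space P) \<A>"
    and S: "S \<in> sets P" and \<epsilon>: "0 < (\<epsilon>::real)"
  shows "\<exists>S'\<in>\<A>. measure P (sym_diff S S') < \<epsilon> \<and> measure Q (sym_diff S S') < \<epsilon>"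
proof -
  interpret P: finite_measure P by fact
  interpret Q: finite_measure Q by fact
  interpret alg: algebra "space P" \<A> by fact
  have sub: "\<A> \<subseteq> sets P" by (auto simp: sets_P)
  have sp: "space Q = space P" using sets_Q by (rule sets_eq_imp_space_eq)
  from S have "S \<in> sigma_sets (space P) \<A>" using sets_P by simp
  then show ?thesis using \<epsilon>
  proof (induction arbitrary: \<epsilon> rule: sigma_sets.induct)
    case (Basic a)
    then show ?case by (intro bexI[of _ a]) auto
  next
    case Empty
    then show ?case by (intro bexI[of _ "{}"]) auto
  next
    case (Compl a)
    then obtain S' where S': "S' \<in> \<A>" "measure P (sym_diff a S') < \<epsilon>" "measure Q (sym_diff a S') < \<epsilon>" by blast
    have "a \<subseteq> space P" using Compl.hyps sigma_sets_into_sp[OF alg.space_closed] by blast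
    then have "sym_diff (space P - a) (space P - S') = sym_diff a S'"
      using S'(1) alg.space_closed by auto
    then show ?case using S' by (intro bexI[of _ "space P - S'"]) auto
  next
    case (Union a)
    have a: "a i \<in> sets P" for i using Union.hyps sets_P by auto
    have a': "a i \<in> sets Q" for i by (simp add: a sets_Q)
    define U where "U n = (\<Union>i. a i) - (\<Union>i<n. a i)" for n
    have U_lim: "(\<lambda>n. measure R (U n)) \<longlonglongrightarrow> 0" if "finite_measure R" "\<And>i. a i \<in> sets R" for R
    proof -
      interpret R: finite_measure R by fact
      have "range a \<subseteq> sets R" using that(2) by (rule image_subsetI)
      then have "U n \<in> sets R" for n
        unfolding U_def by (intro sets.Diff sets.countable_UN sets.finite_UN that(2)) simp_all
      then have "range U \<subseteq> sets R" by (rule image_subsetI)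
      moreover have "decseq U" unfolding decseq_def U_def by (intro allI impI Diff_mono UN_mono) auto
      ultimately have "(\<lambda>n. measure R (U n)) \<longlonglongrightarrow> measure R (\<Inter>n. U n)"
        by (rule R.finite_Lim_measure_decseq)
      moreover have "(\<Inter>n. U n) = {}" by (auto simp: U_def)
      ultimately show ?thesis by simp
    qed
    have "\<forall>\<^sub>F n in sequentially. measure P (U n) < \<epsilon> / 2 \<and> measure Q (U n) < \<epsilon> / 2"
      using Union.prems
      by (intro eventually_conj order_tendstoD(2)[OF U_lim[OF fin(1) a]] order_tendstoD(2)[OF U_lim[OF fin(2) a']])
        simp_all
    then obtain n where n: "measure P (U n) < \<epsilon> / 2" "measure Q (U n) < \<epsilon> / 2"
      by (auto simp: eventually_sequentially)
    \<comment> \<open>Half of \<open>\<epsilon>\<close> is spent on the tail of the union, the other half on its first \<open>n\<close> sets.\<close>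
    define \<epsilon>' where "\<epsilon>' = \<epsilon> / (2 * (real n + 1))"
    have "0 < \<epsilon>'" using Union.prems by (simp add: \<epsilon>'_def)
    then have "\<forall>i. \<exists>S'\<in>\<A>. measure P (sym_diff (a i) S') < \<epsilon>' \<and> measure Q (sym_diff (a i) S') < \<epsilon>'"
      using Union.IH by blast
    then obtain b where b: "\<And>i. b i \<in> \<A>" "\<And>i. measure P (sym_diff (a i) (b i)) < \<epsilon>'"
        "\<And>i. measure Q (sym_diff (a i) (b i)) < \<epsilon>'" by metis
    have bs: "b i \<in> sets P" for i using b(1)[of i] sub by blast
    have incl: "sym_diff (\<Union>i. a i) (\<Union>i<n. b i) \<subseteq> U n \<union> (\<Union>i<n. sym_diff (a i) (b i))"
      by (auto simp: U_def)
    have *: "measure R (sym_diff (\<Union>i. a i) (\<Union>i<n. b i)) < \<epsilon>"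
      if "finite_measure R" "\<And>i. a i \<in> sets R" "\<And>i. b i \<in> sets R" "measure R (U n) < \<epsilon> / 2"
        "\<And>i. measure R (sym_diff (a i) (b i)) < \<epsilon>'" for R
    proof -
      interpret R: finite_measure R by fact
      have "range a \<subseteq> sets R" using that(2) by (rule image_subsetI)
      then have m1: "U n \<in> sets R"
        unfolding U_def by (intro sets.Diff sets.countable_UN sets.finite_UN that(2)) simp_all
      have m2: "sym_diff (a i) (b i) \<in> sets R" for i
        by (intro sets.Un sets.Diff that)
      have m3: "(\<Union>i<n. sym_diff (a i) (b i)) \<in> sets R"
        by (intro sets.finite_UN m2) simp
      have "measure R (sym_diff (\<Union>i. a i) (\<Union>i<n. b i)) \<le> measure R (U n \<union> (\<Union>i<n. sym_diff (a i) (b i)))"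
        by (rule R.finite_measure_mono[OF incl]) (intro sets.Un m1 m3)
      also have "\<dots> \<le> measure R (U n) + measure R (\<Union>i<n. sym_diff (a i) (b i))"
        by (rule measure_Un_le[OF m1 m3])
      also have "measure R (\<Union>i<n. sym_diff (a i) (b i)) \<le> (\<Sum>i<n. measure R (sym_diff (a i) (b i)))"
        by (rule R.finite_measure_subadditive_finite[OF _ image_subsetI[OF m2]]) simp
      also have "\<dots> \<le> (\<Sum>i<n. \<epsilon>')" using that(5) by (intro sum_mono less_imp_le)
      also have "\<dots> \<le> \<epsilon> / 2" using Union.prems by (simp add: \<epsilon>'_def field_simps)
      finally show ?thesis using that(4) by simp
    qed
    have "(\<Union>i<n. b i) \<in> \<A>" using b(1) by (intro alg.finite_UN) auto
    moreover have "measure P (sym_diff (\<Union>i. a i) (\<Union>i<n. b i)) < \<epsilon>"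
      by (rule *[OF fin(1) a bs n(1) b(2)])
    moreover have "measure Q (sym_diff (\<Union>i. a i) (\<Union>i<n. b i)) < \<epsilon>"
      by (rule *[OF fin(2) a' _ n(2) b(3)]) (simp add: bs sets_Q)
    ultimately show ?case by blast
  qed
qed

text \<open>The coins are given by coordinate maps on an arbitrary space rather than as a product space, so that a power
of the Bernoulli space, which is a product of products, is an instance.\<close>

locale coin_process = prob_space M
  for M :: "'a measure" and I :: "'i set" and c :: "'i \<Rightarrow> 'a \<Rightarrow> bool" and q :: "'i \<Rightarrow> bool pmf" +
  assumes sets_generated: "sets M = sigma_sets (space M) {{x\<in>space M. c i x} | i. i \<in> I}"
    and prob_cylinder: "\<And>J v. finite J \<Longrightarrow> J \<subseteq> I \<Longrightarrow>
      prob {x\<in>space M. \<forall>j\<in>J. c j x = v j} = (\<Prod>j\<in>J. pmf (q j) (v j))"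
begin

lemma coordinate_measurable [measurable]: "i \<in> I \<Longrightarrow> Measurable.pred M (c i)"
  by (subst pred_def) (auto simp: sets_generated)

lemma coordinate_sets:
  assumes "i \<in> I" shows "{x\<in>space M. c i x = b} \<in> sets M"
proof -
  have *: "{x\<in>space M. c i x} \<in> sets M" using assms sets_generated by auto
  have "{x\<in>space M. \<not> c i x} = space M - {x\<in>space M. c i x}" by blast
  then have "{x\<in>space M. \<not> c i x} \<in> sets M" using sets.Diff[OF sets.top *] by simp
  with * show ?thesis by (cases b) simp_all
qed

lemma cylinder_sets:
  assumes "finite J" "J \<subseteq> I"
  shows "{x\<in>space M. \<forall>j\<in>J. c j x = v j} \<in> sets M"
proof -
  have "{x\<in>space M. c j x = v j} \<in> sets M" if "j \<in> J" for j
    using that assms by (intro coordinate_sets) auto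
  then show ?thesis using assms(1) by (rule sets.sets_Collect_finite_All)
qed

lemma coordinate_map_measurable:
  assumes f: "f \<in> space N \<rightarrow> space M" and c: "\<And>i. i \<in> I \<Longrightarrow> Measurable.pred N (\<lambda>x. c i (f x))"
  shows "f \<in> N \<rightarrow>\<^sub>M M"
proof (rule measurable_sigma_sets[OF sets_generated])
  show "f -` A \<inter> space N \<in> sets N" if A: "A \<in> {{x\<in>space M. c i x} | i. i \<in> I}" for A
  proof -
    obtain i where i: "i \<in> I" "A = {x\<in>space M. c i x}" using A by auto
    have "f -` A \<inter> space N = {x\<in>space N. c i (f x)}" using f i by auto
    then show ?thesis using pred_def[THEN iffD1, OF c[OF i(1)]] by simp
  qed
qed (use f in auto)

lemma measure_eqI_cylinders:
  assumes P: "sets P = sets M" and Q: "sets Q = sets M" and fin: "finite_measure P"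
    and eq: "\<And>J. finite J \<Longrightarrow> J \<subseteq> I \<Longrightarrow>
      emeasure P {x\<in>space M. \<forall>j\<in>J. c j x} = emeasure Q {x\<in>space M. \<forall>j\<in>J. c j x}"
  shows "P = Q"
proof -
  let ?E = "{{x\<in>space M. \<forall>j\<in>J. c j x} | J. finite J \<and> J \<subseteq> I}"
  interpret P: finite_measure P by fact
  have E: "sets M = sigma_sets (space M) ?E"
  proof (rule antisym)
    show "sets M \<subseteq> sigma_sets (space M) ?E"
      unfolding sets_generated
    proof (rule sigma_sets_mono', safe)
      fix i assume "i \<in> I"
      then show "\<exists>J. {x\<in>space M. c i x} = {x\<in>space M. \<forall>j\<in>J. c j x} \<and> finite J \<and> J \<subseteq> I"
        by (intro exI[of _ "{i}"]) auto
    qed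
    have "?E \<subseteq> sets M" using cylinder_sets[of _ "\<lambda>_. True"] by auto
    then show "sigma_sets (space M) ?E \<subseteq> sets M" by (rule sets.sigma_sets_subset)
  qed
  show ?thesis
  proof (rule measure_eqI_generator_eq[where E = ?E and A = "\<lambda>_. space M" and \<Omega> = "space M"])
    show "Int_stable ?E"
    proof (rule Int_stableI)
      fix a b assume "a \<in> ?E" "b \<in> ?E"
      then obtain J K where "a = {x\<in>space M. \<forall>j\<in>J. c j x}" "finite J" "J \<subseteq> I"
        "b = {x\<in>space M. \<forall>j\<in>K. c j x}" "finite K" "K \<subseteq> I" by auto
      then have "a \<inter> b = {x\<in>space M. \<forall>j\<in>J \<union> K. c j x}" "finite (J \<union> K)" "J \<union> K \<subseteq> I" by auto
      then show "a \<inter> b \<in> ?E" by blast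
    qed
    show "range (\<lambda>_. space M) \<subseteq> ?E" by (auto intro!: exI[of _ "{}"])
  qed (use E P Q eq in auto)
qed

definition depends_on :: "'i set \<Rightarrow> 'a set \<Rightarrow> bool" where
  "depends_on J S \<longleftrightarrow> (\<forall>x\<in>space M. \<forall>y\<in>space M. (\<forall>j\<in>J. c j x = c j y) \<longrightarrow> (x \<in> S \<longleftrightarrow> y \<in> S))"

definition finite_dim_sets :: "'a set set" where
  "finite_dim_sets = {S\<in>sets M. \<exists>J. finite J \<and> J \<subseteq> I \<and> depends_on J S}"

lemma algebra_finite_dim_sets: "algebra (space M) finite_dim_sets"
proof (rule algebra_iff_Un[THEN iffD2], intro conjI ballI)
  show "finite_dim_sets \<subseteq> Pow (space M)" by (auto simp: finite_dim_sets_def dest: sets.sets_into_space)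
  show "{} \<in> finite_dim_sets" by (auto simp: finite_dim_sets_def depends_on_def)
  show "space M - S \<in> finite_dim_sets" if "S \<in> finite_dim_sets" for S
    using that by (fastforce simp: finite_dim_sets_def depends_on_def)
  show "S \<union> T \<in> finite_dim_sets" if "S \<in> finite_dim_sets" "T \<in> finite_dim_sets" for S T
  proof -
    obtain J K where *: "S \<in> sets M" "finite J" "J \<subseteq> I" "depends_on J S" "T \<in> sets M" "finite K" "K \<subseteq> I" "depends_on K T"
      using \<open>S \<in> finite_dim_sets\<close> \<open>T \<in> finite_dim_sets\<close> unfolding finite_dim_sets_def by blast
    have "depends_on (J \<union> K) (S \<union> T)"
      unfolding depends_on_def
    proof (intro ballI impI)
      fix x y assume xy: "x \<in> space M" "y \<in> space M" "\<forall>j\<in>J \<union> K. c j x = c j y"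
      have "x \<in> S \<longleftrightarrow> y \<in> S" using *(4) xy unfolding depends_on_def by (meson UnI1)
      moreover have "x \<in> T \<longleftrightarrow> y \<in> T" using *(8) xy unfolding depends_on_def by (meson UnI2)
      ultimately show "x \<in> S \<union> T \<longleftrightarrow> y \<in> S \<union> T" by simp
    qed
    moreover have "finite (J \<union> K)" "J \<union> K \<subseteq> I" "S \<union> T \<in> sets M" using * by simp_all
    ultimately show ?thesis unfolding finite_dim_sets_def by blast
  qed
qed

lemma sets_finite_dim: "sets M = sigma_sets (space M) finite_dim_sets"
proof (rule antisym)
  show "sets M \<subseteq> sigma_sets (space M) finite_dim_sets"
    by (subst sets_generated, rule sigma_sets_mono')
      (auto simp: finite_dim_sets_def sets_generated depends_on_def intro!: exI[of _ "{_}"])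
  show "sigma_sets (space M) finite_dim_sets \<subseteq> sets M"
    by (rule sets.sigma_sets_subset) (auto simp: finite_dim_sets_def)
qed

lemma prob_finite_dim:
  assumes J: "finite J" "J \<subseteq> I" and S: "S \<in> sets M" "depends_on J S"
  shows "prob S = (\<Sum>v\<in>(\<lambda>x. restrict (\<lambda>j. c j x) J) ` S. \<Prod>j\<in>J. pmf (q j) (v j))"
proof -
  let ?V = "(\<lambda>x. restrict (\<lambda>j. c j x) J) ` S"
  let ?C = "\<lambda>v. {x\<in>space M. \<forall>j\<in>J. c j x = v j}"
  have V: "?V \<subseteq> PiE J (\<lambda>_. UNIV)" by auto
  have fin: "finite ?V" by (rule finite_subset[OF V]) (simp add: J finite_PiE)
  have SM: "S \<subseteq> space M" using S(1) by (rule sets.sets_into_space)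
  have "S = (\<Union>v\<in>?V. ?C v)"
  proof (intro equalityI subsetI)
    fix x assume "x \<in> S"
    then show "x \<in> (\<Union>v\<in>?V. ?C v)" using SM by auto
  next
    fix x assume "x \<in> (\<Union>v\<in>?V. ?C v)"
    then obtain y where "y \<in> S" "x \<in> space M" "\<forall>j\<in>J. c j x = c j y" by auto
    then show "x \<in> S" using S(2) SM unfolding depends_on_def by blast
  qed
  then have "prob S = prob (\<Union>v\<in>?V. ?C v)" by simp
  also have "\<dots> = (\<Sum>v\<in>?V. prob (?C v))"
  proof (rule finite_measure_finite_Union[OF fin])
    show "?C ` ?V \<subseteq> events" using J cylinder_sets by auto
    show "disjoint_family_on ?C ?V"
      unfolding disjoint_family_on_def
    proof (intro ballI impI)
      fix v w assume vw: "v \<in> ?V" "w \<in> ?V" "v \<noteq> w"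
      have "v \<in> PiE J (\<lambda>_. UNIV)" "w \<in> PiE J (\<lambda>_. UNIV)" using vw(1,2) V by blast+
      then have "\<exists>j\<in>J. v j \<noteq> w j" using vw(3) PiE_ext[of v J "\<lambda>_. UNIV" w] by blast
      then show "?C v \<inter> ?C w = {}" by fastforce
    qed
  qed
  also have "\<dots> = (\<Sum>v\<in>?V. \<Prod>j\<in>J. pmf (q j) (v j))"
    using prob_cylinder[OF J] by simp
  finally show ?thesis .
qed

end

text \<open>For sets that depend on finitely many coins this is the Cauchy-Schwarz inequality, where \<open>K\<close> bounds the
squared norms of the densities of finite-dimensional marginals. The bound is uniform, so it passes to the limit. It replaces
Kakutani's theorem, and its explicit constant is what the recurrence estimate needs.\<close>

lemma coin_process_comparison:
  assumes M: "coin_process M I c q" and M': "coin_process M' I c q'" and sets_eq: "sets M' = sets M"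
    and pos: "\<And>i b. i \<in> I \<Longrightarrow> 0 < pmf (q i) b"
    and K: "\<And>J. finite J \<Longrightarrow> J \<subseteq> I \<Longrightarrow> (\<Prod>j\<in>J. \<Sum>b\<in>UNIV. (pmf (q' j) b)\<^sup>2 / pmf (q j) b) \<le> K"
    and S: "S \<in> sets M"
  shows "(measure M' S)\<^sup>2 \<le> K * measure M S"
proof -
  interpret M: coin_process M I c q by fact
  interpret M': coin_process M' I c q' by fact
  have sp: "space M' = space M" using sets_eq by (rule sets_eq_imp_space_eq)
  have K1: "1 \<le> K" using K[of "{}"] by simp
  have fd: "(measure M' S)\<^sup>2 \<le> K * measure M S" if fdS: "S \<in> M.finite_dim_sets" for S
  proof -
    obtain J where J: "finite J" "J \<subseteq> I" "M.depends_on J S" and S: "S \<in> sets M"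
      using fdS unfolding M.finite_dim_sets_def by blast
    have dep': "M'.depends_on J S" using J(3) unfolding M.depends_on_def M'.depends_on_def sp .
    let ?V = "(\<lambda>x. restrict (\<lambda>j. c j x) J) ` S"
    let ?p = "\<lambda>v. \<Prod>j\<in>J. pmf (q j) (v j)" and ?p' = "\<lambda>v. \<Prod>j\<in>J. pmf (q' j) (v j)"
    have V: "?V \<subseteq> PiE J (\<lambda>_. UNIV)" by auto
    have finPi: "finite (PiE J (\<lambda>_. UNIV :: bool set))" by (simp add: J finite_PiE)
    have p_pos: "0 < ?p v" for v using J pos by (intro prod_pos) auto
    have "(measure M' S)\<^sup>2 = (\<Sum>v\<in>?V. (?p' v / sqrt (?p v)) * sqrt (?p v))\<^sup>2"
      using M'.prob_finite_dim[OF J(1,2) _ dep'] S sets_eq p_pos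
      by (auto intro!: arg_cong[where f = "\<lambda>x. x\<^sup>2"] sum.cong simp: less_imp_neq[OF p_pos, symmetric])
    also have "\<dots> \<le> (\<Sum>v\<in>?V. (?p' v / sqrt (?p v))\<^sup>2) * (\<Sum>v\<in>?V. (sqrt (?p v))\<^sup>2)"
      by (rule Cauchy_Schwarz_ineq_sum)
    also have "(\<Sum>v\<in>?V. (sqrt (?p v))\<^sup>2) = measure M S"
      using M.prob_finite_dim[OF J(1,2) S J(3)] p_pos by (simp add: less_imp_le)
    also have "(\<Sum>v\<in>?V. (?p' v / sqrt (?p v))\<^sup>2) = (\<Sum>v\<in>?V. \<Prod>j\<in>J. (pmf (q' j) (v j))\<^sup>2 / pmf (q j) (v j))"
      using p_pos by (intro sum.cong) (auto simp: power_divide less_imp_le prod_dividef prod_power_distrib)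
    also have "\<dots> \<le> (\<Sum>v\<in>PiE J (\<lambda>_. UNIV). \<Prod>j\<in>J. (pmf (q' j) (v j))\<^sup>2 / pmf (q j) (v j))"
      by (rule sum_mono2[OF finPi V]) (auto intro!: prod_nonneg)
    also have "\<dots> = (\<Prod>j\<in>J. \<Sum>b\<in>UNIV. (pmf (q' j) b)\<^sup>2 / pmf (q j) b)"
      using J by (intro prod_sum_PiE[symmetric]) auto
    also have "\<dots> \<le> K" by (rule K[OF J(1,2)])
    finally show ?thesis by (simp add: mult_right_mono)
  qed
  have approx: "(measure M' S - \<epsilon>)\<^sup>2 \<le> K * (measure M S + \<epsilon>)" if eps: "0 < \<epsilon>" "\<epsilon> < measure M' S" for \<epsilon> :: real
  proof -
    obtain S' where S': "S' \<in> M.finite_dim_sets" "measure M (sym_diff S S') < \<epsilon>" "measure M' (sym_diff S S') < \<epsilon>"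
      using approximation_by_algebra[OF M.finite_measure_axioms M'.finite_measure_axioms sets_eq
        M.algebra_finite_dim_sets M.sets_finite_dim S eps(1)] by blast
    have S'm: "S' \<in> sets M" using S'(1) by (simp add: M.finite_dim_sets_def)
    have le: "measure R A \<le> measure R B + measure R (sym_diff A B)"
      if "finite_measure R" "A \<in> sets R" "B \<in> sets R" for R and A B :: "'a set"
    proof -
      interpret R: finite_measure R by fact
      have "measure R A \<le> measure R (B \<union> sym_diff A B)"
        using that by (intro R.finite_measure_mono) auto
      also have "\<dots> \<le> measure R B + measure R (sym_diff A B)"
        using that by (intro measure_Un_le) auto
      finally show ?thesis .
    qed
    have "measure M' S \<le> measure M' S' + measure M' (sym_diff S S')"
      using S S'm sets_eq by (intro le M'.finite_measure_axioms) auto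
    then have "measure M' S - \<epsilon> \<le> measure M' S'" using S' by simp
    then have "(measure M' S - \<epsilon>)\<^sup>2 \<le> (measure M' S')\<^sup>2" using eps by (intro power_mono) auto
    also have "\<dots> \<le> K * measure M S'" by (rule fd[OF S'(1)])
    also have "measure M S' \<le> measure M S + measure M (sym_diff S' S)"
      using S S'm by (intro le M.finite_measure_axioms) auto
    then have "K * measure M S' \<le> K * (measure M S + \<epsilon>)"
      using S'(2) K1 by (intro mult_left_mono) (auto simp: Un_commute)
    finally show ?thesis .
  qed
  show ?thesis
  proof (cases "measure M' S = 0")
    case True
    then show ?thesis using K1 by simp
  next
    case False
    then have p: "0 < measure M' S" by (simp add: zero_less_measure_iff)
    have "((\<lambda>\<epsilon>. (measure M' S - \<epsilon>)\<^sup>2) \<longlongrightarrow> (measure M' S - 0)\<^sup>2) (at_right 0)"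
      by (intro tendsto_intros)
    moreover have "((\<lambda>\<epsilon>. K * (measure M S + \<epsilon>)) \<longlongrightarrow> K * (measure M S + 0)) (at_right 0)"
      by (intro tendsto_intros)
    moreover have "\<forall>\<^sub>F \<epsilon> in at_right 0. (measure M' S - \<epsilon>)\<^sup>2 \<le> K * (measure M S + \<epsilon>)"
      using eventually_at_right_real[OF p] by eventually_elim (use approx in auto)
    ultimately show ?thesis
      by (intro tendsto_le[OF trivial_limit_at_right_real, of "\<lambda>\<epsilon>. K * (measure M S + \<epsilon>)" _ 0 "\<lambda>\<epsilon>. (measure M' S - \<epsilon>)\<^sup>2"]) auto
  qed
qed


text \<open>The number \<open>\<delta>\<close> keeps all coins uniformly away from being deterministic.\<close>

locale coin_flip = coin_process M I c q
  for M :: "'a measure" and I :: "'i set" and c :: "'i \<Rightarrow> 'a \<Rightarrow> bool" and q :: "'i \<Rightarrow> bool pmf" +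
  fixes flip :: "'i \<Rightarrow> 'a \<Rightarrow> 'a" and \<delta> :: real
  assumes flip_space: "\<And>i x. i \<in> I \<Longrightarrow> x \<in> space M \<Longrightarrow> flip i x \<in> space M"
    and coord_flip: "\<And>i j x. i \<in> I \<Longrightarrow> j \<in> I \<Longrightarrow> x \<in> space M \<Longrightarrow> c j (flip i x) = (c j x \<noteq> (i = j))"
    and separation: "\<And>x y. x \<in> space M \<Longrightarrow> y \<in> space M \<Longrightarrow> (\<And>i. i \<in> I \<Longrightarrow> c i x = c i y) \<Longrightarrow> x = y"
    and \<delta>_pos: "0 < \<delta>" and \<delta>_le: "\<And>i b. i \<in> I \<Longrightarrow> \<delta> \<le> pmf (q i) b"
begin

lemma pmf_pos: "i \<in> I \<Longrightarrow> 0 < pmf (q i) b"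
  using \<delta>_pos \<delta>_le[of i b] by linarith

lemma flip_flip: "i \<in> I \<Longrightarrow> x \<in> space M \<Longrightarrow> flip i (flip i x) = x"
  by (rule separation) (auto simp: coord_flip flip_space)

lemma flip_measurable [measurable]:
  assumes "i \<in> I" shows "flip i \<in> M \<rightarrow>\<^sub>M M"
proof (rule coordinate_map_measurable)
  show "flip i \<in> space M \<rightarrow> space M" using assms flip_space by auto
  show "Measurable.pred M (\<lambda>x. c j (flip i x))" if "j \<in> I" for j
  proof -
    have [measurable]: "Measurable.pred M (c j)" using that by (rule coordinate_measurable)
    have "Measurable.pred M (\<lambda>x. c j x \<noteq> (i = j))" by measurable
    then show ?thesis
      by (subst measurable_cong[where g = "\<lambda>x. c j x \<noteq> (i = j)"]) (use assms that coord_flip in auto)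
  qed
qed

definition odds :: "'i \<Rightarrow> bool \<Rightarrow> real" where
  "odds i b = pmf (q i) (\<not> b) / pmf (q i) b"

lemma odds_pos: "i \<in> I \<Longrightarrow> 0 < odds i b"
  by (simp add: odds_def pmf_pos)

lemma odds_le: "i \<in> I \<Longrightarrow> odds i b \<le> 1 / \<delta>"
  using \<delta>_le[of i b] \<delta>_pos pmf_le_1[of "q i" "\<not> b"]
  by (auto simp: odds_def intro!: frac_le)

lemma odds_measurable [measurable]: "i \<in> I \<Longrightarrow> (\<lambda>x. odds i (c i x)) \<in> borel_measurable M"
  by (rule measurable_compose[OF coordinate_measurable]) auto

lemma distr_flip:
  assumes i: "i \<in> I"
  shows "distr M M (flip i) = density M (\<lambda>x. ennreal (odds i (c i x)))"
proof (rule measure_eqI_cylinders)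
  note [measurable] = flip_measurable[OF i] odds_measurable[OF i]
  let ?D = "density M (\<lambda>x. ennreal (odds i (c i x)))"
  show "finite_measure (distr M M (flip i))" by (rule finite_measure_distr) measurable
  fix J assume J: "finite J" "J \<subseteq> I"
  define P where "P b = {x\<in>space M. \<forall>j\<in>insert i J. c j x = (if j = i then b else True)}" for b
  have Pm [measurable]: "P b \<in> sets M" for b
    unfolding P_def using J i by (intro cylinder_sets) auto
  have prP: "prob (P b) = pmf (q i) b * (\<Prod>j\<in>J - {i}. pmf (q j) True)" for b
  proof -
    have "prob (P b) = (\<Prod>j\<in>insert i J. pmf (q j) (if j = i then b else True))"
      unfolding P_def using J i by (intro prob_cylinder) auto
    also have "\<dots> = pmf (q i) b * (\<Prod>j\<in>J - {i}. pmf (q j) (if j = i then b else True))"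
      using J by (subst prod.insert_remove) auto
    also have "(\<Prod>j\<in>J - {i}. pmf (q j) (if j = i then b else True)) = (\<Prod>j\<in>J - {i}. pmf (q j) True)"
      by (intro prod.cong) auto
    finally show ?thesis .
  qed
  have eqP: "emeasure (distr M M (flip i)) (P b) = emeasure ?D (P b)" for b
  proof -
    have "flip i -` P b \<inter> space M = P (\<not> b)"
      using i J flip_space coord_flip by (auto simp: P_def subset_iff)
    then have "emeasure (distr M M (flip i)) (P b) = ennreal (prob (P (\<not> b)))"
      by (simp add: emeasure_distr emeasure_eq_measure)
    also have "prob (P (\<not> b)) = odds i b * prob (P b)"
      using pmf_pos[OF i, of b] by (simp add: prP odds_def)
    also have "ennreal (odds i b * prob (P b)) = (\<integral>\<^sup>+x. ennreal (odds i b) * indicator (P b) x \<partial>M)"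
      using odds_pos[OF i, of b] by (simp add: nn_integral_cmult_indicator emeasure_eq_measure ennreal_mult)
    also have "\<dots> = (\<integral>\<^sup>+x. ennreal (odds i (c i x)) * indicator (P b) x \<partial>M)"
      by (intro nn_integral_cong) (auto simp: P_def indicator_def)
    also have "\<dots> = emeasure ?D (P b)" by (simp add: emeasure_density)
    finally show ?thesis .
  qed
  show "emeasure (distr M M (flip i)) {x\<in>space M. \<forall>j\<in>J. c j x} = emeasure ?D {x\<in>space M. \<forall>j\<in>J. c j x}"
  proof (cases "i \<in> J")
    case True
    then have "{x\<in>space M. \<forall>j\<in>J. c j x} = P True" by (auto simp: P_def)
    then show ?thesis using eqP by simp
  next
    case False
    then have *: "{x\<in>space M. \<forall>j\<in>J. c j x} = P True \<union> P False" by (auto simp: P_def split: if_splits)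
    have "P True \<inter> P False = {}" by (auto simp: P_def)
    then show ?thesis unfolding * using eqP by (simp add: plus_emeasure[symmetric])
  qed
qed simp_all

lemma nn_integral_flip:
  assumes i: "i \<in> I" and [measurable]: "f \<in> borel_measurable M"
  shows "(\<integral>\<^sup>+x. f (flip i x) \<partial>M) = (\<integral>\<^sup>+x. f x * ennreal (odds i (c i x)) \<partial>M)"
proof -
  have "(\<integral>\<^sup>+x. f (flip i x) \<partial>M) = (\<integral>\<^sup>+x. f x \<partial>distr M M (flip i))"
    using i by (intro nn_integral_distr[symmetric]) auto
  also have "\<dots> = (\<integral>\<^sup>+x. ennreal (odds i (c i x)) * f x \<partial>M)"
    unfolding distr_flip[OF i] using i by (intro nn_integral_density) auto
  finally show ?thesis by (simp add: mult.commute)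
qed

text \<open>Flipping a coin changes a density between two laws by the quotient of their odds, as if the density were the
infinite product of the quotients of the weights. Uniqueness of densities gives this without writing
down that product.\<close>

lemma AE_density_flip:
  assumes "coin_flip M' I c q' flip \<delta>'" and M': "M' = density M f"
    and [measurable]: "f \<in> borel_measurable M" and i: "i \<in> I"
  shows "AE x in M. f (flip i x) * ennreal (odds i (c i x)) =
    ennreal (coin_flip.odds q' i (c i x)) * f x"
proof -
  interpret M': coin_flip M' I c q' flip \<delta>' by fact
  note [measurable] = flip_measurable[OF i] odds_measurable[OF i]
  have sets_M': "sets M' = sets M" and sp: "space M' = space M" by (auto simp: M')
  have om [measurable]: "(\<lambda>x. M'.odds i (c i x)) \<in> borel_measurable M"
    using M'.odds_measurable[OF i] measurable_cong_sets[OF sets_M' refl] by blast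
  have "density M (\<lambda>x. f (flip i x) * ennreal (odds i (c i x))) =
      density M (\<lambda>x. ennreal (M'.odds i (c i x)) * f x)" (is "?L = ?R")
  proof (rule measure_eqI)
    fix S assume "S \<in> sets ?L"
    then have [measurable]: "S \<in> sets M" by simp
    have "emeasure ?R S = (\<integral>\<^sup>+x. f x * (indicator S x * ennreal (M'.odds i (c i x))) \<partial>M)"
      by (simp add: emeasure_density ac_simps)
    also have "\<dots> = (\<integral>\<^sup>+x. indicator S x * ennreal (M'.odds i (c i x)) \<partial>M')"
      unfolding M' by (rule nn_integral_density[symmetric]) measurable
    also have "\<dots> = (\<integral>\<^sup>+x. indicator S (flip i x) \<partial>M')"
      by (rule M'.nn_integral_flip[OF i, symmetric], rule borel_measurable_indicator) (simp add: sets_M')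
    also have "\<dots> = (\<integral>\<^sup>+x. f x * indicator S (flip i x) \<partial>M)"
      unfolding M' by (rule nn_integral_density) measurable
    also have "\<dots> = (\<integral>\<^sup>+x. f (flip i (flip i x)) * indicator S (flip i x) \<partial>M)"
      by (intro nn_integral_cong) (simp add: flip_flip[OF i])
    also have "\<dots> = (\<integral>\<^sup>+x. (f (flip i x) * indicator S x) * ennreal (odds i (c i x)) \<partial>M)"
      by (rule nn_integral_flip[OF i, of "\<lambda>x. f (flip i x) * indicator S x"]) measurable
    also have "\<dots> = emeasure ?L S"
      by (simp add: emeasure_density ac_simps)
    finally show "emeasure ?L S = emeasure ?R S" ..
  qed simp
  then show ?thesis
    by (subst (asm) density_unique_iff) auto
qed

end


section \<open>Permuting the coins\<close>

text \<open>The sum is 1 plus \<open>d\<^sup>2 / (p (1 - p))\<close>, where \<open>d\<close> is the difference of the biases.\<close>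

lemma sum_square_quotient_le:
  fixes p p' :: "bool pmf"
  assumes \<delta>: "0 < \<delta>" "\<And>b. \<delta> \<le> pmf p b"
  shows "(\<Sum>b\<in>UNIV. (pmf p' b)\<^sup>2 / pmf p b) \<le> exp ((pmf p' True - pmf p True)\<^sup>2 / \<delta>\<^sup>2)"
proof -
  define a d where "a = pmf p True" and "d = pmf p' True - pmf p True"
  have F: "pmf p False = 1 - a" "pmf p' False = 1 - a - d" "pmf p' True = a + d"
    using pmf_True_conv_False[of p] pmf_True_conv_False[of p'] by (auto simp: a_def d_def pmf_False_conv_True)
  have a: "\<delta> \<le> a" "\<delta> \<le> 1 - a" using \<delta>(2)[of True] \<delta>(2)[of False] F by (auto simp: a_def)
  have pos: "0 < a" "0 < 1 - a" using a \<delta>(1) by auto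
  have "\<delta>\<^sup>2 \<le> a * (1 - a)" using a \<delta>(1) by (simp add: power2_eq_square mult_mono)
  then have le: "d\<^sup>2 / (a * (1 - a)) \<le> d\<^sup>2 / \<delta>\<^sup>2" using \<delta>(1) by (intro divide_left_mono) (use pos in auto)
  have "(\<Sum>b\<in>UNIV. (pmf p' b)\<^sup>2 / pmf p b) = (a + d)\<^sup>2 / a + (1 - a - d)\<^sup>2 / (1 - a)"
    by (simp add: UNIV_bool F a_def[symmetric])
  also have "\<dots> = 1 + d\<^sup>2 / (a * (1 - a))"
    using pos by (simp add: field_simps power2_eq_square)
  also have "\<dots> \<le> 1 + d\<^sup>2 / \<delta>\<^sup>2" using le by simp
  also have "\<dots> \<le> exp (d\<^sup>2 / \<delta>\<^sup>2)" by (rule exp_ge_add_one_self)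
  finally show ?thesis by (simp add: d_def)
qed

text \<open>The coin that shows at \<open>i\<close> after applying \<open>g\<close> is the one that was at \<open>\<pi> g i\<close>. The energy \<open>E g\<close> bounds the
squared distance between the biases before and after.\<close>

locale coin_action = coin_flip M I c q flip \<delta>
  for M :: "'a measure" and I :: "'i set" and c :: "'i \<Rightarrow> 'a \<Rightarrow> bool" and q :: "'i \<Rightarrow> bool pmf"
    and flip :: "'i \<Rightarrow> 'a \<Rightarrow> 'a" and \<delta> :: real +
  fixes act :: "int \<Rightarrow> 'a \<Rightarrow> 'a" and \<pi> :: "int \<Rightarrow> 'i \<Rightarrow> 'i" and E :: "int \<Rightarrow> real"
  assumes act_space: "\<And>g x. x \<in> space M \<Longrightarrow> act g x \<in> space M"
    and coord_act: "\<And>g i x. i \<in> I \<Longrightarrow> x \<in> space M \<Longrightarrow> c i (act g x) = c (\<pi> g i) x"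
    and \<pi>_I: "\<And>g i. i \<in> I \<Longrightarrow> \<pi> g i \<in> I"
    and \<pi>_0: "\<And>i. i \<in> I \<Longrightarrow> \<pi> 0 i = i"
    and \<pi>_add: "\<And>g h i. i \<in> I \<Longrightarrow> \<pi> (g + h) i = \<pi> g (\<pi> h i)"
    and \<pi>_free: "\<And>g i. i \<in> I \<Longrightarrow> \<pi> g i = i \<Longrightarrow> g = 0"
    and infinite_I: "infinite I" and countable_I: "countable I"
    and energy: "\<And>g J. finite J \<Longrightarrow> J \<subseteq> I \<Longrightarrow> (\<Sum>j\<in>J. (pmf (q (\<pi> g j)) True - pmf (q j) True)\<^sup>2) \<le> E g"
begin

lemma \<pi>_cancel: "i \<in> I \<Longrightarrow> \<pi> g (\<pi> (- g) i) = i" "i \<in> I \<Longrightarrow> \<pi> (- g) (\<pi> g i) = i"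
  using \<pi>_add[of i g "- g"] \<pi>_add[of i "- g" g] \<pi>_0[of i] by simp_all

lemma inj_\<pi>: "inj_on (\<pi> g) I"
  by (rule inj_on_inverseI[where g = "\<pi> (- g)"]) (rule \<pi>_cancel)

lemma act_measurable [measurable]: "act g \<in> M \<rightarrow>\<^sub>M M"
proof (rule coordinate_map_measurable)
  show "act g \<in> space M \<rightarrow> space M" using act_space by auto
  show "Measurable.pred M (\<lambda>x. c i (act g x))" if i: "i \<in> I" for i
    by (subst measurable_cong[OF coord_act[OF i]]) (auto intro: coordinate_measurable \<pi>_I i)
qed

lemma act_add: "x \<in> space M \<Longrightarrow> act (g + h) x = act g (act h x)"
  by (rule separation) (auto simp: act_space coord_act \<pi>_I \<pi>_add[symmetric] add.commute)

lemma act_0: "x \<in> space M \<Longrightarrow> act 0 x = x"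
  by (rule separation) (auto simp: act_space coord_act \<pi>_0)

lemma coin_flip_distr_act: "coin_flip (distr M M (act g)) I c (\<lambda>i. q (\<pi> g i)) flip \<delta>"
proof -
  interpret D: prob_space "distr M M (act g)" by (rule prob_space_distr) measurable
  show ?thesis
  proof
    show "sets (distr M M (act g)) =
        sigma_sets (space (distr M M (act g))) {{x \<in> space (distr M M (act g)). c i x} |i. i \<in> I}"
      using sets_generated by simp
  next
    fix J v assume J: "finite J" "J \<subseteq> I"
    have inj: "inj_on (\<pi> g) J" using inj_\<pi> J(2) by (rule inj_on_subset)
    have "measure (distr M M (act g)) {x\<in>space (distr M M (act g)). \<forall>j\<in>J. c j x = v j} =
        prob (act g -` {x\<in>space M. \<forall>j\<in>J. c j x = v j} \<inter> space M)"
      using cylinder_sets[OF J] by (simp add: measure_distr)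
    also have "act g -` {x\<in>space M. \<forall>j\<in>J. c j x = v j} \<inter> space M =
        {x\<in>space M. \<forall>j\<in>\<pi> g ` J. c j x = v (\<pi> (- g) j)}"
      using J(2) by (auto simp: act_space coord_act \<pi>_cancel subset_iff)
    also have "prob \<dots> = (\<Prod>j\<in>\<pi> g ` J. pmf (q j) (v (\<pi> (- g) j)))"
      using J \<pi>_I by (intro prob_cylinder) auto
    also have "\<dots> = (\<Prod>j\<in>J. pmf (q (\<pi> g j)) (v j))"
      using J(2) by (subst prod.reindex[OF inj]) (auto intro!: prod.cong simp: \<pi>_cancel subset_iff)
    finally show "measure (distr M M (act g)) {x\<in>space (distr M M (act g)). \<forall>j\<in>J. c j x = v j} =
        (\<Prod>j\<in>J. pmf (q (\<pi> g j)) (v j))" .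
  qed (use flip_space coord_flip separation \<delta>_pos \<delta>_le \<pi>_I in auto)
qed

lemma prob_act_comparison:
  assumes S: "S \<in> sets M"
  shows "(measure (distr M M (act g)) S)\<^sup>2 \<le> exp (E g / \<delta>\<^sup>2) * prob S"
    and "(prob S)\<^sup>2 \<le> exp (E g / \<delta>\<^sup>2) * measure (distr M M (act g)) S"
proof -
  interpret D: coin_flip "distr M M (act g)" I c "\<lambda>i. q (\<pi> g i)" flip \<delta>
    by (rule coin_flip_distr_act)
  have K: "(\<Prod>j\<in>J. \<Sum>b\<in>UNIV. (pmf (r' j) b)\<^sup>2 / pmf (r j) b) \<le> exp (E g / \<delta>\<^sup>2)"
    if J: "finite J" "J \<subseteq> I" and r: "\<And>j b. j \<in> I \<Longrightarrow> \<delta> \<le> pmf (r j) b"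
      and sq: "\<And>j. (pmf (r' j) True - pmf (r j) True)\<^sup>2 = (pmf (q (\<pi> g j)) True - pmf (q j) True)\<^sup>2" for J r r'
  proof -
    have "(\<Prod>j\<in>J. \<Sum>b\<in>UNIV. (pmf (r' j) b)\<^sup>2 / pmf (r j) b) \<le>
        (\<Prod>j\<in>J. exp ((pmf (r' j) True - pmf (r j) True)\<^sup>2 / \<delta>\<^sup>2))"
      using J r \<delta>_pos by (intro prod_mono) (auto intro!: sum_square_quotient_le sum_nonneg)
    also have "\<dots> = exp ((\<Sum>j\<in>J. (pmf (q (\<pi> g j)) True - pmf (q j) True)\<^sup>2) / \<delta>\<^sup>2)"
      using J by (simp add: exp_sum sq sum_divide_distrib)
    also have "\<dots> \<le> exp (E g / \<delta>\<^sup>2)"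
      using energy[OF J] by (simp add: divide_right_mono)
    finally show ?thesis .
  qed
  show "(measure (distr M M (act g)) S)\<^sup>2 \<le> exp (E g / \<delta>\<^sup>2) * prob S"
    by (rule coin_process_comparison[OF coin_process_axioms D.coin_process_axioms])
      (auto simp: pmf_pos S intro!: K \<delta>_le)
  show "(prob S)\<^sup>2 \<le> exp (E g / \<delta>\<^sup>2) * measure (distr M M (act g)) S"
    by (rule coin_process_comparison[OF D.coin_process_axioms coin_process_axioms])
      (auto simp: D.pmf_pos S power2_commute intro!: K D.\<delta>_le)
qed

lemma nonsingular: "nonsingular_action M act"
  unfolding nonsingular_action_def
proof (intro conjI allI ballI)
  show "null_sets (distr M M (act g)) = null_sets M" for g
  proof -
    interpret D: prob_space "distr M M (act g)" by (rule prob_space_distr) measurable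
    have "measure (distr M M (act g)) S = 0 \<longleftrightarrow> prob S = 0" if "S \<in> sets M" for S
      using prob_act_comparison[OF that, of g] by auto
    then show ?thesis
      by (auto simp: null_sets_def emeasure_eq_measure D.emeasure_eq_measure)
  qed
qed (auto simp: sigma_finite_measure_axioms act_add act_0)

text \<open>The preimages of the fixed point set \<open>F\<close> under the flips of different coins are disjoint, because a free
permutation leaves no pair of coins in place. Each has at least \<open>\<delta>\<close> times the measure of \<open>F\<close>, and there are
infinitely many coins.\<close>

lemma fixed_points_null:
  assumes "g \<noteq> 0"
  shows "AE x in M. act g x \<noteq> x"
proof -
  define F where "F = {x\<in>space M. \<forall>i\<in>I. c (\<pi> g i) x = c i x}"
  have fixed: "x \<in> F" if "x \<in> space M" "act g x = x" for x
    using that coord_act[of _ x g] by (simp add: F_def)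
  have [measurable]: "F \<in> sets M"
    unfolding F_def
  proof (rule sets.sets_Collect_countable_All'[OF _ countable_I])
    fix i assume i: "i \<in> I"
    have [measurable]: "Measurable.pred M (c i)" "Measurable.pred M (c (\<pi> g i))"
      using i \<pi>_I by (auto intro: coordinate_measurable)
    show "{x\<in>space M. c (\<pi> g i) x = c i x} \<in> sets M" by measurable
  qed
  define G where "G i = flip i -` F \<inter> space M" for i
  have Gm: "G i \<in> sets M" if "i \<in> I" for i
    unfolding G_def using that by (intro measurable_sets[OF flip_measurable]) auto
  have G_le: "\<delta> * prob F \<le> prob (G i)" if i: "i \<in> I" for i
  proof -
    note [measurable] = Gm[OF i]
    have "emeasure M F = (\<integral>\<^sup>+x. indicator F x \<partial>M)" by simp
    also have "\<dots> = (\<integral>\<^sup>+x. indicator (G i) (flip i x) \<partial>M)"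
      by (intro nn_integral_cong) (simp add: G_def indicator_def flip_flip[OF i] flip_space[OF i])
    also have "\<dots> = (\<integral>\<^sup>+x. indicator (G i) x * ennreal (odds i (c i x)) \<partial>M)"
      by (rule nn_integral_flip[OF i]) measurable
    also have "\<dots> \<le> (\<integral>\<^sup>+x. indicator (G i) x * ennreal (1 / \<delta>) \<partial>M)"
      using odds_le[OF i] by (intro nn_integral_mono mult_left_mono ennreal_leI) auto
    also have "\<dots> = ennreal (1 / \<delta> * prob (G i))"
      using \<delta>_pos by (subst mult.commute, subst nn_integral_cmult_indicator)
        (auto simp: emeasure_eq_measure ennreal_mult[symmetric])
    finally have "prob F \<le> 1 / \<delta> * prob (G i)"
      using \<delta>_pos by (simp add: emeasure_eq_measure)
    then show ?thesis using \<delta>_pos by (simp add: field_simps)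
  qed
  have disj: "G i \<inter> G j = {}" if ij: "i \<in> I" "j \<in> I" "i \<noteq> j" for i j
  proof -
    have one_way: "G i \<inter> G j = {}" if ij: "i \<in> I" "j \<in> I" "i \<noteq> j" "\<pi> g i \<noteq> j" for i j
    proof (intro equals0I)
      fix x assume "x \<in> G i \<inter> G j"
      then have x: "x \<in> space M" "flip i x \<in> F" "flip j x \<in> F" by (auto simp: G_def)
      have "\<pi> g i \<noteq> i" using \<pi>_free[OF ij(1), of g] assms by blast
      moreover have "c (\<pi> g i) (flip i x) = c i (flip i x)" "c (\<pi> g i) (flip j x) = c i (flip j x)"
        using x ij by (auto simp: F_def)
      ultimately show False
        using ij x \<pi>_I[OF ij(1)] by (auto simp: coord_flip)
    qed
    \<comment> \<open>A pair of coins that is exchanged by \<open>g\<close> would be fixed by \<open>g + g\<close>.\<close>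
    have "\<not> (\<pi> g i = j \<and> \<pi> g j = i)"
    proof
      assume "\<pi> g i = j \<and> \<pi> g j = i"
      then have "\<pi> (g + g) i = i" using \<pi>_add[OF ij(1), of g g] by simp
      then show False using \<pi>_free[OF ij(1), of "g + g"] assms by simp
    qed
    then consider "\<pi> g i \<noteq> j" | "\<pi> g j \<noteq> i" by blast
    then show ?thesis
    proof cases
      case 1
      then show ?thesis using one_way ij by simp
    next
      case 2
      then have "G j \<inter> G i = {}" using one_way ij by simp
      then show ?thesis by (simp add: Int_commute)
    qed
  qed
  have "real n * (\<delta> * prob F) \<le> 1" for n
  proof -
    obtain K where K: "K \<subseteq> I" "finite K" "card K = n"
      using infinite_arbitrarily_large[OF infinite_I] by blast
    have "real n * (\<delta> * prob F) = (\<Sum>i\<in>K. \<delta> * prob F)" by (simp add: K)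
    also have "\<dots> \<le> (\<Sum>i\<in>K. prob (G i))" using K G_le by (intro sum_mono) auto
    also have "\<dots> = prob (\<Union>i\<in>K. G i)"
      by (rule finite_measure_finite_Union[symmetric])
        (use K Gm disj in \<open>auto simp: disjoint_family_on_def subset_iff\<close>)
    also have "\<dots> \<le> 1" by (rule prob_le_1)
    finally show ?thesis .
  qed
  then have "\<delta> * prob F \<le> 0"
    using reals_Archimedean3[of "\<delta> * prob F"] by (meson not_le)
  then have "prob F = 0" using \<delta>_pos by (simp add: mult_le_0_iff measure_le_0_iff)
  then have "F \<in> null_sets M" by (auto simp: null_sets_def emeasure_eq_measure)
  then have "AE x in M. x \<notin> F" by (rule AE_not_in)
  with AE_space show ?thesis by eventually_elim (use fixed in auto)
qed

text \<open>On the set \<open>S\<close> where the cocycle is below \<open>1 / t\<close> the moved law has mass at most \<open>prob S / t\<close>, whereas by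
comparison it has at least \<open>(prob S)\<^sup>2 / K\<close>.\<close>

lemma rn_cocycle_tail:
  assumes t: "0 < t"
  shows "prob {x\<in>space M. rn_cocycle M act g x < 1 / t} \<le> exp (E (- g) / \<delta>\<^sup>2) / t"
proof -
  note [measurable] = rn_cocycle_measurable[OF nonsingular]
  define S where "S = {x\<in>space M. rn_cocycle M act g x < 1 / t}"
  have [measurable]: "S \<in> sets M" unfolding S_def by measurable
  let ?D = "distr M M (act (- g))"
  interpret D: prob_space ?D by (rule prob_space_distr) measurable
  have "emeasure ?D S = (\<integral>\<^sup>+x. indicator S x \<partial>?D)" by simp
  also have "\<dots> = (\<integral>\<^sup>+x. indicator S (act (- g) x) \<partial>M)" by (rule nn_integral_distr) measurable
  also have "\<dots> = (\<integral>\<^sup>+x. indicator S x * ennreal (rn_cocycle M act g x) \<partial>M)"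
    by (rule rn_cocycle_nn_integral[OF nonsingular, symmetric]) measurable
  also have "\<dots> \<le> (\<integral>\<^sup>+x. indicator S x * ennreal (1 / t) \<partial>M)"
    by (intro nn_integral_mono) (auto simp: S_def indicator_def intro!: ennreal_leI)
  also have "\<dots> = ennreal (prob S * (1 / t))"
    using t by (simp add: nn_integral_multc emeasure_eq_measure ennreal_mult[symmetric])
  finally have *: "measure ?D S \<le> prob S * (1 / t)"
    using t by (simp add: D.emeasure_eq_measure)
  have "(prob S)\<^sup>2 \<le> exp (E (- g) / \<delta>\<^sup>2) * measure ?D S"
    by (rule prob_act_comparison) measurable
  also have "\<dots> \<le> exp (E (- g) / \<delta>\<^sup>2) * (prob S * (1 / t))"
    using * by (intro mult_left_mono) auto
  finally have le: "prob S * prob S \<le> prob S * (exp (E (- g) / \<delta>\<^sup>2) / t)"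
    by (simp add: power2_eq_square ac_simps)
  have "prob S \<le> exp (E (- g) / \<delta>\<^sup>2) / t"
  proof (cases "prob S = 0")
    case True
    then show ?thesis using t by simp
  next
    case False
    then have "0 < prob S" by (simp add: zero_less_measure_iff)
    with le show ?thesis by (rule mult_left_le_imp_le)
  qed
  then show ?thesis by (simp add: S_def)
qed

lemma AE_rn_cocycle_flip:
  assumes i: "i \<in> I"
  shows "AE x in M. ln (rn_cocycle M act g (flip i x)) - ln (rn_cocycle M act g x) =
    ln (coin_flip.odds (\<lambda>i. q (\<pi> (- g) i)) i (c i x)) - ln (odds i (c i x))"
proof -
  let ?D = "distr M M (act (- g))"
  let ?f = "RN_deriv M ?D"
  interpret D: coin_flip ?D I c "\<lambda>i. q (\<pi> (- g) i)" flip \<delta> by (rule coin_flip_distr_act)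
  have D: "?D = density M ?f"
    by (rule density_RN_deriv_action[OF nonsingular, symmetric])
  have 1: "AE x in M. ?f (flip i x) * ennreal (odds i (c i x)) = ennreal (D.odds i (c i x)) * ?f x"
    by (rule AE_density_flip[OF D.coin_flip_axioms D _ i]) measurable
  have 2: "AE x in M. 0 < rn_cocycle M act g x \<and> ennreal (rn_cocycle M act g x) = ?f x"
    by (rule AE_rn_cocycle[OF nonsingular])
  have "absolutely_continuous M (distr M M (flip i))"
    unfolding distr_flip[OF i] using odds_measurable[OF i]
    by (auto simp: absolutely_continuous_def null_sets_density_iff intro: AE_I' )
  then have "AE x in distr M M (flip i). 0 < rn_cocycle M act g x \<and> ennreal (rn_cocycle M act g x) = ?f x"
    by (rule absolutely_continuous_AE[rotated]) (use 2 in auto)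
  then have 3: "AE x in M. 0 < rn_cocycle M act g (flip i x) \<and> ennreal (rn_cocycle M act g (flip i x)) = ?f (flip i x)"
    by (rule AE_distrD[rotated]) (rule flip_measurable[OF i])
  show ?thesis using 1 2 3
  proof eventually_elim
    case (elim x)
    let ?\<omega> = "rn_cocycle M act g"
    have o: "0 < odds i (c i x)" "0 < D.odds i (c i x)" using odds_pos[OF i] D.odds_pos[OF i] by auto
    have "ennreal (?\<omega> (flip i x) * odds i (c i x)) = ennreal (D.odds i (c i x) * ?\<omega> x)"
      using elim o by (simp add: ennreal_mult less_imp_le)
    then have "?\<omega> (flip i x) * odds i (c i x) = D.odds i (c i x) * ?\<omega> x"
      using elim o by (simp add: less_imp_le)
    then have "ln (?\<omega> (flip i x) * odds i (c i x)) = ln (D.odds i (c i x) * ?\<omega> x)" by simp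
    then show ?case using elim o by (simp add: ln_mult)
  qed
qed

end


section \<open>Recurrence of the Maharam extension\<close>

text \<open>The weight \<open>min 1 (exp (2 * s))\<close> decays at minus infinity faster than \<open>exp s\<close>, which is what integrability
with respect to \<open>exp (- s) ds\<close> needs.\<close>

lemma nn_integral_min_exp_finite:
  "(\<integral>\<^sup>+s. ennreal (min 1 (exp (2 * s))) \<partial>exp_measure) < \<infinity>"
proof -
  have e: "(\<integral>\<^sup>+s. ennreal (exp (- s)) * indicator {0..} s \<partial>lborel) = 1"
    using nn_intergal_power_times_exp_Ici[of 0] by simp
  have "(\<integral>\<^sup>+s. ennreal (min 1 (exp (2 * s))) \<partial>exp_measure) =
      (\<integral>\<^sup>+s. ennreal (exp (- s)) * ennreal (min 1 (exp (2 * s))) \<partial>lborel)"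
    by (rule nn_integral_density) measurable
  also have "\<dots> \<le> (\<integral>\<^sup>+s. ennreal (exp (- s)) * indicator {0..} s + ennreal (exp (- (- s))) * indicator {0..} (- s) \<partial>lborel)"
  proof (rule nn_integral_mono)
    fix s :: real
    show "ennreal (exp (- s)) * ennreal (min 1 (exp (2 * s))) \<le>
        ennreal (exp (- s)) * indicator {0..} s + ennreal (exp (- (- s))) * indicator {0..} (- s)"
    proof (cases "0 \<le> s")
      case True
      have "ennreal (exp (- s)) * ennreal (min 1 (exp (2 * s))) \<le> ennreal (exp (- s)) * 1"
        by (intro mult_left_mono) (auto simp: ennreal_le_1)
      with True show ?thesis by (auto intro: add_increasing2)
    next
      case False
      have "ennreal (exp (- s)) * ennreal (min 1 (exp (2 * s))) \<le> ennreal (exp (- s)) * ennreal (exp (2 * s))"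
        by (intro mult_left_mono ennreal_leI) auto
      also have "\<dots> = ennreal (exp s)" by (simp add: ennreal_mult[symmetric] exp_add[symmetric])
      finally show ?thesis using False by simp
    qed
  qed
  also have "\<dots> = (\<integral>\<^sup>+s. ennreal (exp (- s)) * indicator {0..} s \<partial>lborel) +
      (\<integral>\<^sup>+s. ennreal (exp (- (- s))) * indicator {0..} (- s) \<partial>lborel)"
    by (rule nn_integral_add) measurable
  also have "(\<integral>\<^sup>+s. ennreal (exp (- (- s))) * indicator {0..} (- s) \<partial>lborel) =
      (\<integral>\<^sup>+s. ennreal (exp (- s)) * indicator {0..} s \<partial>lborel)"
    by (subst nn_integral_real_affine[where c = "-1" and t = 0 and f = "\<lambda>s. ennreal (exp (- s)) * indicator {0..} s"]) auto
  finally show ?thesis by (auto simp: e top_unique less_top[symmetric])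
qed

lemma emeasure_exp_measure_interval_finite: "emeasure exp_measure {-L..L} < \<infinity>"
proof -
  have "emeasure exp_measure {-L..L} = (\<integral>\<^sup>+s. ennreal (exp (- s)) * indicator {-L..L} s \<partial>lborel)"
    by (rule emeasure_density) measurable
  also have "\<dots> \<le> (\<integral>\<^sup>+s. ennreal (exp L) * indicator {-L..L} s \<partial>lborel)"
    by (intro nn_integral_mono) (auto simp: indicator_def intro!: ennreal_leI)
  also have "\<dots> = ennreal (exp L) * emeasure lborel {-L..L}"
    by (rule nn_integral_cmult_indicator) simp
  also have "\<dots> < \<infinity>" by (simp add: ennreal_mult_less_top emeasure_lborel_Icc_eq)
  finally show ?thesis .
qed

lemma suminf_eq_top_of_harmonic:
  fixes f :: "nat \<Rightarrow> ennreal"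
  assumes \<kappa>: "0 < \<kappa>" and le: "\<And>n. n0 \<le> n \<Longrightarrow> ennreal (\<kappa> / real n) \<le> f n"
  shows "(\<Sum>n. f n) = \<infinity>"
proof (rule ccontr)
  assume *: "(\<Sum>n. f n) \<noteq> \<infinity>"
  have "(\<Sum>n. ennreal (if n < n0 then 0 else \<kappa> / real n)) \<le> (\<Sum>n. f n)"
    using le by (intro suminf_le) auto
  with * have "(\<Sum>n. ennreal (if n < n0 then 0 else \<kappa> / real n)) \<noteq> \<top>" by (auto simp: top_unique)
  then have "summable (\<lambda>n. if n < n0 then 0 else \<kappa> / real n)"
    using \<kappa> by (intro summable_suminf_not_top) auto
  then have "summable (\<lambda>n. \<kappa> / real n)"
    by (rule summable_cong[THEN iffD1, rotated]) (auto simp: eventually_sequentially intro!: exI[of _ n0])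
  then have "summable (\<lambda>n. inverse \<kappa> * (\<kappa> / real n))" by (rule summable_mult)
  then have "summable (\<lambda>n. inverse (real n))" using \<kappa> by (simp add: field_simps)
  then show False using not_summable_harmonic[where 'a = real] by simp
qed

text \<open>The exponent \<open>1 / 8\<close> is a convenient choice: any exponent that is small enough would do in the
recurrence estimate. The assumptions on the sequence \<open>idx\<close> of coins say that their log-odds of \<open>True\<close> approach
those of \<open>base\<close> from below, but not square summably.\<close>

locale coin_system = coin_action M I c q flip \<delta> act \<pi> E
  for M :: "'a measure" and I :: "'i set" and c :: "'i \<Rightarrow> 'a \<Rightarrow> bool" and q :: "'i \<Rightarrow> bool pmf"
    and flip :: "'i \<Rightarrow> 'a \<Rightarrow> 'a" and \<delta> :: real and act :: "int \<Rightarrow> 'a \<Rightarrow> 'a" and \<pi> :: "int \<Rightarrow> 'i \<Rightarrow> 'i"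
    and E :: "int \<Rightarrow> real" +
  fixes base :: "bool pmf" and C\<^sub>E :: real and idx :: "nat \<Rightarrow> 'i"
  assumes base_pos: "\<And>v. 0 < pmf base v"
    and base_direction: "\<And>i. i \<in> I \<Longrightarrow> \<exists>\<sigma>\<in>{1, -1}. \<exists>n0::nat. \<forall>n\<ge>n0. q (\<pi> (\<sigma> * int n) i) = base"
    and growth: "\<And>n::nat. 0 < n \<Longrightarrow> exp (E (- int n) / \<delta>\<^sup>2) \<le> C\<^sub>E * real n powr (1 / 8)"
    and inj_idx: "inj idx" and idx_I: "\<And>n. idx n \<in> I"
    and drift_nonneg: "\<And>n. 0 \<le> ln (pmf base True / pmf base False) - ln (pmf (q (idx n)) True / pmf (q (idx n)) False)"
    and drift_tendsto: "(\<lambda>n. ln (pmf base True / pmf base False) - ln (pmf (q (idx n)) True / pmf (q (idx n)) False)) \<longlonglongrightarrow> 0"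
    and drift_square_divergent: "\<not> summable (\<lambda>n. (ln (pmf base True / pmf base False) - ln (pmf (q (idx n)) True / pmf (q (idx n)) False))\<^sup>2)"

text \<open>The system together with a probability measure preserving action that it is tested against for weak mixing.\<close>

locale driven_coin_system = coin_system M I c q flip \<delta> act \<pi> E base C\<^sub>E idx
  for M :: "'a measure" and I :: "'i set" and c :: "'i \<Rightarrow> 'a \<Rightarrow> bool" and q :: "'i \<Rightarrow> bool pmf"
    and flip :: "'i \<Rightarrow> 'a \<Rightarrow> 'a" and \<delta> :: real and act :: "int \<Rightarrow> 'a \<Rightarrow> 'a" and \<pi> :: "int \<Rightarrow> 'i \<Rightarrow> 'i"
    and E :: "int \<Rightarrow> real" and base C\<^sub>E idx +
  fixes N :: "'b measure" and act' :: "int \<Rightarrow> 'b \<Rightarrow> 'b"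
  assumes pmp: "pmp_action N act'"
begin

sublocale N: prob_space N using pmp by (simp add: pmp_action_def)

sublocale Exp: sigma_finite_measure "density lborel (\<lambda>s. ennreal (exp (- s)))"
  by (rule sigma_finite_exp_measure)

definition m :: "('b \<times> 'a \<times> real) measure" where
  "m = N \<Otimes>\<^sub>M maharam_measure M"

definition \<tau> :: "int \<Rightarrow> 'b \<times> 'a \<times> real \<Rightarrow> 'b \<times> 'a \<times> real" where
  "\<tau> = diagonal_action act' (maharam_action M act)"

sublocale near_action m \<tau>
  unfolding m_def \<tau>_def by (rule near_action_diagonal_maharam[OF nonsingular pmp])

lemma \<tau>_eq: "\<tau> g (y, x, s) = (act' g y, act g x, ln (rn_cocycle M act g x) + s)"
  by (simp add: \<tau>_def diagonal_action_def maharam_action_def)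

lemma sets_m [measurable_cong]: "sets m = sets (N \<Otimes>\<^sub>M (M \<Otimes>\<^sub>M borel))"
  unfolding m_def maharam_measure_def by (intro sets_pair_measure_cong) simp_all

lemma space_m: "space m = space N \<times> space M \<times> UNIV"
  by (simp add: m_def maharam_measure_def space_pair_measure)

lemma nn_integral_m:
  assumes R: "R \<in> borel_measurable m"
  shows "(\<integral>\<^sup>+z. R z \<partial>m) = (\<integral>\<^sup>+y. \<integral>\<^sup>+x. \<integral>\<^sup>+s. R (y, x, s) \<partial>exp_measure \<partial>M \<partial>N)"
proof -
  interpret mm: sigma_finite_measure "maharam_measure M"
    by (rule sigma_finite_maharam_measure[OF nonsingular])
  have 1: "R \<in> borel_measurable (N \<Otimes>\<^sub>M maharam_measure M)" using R by (simp add: m_def)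
  have "(\<integral>\<^sup>+z. R z \<partial>m) = (\<integral>\<^sup>+y. \<integral>\<^sup>+w. R (y, w) \<partial>maharam_measure M \<partial>N)"
    unfolding m_def by (rule mm.nn_integral_fst[OF 1, symmetric])
  also have "\<dots> = (\<integral>\<^sup>+y. \<integral>\<^sup>+x. \<integral>\<^sup>+s. R (y, x, s) \<partial>exp_measure \<partial>M \<partial>N)"
  proof (rule nn_integral_cong)
    fix y assume y: "y \<in> space N"
    have "(\<lambda>w. R (y, w)) \<in> borel_measurable (M \<Otimes>\<^sub>M exp_measure)"
      using measurable_compose[OF measurable_Pair1'[OF y] 1] by (simp add: maharam_measure_def)
    then show "(\<integral>\<^sup>+w. R (y, w) \<partial>maharam_measure M) = (\<integral>\<^sup>+x. \<integral>\<^sup>+s. R (y, x, s) \<partial>exp_measure \<partial>M)"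
      unfolding maharam_measure_def by (rule Exp.nn_integral_fst[symmetric])
  qed
  finally show ?thesis .
qed

lemma emeasure_m_rectangle:
  assumes "S \<in> sets M" "U \<in> sets borel"
  shows "emeasure m {z\<in>space m. fst (snd z) \<in> S \<and> snd (snd z) \<in> U} = emeasure M S * emeasure exp_measure U"
proof -
  interpret mm: sigma_finite_measure "maharam_measure M"
    by (rule sigma_finite_maharam_measure[OF nonsingular])
  have "{z\<in>space m. fst (snd z) \<in> S \<and> snd (snd z) \<in> U} = space N \<times> (S \<times> U)"
    using sets.sets_into_space[OF assms(1)] by (auto simp: space_m)
  then show ?thesis
    using assms unfolding m_def maharam_measure_def
    by (simp add: mm.emeasure_pair_measure_Times[unfolded maharam_measure_def] Exp.emeasure_pair_measure_Times N.emeasure_space_1)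
qed

definition h :: "'b \<times> 'a \<times> real \<Rightarrow> ennreal" where
  "h z = ennreal (min 1 (exp (2 * snd (snd z))))"

lemma h_measurable [measurable]: "h \<in> borel_measurable m"
  unfolding h_def by measurable

lemma nn_integral_h: "(\<integral>\<^sup>+z. h z \<partial>m) < \<infinity>"
  using nn_integral_min_exp_finite
  by (simp add: nn_integral_m h_def emeasure_space_1 N.emeasure_space_1)

text \<open>It is enough to bound the terms below by a multiple of \<open>1 / n\<close>. On a part of \<open>W\<close> where \<open>s\<close> is bounded, this
holds wherever the cocycle is at least \<open>n powr (- (1 / 4))\<close>: the weight squares the cocycle and
costs \<open>n powr (- (1 / 2))\<close>. The exceptional set has measure at most a multiple of \<open>n powr (1 / 8 - 1 / 4)\<close>, which tends to 0.\<close>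

lemma h_divergent:
  assumes W [measurable]: "W \<in> sets m" and W0: "emeasure m W \<noteq> 0"
  shows "(\<Sum>n. \<integral>\<^sup>+z. indicator W z * h (\<tau> (int n) z) \<partial>m) = \<infinity>"
proof -
  define V where "V L = {z\<in>space m. fst (snd z) \<in> space M \<and> snd (snd z) \<in> {- real L..real L}}" for L :: nat
  have Vm [measurable]: "V L \<in> sets m" for L unfolding V_def by measurable
  have "(\<Union>L. W \<inter> V L) = W"
  proof -
    have "z \<in> (\<Union>L. V L)" if "z \<in> space m" for z
    proof -
      obtain L :: nat where "\<bar>snd (snd z)\<bar> \<le> real L" using real_arch_simple by blast
      then have "z \<in> V L" using that by (auto simp: V_def space_m)
      then show ?thesis by blast
    qed
    then show ?thesis using sets.sets_into_space[OF W] by blast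
  qed
  then have UN: "emeasure m (\<Union>L. W \<inter> V L) \<noteq> 0" using W0 by simp
  have "\<exists>L. emeasure m (W \<inter> V L) \<noteq> 0"
  proof (rule ccontr)
    assume "\<not> (\<exists>L. emeasure m (W \<inter> V L) \<noteq> 0)"
    then have "emeasure m (\<Union>L. W \<inter> V L) = 0"
      by (intro emeasure_UN_eq_0) (auto intro!: sets.Int W Vm)
    with UN show False by simp
  qed
  then obtain L where L: "emeasure m (W \<inter> V L) \<noteq> 0" ..
  define v where "v = measure exp_measure {- real L..real L}"
  have v: "emeasure exp_measure {- real L..real L} = ennreal v"
    using emeasure_exp_measure_interval_finite[of "real L"]
    unfolding v_def by (intro emeasure_eq_ennreal_measure) auto
  have V_v: "emeasure m (V L) = ennreal v"
    unfolding V_def by (subst emeasure_m_rectangle) (auto simp: emeasure_space_1 v)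
  have WV_le: "emeasure m (W \<inter> V L) \<le> ennreal v"
    unfolding V_v[symmetric] by (intro emeasure_mono) auto
  define w where "w = measure m (W \<inter> V L)"
  have w: "emeasure m (W \<inter> V L) = ennreal w"
    unfolding w_def using WV_le by (intro emeasure_eq_ennreal_measure) (auto simp: top_unique)
  have w_pos: "0 < w" using L w by (cases "w \<le> 0") (auto simp: ennreal_neg)
  note [measurable] = rn_cocycle_measurable[OF nonsingular]
  define b where "b n = {x\<in>space M. rn_cocycle M act (int n) x < 1 / (real n powr (1/4))}" for n :: nat
  have bm [measurable]: "b n \<in> sets M" for n unfolding b_def by measurable
  have b_le: "prob (b n) \<le> C\<^sub>E * real n powr (- (1 / 8))" if "0 < n" for n
  proof -
    have "prob (b n) \<le> exp (E (- int n) / \<delta>\<^sup>2) / real n powr (1/4)"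
      unfolding b_def using that by (intro rn_cocycle_tail) simp
    also have "\<dots> \<le> C\<^sub>E * real n powr (1 / 8) / real n powr (1 / 4)"
      using growth[OF that] by (intro divide_right_mono) auto
    also have "\<dots> = C\<^sub>E * real n powr (1 / 8 - 1 / 4)"
      by (simp only: powr_diff times_divide_eq_right)
    also have "(1 / 8 - 1 / 4 :: real) = - (1 / 8)" by simp
    finally show ?thesis .
  qed
  have "(\<lambda>n. C\<^sub>E * real n powr (- (1 / 8)) * v) \<longlonglongrightarrow> C\<^sub>E * 0 * v"
    by (intro tendsto_intros tendsto_neg_powr filterlim_real_sequentially) simp
  then have "\<forall>\<^sub>F n in sequentially. C\<^sub>E * real n powr (- (1 / 8)) * v < w / 2"
    by (rule order_tendstoD(2)) (use w_pos in simp)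
  then obtain n1 where n1: "\<And>n. n1 \<le> n \<Longrightarrow> C\<^sub>E * real n powr (- (1 / 8)) * v < w / 2"
    by (auto simp: eventually_sequentially)
  define \<kappa> where "\<kappa> = exp (- 2 * real L) * (w / 2)"
  have main: "ennreal (\<kappa> / real n) \<le> (\<integral>\<^sup>+z. indicator W z * h (\<tau> (int n) z) \<partial>m)" if n: "max 1 n1 \<le> n" for n
  proof -
    have n0: "0 < n" "1 \<le> n" "n1 \<le> n" using n by auto
    define Bd where "Bd = {z\<in>space m. fst (snd z) \<in> b n \<and> snd (snd z) \<in> {- real L..real L}}"
    have [measurable]: "Bd \<in> sets m" unfolding Bd_def by measurable
    have "emeasure m Bd = ennreal (prob (b n) * v)"
      unfolding Bd_def by (subst emeasure_m_rectangle) (auto simp: emeasure_eq_measure v ennreal_mult v_def)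
    also have "\<dots> \<le> ennreal (C\<^sub>E * real n powr (- (1 / 8)) * v)"
      using b_le[OF n0(1)] by (intro ennreal_leI mult_right_mono) (auto simp: v_def)
    also have "\<dots> \<le> ennreal (w / 2)"
      using n1[OF n0(3)] by (intro ennreal_leI) simp
    finally have Bd: "emeasure m Bd \<le> ennreal (w / 2)" .
    have "ennreal w \<le> emeasure m ((W \<inter> V L - Bd) \<union> Bd)"
      unfolding w[symmetric] by (intro emeasure_mono) auto
    also have "\<dots> \<le> emeasure m (W \<inter> V L - Bd) + emeasure m Bd"
      by (intro emeasure_subadditive) auto
    also have "\<dots> \<le> emeasure m (W \<inter> V L - Bd) + ennreal (w / 2)"
      using Bd by (intro add_left_mono)
    finally have "ennreal w \<le> emeasure m (W \<inter> V L - Bd) + ennreal (w / 2)" .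
    then have "ennreal w - ennreal (w / 2) \<le> emeasure m (W \<inter> V L - Bd)"
      by (simp add: ennreal_minus_le_iff add.commute)
    then have good: "ennreal (w / 2) \<le> emeasure m (W \<inter> V L - Bd)"
      using w_pos by (simp add: ennreal_minus)
    have "ennreal (\<kappa> / real n) = ennreal (exp (- 2 * real L) / real n) * ennreal (w / 2)"
      using w_pos n0 by (simp add: \<kappa>_def ennreal_mult[symmetric])
    also have "\<dots> \<le> ennreal (exp (- 2 * real L) / real n) * emeasure m (W \<inter> V L - Bd)"
      by (intro mult_left_mono good) simp
    also have "\<dots> = (\<integral>\<^sup>+z. ennreal (exp (- 2 * real L) / real n) * indicator (W \<inter> V L - Bd) z \<partial>m)"
      by (rule nn_integral_cmult_indicator[symmetric]) measurable
    also have "\<dots> \<le> (\<integral>\<^sup>+z. indicator W z * h (\<tau> (int n) z) \<partial>m)"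
    proof (rule nn_integral_mono_AE)
      interpret mm: sigma_finite_measure "maharam_measure M"
        by (rule sigma_finite_maharam_measure[OF nonsingular])
      have "AE x in M. 0 < rn_cocycle M act (int n) x"
        using AE_rn_cocycle[OF nonsingular, of "int n"] by eventually_elim simp
      then have "AE z in m. 0 < rn_cocycle M act (int n) (fst (snd z))"
        unfolding m_def
        by (intro AE_pair_snd mm.sigma_finite_measure_axioms)
          (unfold maharam_measure_def, intro AE_pair_fst sigma_finite_exp_measure)
      then show "AE z in m. ennreal (exp (- 2 * real L) / real n) * indicator (W \<inter> V L - Bd) z
          \<le> indicator W z * h (\<tau> (int n) z)"
      proof eventually_elim
        case (elim z)
        show ?case
        proof (cases "z \<in> W \<inter> V L - Bd")
          case True
          obtain y x s where z: "z = (y, x, s)" by (cases z) auto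
          define \<omega> where "\<omega> = rn_cocycle M act (int n) x"
          have s: "- real L \<le> s" and \<omega>: "0 < \<omega>" "1 / (real n powr (1/4)) \<le> \<omega>"
            using True elim by (auto simp: V_def Bd_def b_def z \<omega>_def not_less)
          have "exp (- 2 * real L) / real n \<le> 1"
          proof -
            have "exp (- 2 * real L) / real n \<le> 1 / 1" using n0 by (intro frac_le) auto
            then show ?thesis by simp
          qed
          moreover have "exp (- 2 * real L) / real n \<le> exp (2 * (ln \<omega> + s))"
          proof -
            have "real n powr (1/4) * real n powr (1/4) = real n powr (1/2)"
              by (simp add: powr_add[symmetric])
            also have "\<dots> \<le> real n powr 1" using n0 by (intro powr_mono) auto
            finally have "real n powr (1/4) * real n powr (1/4) \<le> real n" using n0 by simp
            then have "1 / real n \<le> 1 / (real n powr (1/4) * real n powr (1/4))"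
              using n0 by (intro divide_left_mono) auto
            also have "\<dots> = (1 / (real n powr (1/4)))\<^sup>2" by (simp add: power2_eq_square)
            also have "\<dots> \<le> \<omega>\<^sup>2" using \<omega> by (intro power_mono) auto
            finally have "1 / real n \<le> \<omega>\<^sup>2" .
            moreover have "exp (- 2 * real L) \<le> exp (2 * s)" using s by simp
            ultimately have "1 / real n * exp (- 2 * real L) \<le> \<omega>\<^sup>2 * exp (2 * s)"
              by (intro mult_mono) auto
            also have "\<omega>\<^sup>2 = exp (2 * ln \<omega>)" using \<omega> by (simp add: exp_double)
            finally show ?thesis by (simp add: exp_add[symmetric] algebra_simps)
          qed
          ultimately have "ennreal (exp (- 2 * real L) / real n) \<le> h (\<tau> (int n) z)"
            by (auto simp: h_def z \<tau>_eq \<omega>_def intro!: ennreal_leI)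
          then show ?thesis using True by simp
        qed simp
      qed
    qed
    finally show ?thesis .
  qed
  show ?thesis
    by (rule suminf_eq_top_of_harmonic[of \<kappa> "max 1 n1"]) (use w_pos main in \<open>auto simp: \<kappa>_def\<close>)
qed

lemma AE_visits:
  assumes "\<sigma> \<in> {1, -1}" "B \<in> sets m"
  shows "AE z in m. z \<in> B \<longrightarrow> (\<forall>k. \<exists>n. visit \<sigma> B k n z)"
  by (rule visits_exist[OF assms h_measurable nn_integral_h]) (rule h_divergent)

end


section \<open>Invariance under flipping a coin\<close>

context driven_coin_system
begin

text \<open>In the time direction in which the coin \<open>i\<close> becomes stationary, flipping it changes the logarithm of the
cocycle by minus this number.\<close>

definition shift :: "'i \<Rightarrow> bool \<Rightarrow> real" where
  "shift i v = ln (odds i v) - ln (pmf base (\<not> v) / pmf base v)"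

definition \<theta> :: "'i \<Rightarrow> 'b \<times> 'a \<times> real \<Rightarrow> 'b \<times> 'a \<times> real" where
  "\<theta> i = (\<lambda>(y, x, s). (y, flip i x, s + shift i (c i x)))"

lemma \<theta>_measurable:
  assumes i: "i \<in> I" shows "\<theta> i \<in> m \<rightarrow>\<^sub>M m"
proof -
  note [measurable] = flip_measurable[OF i]
  define f where "f = (\<lambda>x. shift i (c i x))"
  have [measurable]: "f \<in> borel_measurable M"
    unfolding f_def by (rule measurable_compose[OF coordinate_measurable[OF i]]) simp
  have "(\<lambda>z. (fst z, flip i (fst (snd z)), snd (snd z) + f (fst (snd z)))) \<in> m \<rightarrow>\<^sub>M m"
    by measurable
  then show ?thesis by (simp add: \<theta>_def f_def case_prod_unfold)
qed

lemma nn_integral_\<theta>_le: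
  assumes i: "i \<in> I" and R [measurable]: "R \<in> borel_measurable m"
  shows "(\<integral>\<^sup>+z. R (\<theta> i z) \<partial>m) \<le> ennreal (exp (max (shift i True) (shift i False)) / \<delta>) * (\<integral>\<^sup>+z. R z \<partial>m)"
proof -
  let ?D = "max (shift i True) (shift i False)"
  note [measurable] = flip_measurable[OF i] \<theta>_measurable[OF i] odds_measurable[OF i]
  define G where "G y x = (\<integral>\<^sup>+s. R (y, x, s) \<partial>exp_measure)" for y x
  have R': "R \<in> borel_measurable (N \<Otimes>\<^sub>M (M \<Otimes>\<^sub>M borel))" by measurable
  have [measurable]: "(\<lambda>(y, x). G y x) \<in> borel_measurable (N \<Otimes>\<^sub>M M)"
    unfolding G_def by measurable
  have [measurable]: "G y \<in> borel_measurable M" if "y \<in> space N" for y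
    using that unfolding G_def by measurable
  have step: "(\<integral>\<^sup>+x. \<integral>\<^sup>+s. R (\<theta> i (y, x, s)) \<partial>exp_measure \<partial>M) \<le> ennreal (exp ?D / \<delta>) * (\<integral>\<^sup>+x. G y x \<partial>M)"
    if y: "y \<in> space N" for y
  proof -
    have [measurable]: "G y \<in> borel_measurable M" using y unfolding G_def by measurable
    have "(\<integral>\<^sup>+x. \<integral>\<^sup>+s. R (\<theta> i (y, x, s)) \<partial>exp_measure \<partial>M) \<le> (\<integral>\<^sup>+x. ennreal (exp ?D) * G y (flip i x) \<partial>M)"
    proof (rule nn_integral_mono)
      fix x assume x: "x \<in> space M"
      have [measurable]: "(\<lambda>s. R (y, flip i x, s)) \<in> borel_measurable borel"
        using y flip_space[OF i x] by measurable
      have "(\<integral>\<^sup>+s. R (\<theta> i (y, x, s)) \<partial>exp_measure) = (\<integral>\<^sup>+s. R (y, flip i x, shift i (c i x) + s) \<partial>exp_measure)"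
        by (simp add: \<theta>_def add.commute)
      also have "\<dots> = ennreal (exp (shift i (c i x))) * G y (flip i x)"
        unfolding G_def by (rule nn_integral_exp_measure_shift) measurable
      also have "\<dots> \<le> ennreal (exp ?D) * G y (flip i x)"
        by (intro mult_right_mono ennreal_leI) (cases "c i x", auto)
      finally show "(\<integral>\<^sup>+s. R (\<theta> i (y, x, s)) \<partial>exp_measure) \<le> ennreal (exp ?D) * G y (flip i x)" .
    qed
    also have "\<dots> = ennreal (exp ?D) * (\<integral>\<^sup>+x. G y (flip i x) \<partial>M)"
      by (rule nn_integral_cmult) measurable
    also have "(\<integral>\<^sup>+x. G y (flip i x) \<partial>M) = (\<integral>\<^sup>+x. G y x * ennreal (odds i (c i x)) \<partial>M)"
      by (rule nn_integral_flip[OF i]) measurable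
    also have "\<dots> \<le> (\<integral>\<^sup>+x. G y x * ennreal (1 / \<delta>) \<partial>M)"
      using odds_le[OF i] by (intro nn_integral_mono mult_left_mono ennreal_leI) auto
    also have "\<dots> = (\<integral>\<^sup>+x. G y x \<partial>M) * ennreal (1 / \<delta>)"
      by (rule nn_integral_multc) measurable
    finally have "(\<integral>\<^sup>+x. \<integral>\<^sup>+s. R (\<theta> i (y, x, s)) \<partial>exp_measure \<partial>M) \<le>
        ennreal (exp ?D) * ((\<integral>\<^sup>+x. G y x \<partial>M) * ennreal (1 / \<delta>))"
      by (simp add: mult_left_mono)
    also have "\<dots> = (ennreal (exp ?D) * ennreal (1 / \<delta>)) * (\<integral>\<^sup>+x. G y x \<partial>M)" by (simp only: ac_simps)
    also have "ennreal (exp ?D) * ennreal (1 / \<delta>) = ennreal (exp ?D / \<delta>)"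
      using \<delta>_pos by (simp add: ennreal_mult[symmetric])
    finally show ?thesis .
  qed
  have "(\<integral>\<^sup>+z. R (\<theta> i z) \<partial>m) = (\<integral>\<^sup>+y. \<integral>\<^sup>+x. \<integral>\<^sup>+s. R (\<theta> i (y, x, s)) \<partial>exp_measure \<partial>M \<partial>N)"
    by (rule nn_integral_m) measurable
  also have "\<dots> \<le> (\<integral>\<^sup>+y. ennreal (exp ?D / \<delta>) * (\<integral>\<^sup>+x. G y x \<partial>M) \<partial>N)"
    by (rule nn_integral_mono) (rule step)
  also have "\<dots> = ennreal (exp ?D / \<delta>) * (\<integral>\<^sup>+y. \<integral>\<^sup>+x. G y x \<partial>M \<partial>N)"
    by (rule nn_integral_cmult) measurable
  also have "(\<integral>\<^sup>+y. \<integral>\<^sup>+x. G y x \<partial>M \<partial>N) = (\<integral>\<^sup>+z. R z \<partial>m)"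
    unfolding G_def by (rule nn_integral_m[symmetric]) measurable
  finally show ?thesis .
qed

definition finite_dim_m :: "('b \<times> 'a \<times> real) set set" where
  "finite_dim_m = {A\<in>sets m. \<exists>J. finite J \<and> J \<subseteq> I \<and> (\<forall>y\<in>space N. \<forall>x\<in>space M. \<forall>x'\<in>space M. \<forall>s.
     (\<forall>j\<in>J. c j x = c j x') \<longrightarrow> ((y, x, s) \<in> A \<longleftrightarrow> (y, x', s) \<in> A))}"

lemma finite_dim_mI:
  assumes "A \<in> sets m" "finite J" "J \<subseteq> I"
    and "\<And>y x x' s. y \<in> space N \<Longrightarrow> x \<in> space M \<Longrightarrow> x' \<in> space M \<Longrightarrow> \<forall>j\<in>J. c j x = c j x' \<Longrightarrow>
      (y, x, s) \<in> A \<longleftrightarrow> (y, x', s) \<in> A"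
  shows "A \<in> finite_dim_m"
  unfolding finite_dim_m_def
  by (intro CollectI conjI exI[of _ J] assms(1-3)) (intro ballI allI impI, rule assms(4); assumption)

lemma finite_dim_mE:
  assumes "A \<in> finite_dim_m"
  obtains J where "A \<in> sets m" "finite J" "J \<subseteq> I"
    "\<And>y x x' s. y \<in> space N \<Longrightarrow> x \<in> space M \<Longrightarrow> x' \<in> space M \<Longrightarrow> \<forall>j\<in>J. c j x = c j x' \<Longrightarrow>
      (y, x, s) \<in> A \<longleftrightarrow> (y, x', s) \<in> A"
proof -
  from assms obtain J where A: "A \<in> sets m" and J: "finite J" "J \<subseteq> I"
    and dep: "\<forall>y\<in>space N. \<forall>x\<in>space M. \<forall>x'\<in>space M. \<forall>s.
      (\<forall>j\<in>J. c j x = c j x') \<longrightarrow> ((y, x, s) \<in> A \<longleftrightarrow> (y, x', s) \<in> A)"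
    unfolding finite_dim_m_def mem_Collect_eq by (elim conjE exE)
  show thesis
    by (rule that[OF A J dep[THEN bspec, THEN bspec, THEN bspec, THEN spec, THEN mp]])
qed

lemma algebra_finite_dim_m: "algebra (space m) finite_dim_m"
proof (rule algebra_iff_Un[THEN iffD2], intro conjI ballI)
  show "finite_dim_m \<subseteq> Pow (space m)" by (auto simp: finite_dim_m_def dest: sets.sets_into_space)
  show "{} \<in> finite_dim_m" by (rule finite_dim_mI[of _ "{}"]) auto
  show "space m - S \<in> finite_dim_m" if S: "S \<in> finite_dim_m" for S
    using S
  proof (rule finite_dim_mE)
    fix J assume J: "S \<in> sets m" "finite J" "J \<subseteq> I"
      and dep: "\<And>y x x' s. y \<in> space N \<Longrightarrow> x \<in> space M \<Longrightarrow> x' \<in> space M \<Longrightarrow> \<forall>j\<in>J. c j x = c j x' \<Longrightarrow>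
        (y, x, s) \<in> S \<longleftrightarrow> (y, x', s) \<in> S"
    show ?thesis
    proof (rule finite_dim_mI[of _ J])
      fix y x x' s assume *: "y \<in> space N" "x \<in> space M" "x' \<in> space M" "\<forall>j\<in>J. c j x = c j x'"
      show "(y, x, s) \<in> space m - S \<longleftrightarrow> (y, x', s) \<in> space m - S"
        using dep[OF *, of s] *(1-3) by (simp add: space_m)
    qed (use J in simp_all)
  qed
  show "S \<union> T \<in> finite_dim_m" if S: "S \<in> finite_dim_m" and T: "T \<in> finite_dim_m" for S T
    using S
  proof (rule finite_dim_mE)
    fix J assume J: "S \<in> sets m" "finite J" "J \<subseteq> I"
      and S: "\<And>y x x' s. y \<in> space N \<Longrightarrow> x \<in> space M \<Longrightarrow> x' \<in> space M \<Longrightarrow> \<forall>j\<in>J. c j x = c j x' \<Longrightarrow>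
        (y, x, s) \<in> S \<longleftrightarrow> (y, x', s) \<in> S"
    show ?thesis using T
    proof (rule finite_dim_mE)
      fix K assume K: "T \<in> sets m" "finite K" "K \<subseteq> I"
        and T: "\<And>y x x' s. y \<in> space N \<Longrightarrow> x \<in> space M \<Longrightarrow> x' \<in> space M \<Longrightarrow> \<forall>j\<in>K. c j x = c j x' \<Longrightarrow>
          (y, x, s) \<in> T \<longleftrightarrow> (y, x', s) \<in> T"
      show ?thesis
      proof (rule finite_dim_mI[of _ "J \<union> K"])
        fix y x x' s assume *: "y \<in> space N" "x \<in> space M" "x' \<in> space M" "\<forall>j\<in>J \<union> K. c j x = c j x'"
        have "(y, x, s) \<in> S \<longleftrightarrow> (y, x', s) \<in> S" by (rule S[OF *(1-3)]) (use *(4) in simp)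
        moreover have "(y, x, s) \<in> T \<longleftrightarrow> (y, x', s) \<in> T" by (rule T[OF *(1-3)]) (use *(4) in simp)
        ultimately show "(y, x, s) \<in> S \<union> T \<longleftrightarrow> (y, x', s) \<in> S \<union> T" by simp
      qed (use J K in simp_all)
    qed
  qed
qed

lemma sets_finite_dim_m: "sets m = sigma_sets (space m) finite_dim_m"
proof (rule antisym)
  have sub: "finite_dim_m \<subseteq> Pow (space m)" by (auto simp: finite_dim_m_def dest: sets.sets_into_space)
  define S where "S = sigma (space m) finite_dim_m"
  have sets_S: "sets S = sigma_sets (space m) finite_dim_m" and space_S: "space S = space m"
    using sub by (auto simp: S_def)
  have inS: "A \<in> sets S" if "A \<in> finite_dim_m" for A using that sets_S by auto
  have 1: "fst \<in> S \<rightarrow>\<^sub>M N"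
  proof (rule measurableI)
    fix Q assume [measurable]: "Q \<in> sets N"
    have "fst -` Q \<inter> space m \<in> sets m" by measurable
    then have "fst -` Q \<inter> space m \<in> finite_dim_m"
      by (rule finite_dim_mI[of _ "{}"]) (auto simp: space_m)
    then show "fst -` Q \<inter> space S \<in> sets S" unfolding space_S by (rule inS)
  qed (auto simp: space_S space_m)
  have 2: "(\<lambda>z. fst (snd z)) \<in> S \<rightarrow>\<^sub>M M"
  proof (rule coordinate_map_measurable)
    fix i assume i: "i \<in> I"
    note [measurable] = coordinate_measurable[OF i]
    have "{z\<in>space m. c i (fst (snd z))} \<in> sets m" by measurable
    then have "{z\<in>space m. c i (fst (snd z))} \<in> finite_dim_m"
      by (rule finite_dim_mI[of _ "{i}"]) (use i in \<open>auto simp: space_m\<close>)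
    then show "Measurable.pred S (\<lambda>z. c i (fst (snd z)))"
      unfolding pred_def space_S by (rule inS)
  qed (auto simp: space_S space_m)
  have 3: "(\<lambda>z. snd (snd z)) \<in> S \<rightarrow>\<^sub>M borel"
  proof (rule measurableI)
    fix Q :: "real set" assume [measurable]: "Q \<in> sets borel"
    have "(\<lambda>z. snd (snd z)) -` Q \<inter> space m \<in> sets m" by measurable
    then have "(\<lambda>z. snd (snd z)) -` Q \<inter> space m \<in> finite_dim_m"
      by (rule finite_dim_mI[of _ "{}"]) (auto simp: space_m)
    then show "(\<lambda>z. snd (snd z)) -` Q \<inter> space S \<in> sets S" unfolding space_S by (rule inS)
  qed auto
  have id: "(\<lambda>z. z) \<in> S \<rightarrow>\<^sub>M N \<Otimes>\<^sub>M (M \<Otimes>\<^sub>M borel)"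
    by (intro measurable_pair) (use 1 2 3 in \<open>simp_all add: comp_def\<close>)
  show "sets m \<subseteq> sigma_sets (space m) finite_dim_m"
  proof
    fix A assume A: "A \<in> sets m"
    then have "(\<lambda>z. z) -` A \<inter> space S \<in> sets S"
      using sets_m by (intro measurable_sets[OF id]) simp
    moreover have "(\<lambda>z. z) -` A \<inter> space S = A" using sets.sets_into_space[OF A] space_S by auto
    ultimately show "A \<in> sigma_sets (space m) finite_dim_m" using sets_S by simp
  qed
  show "sigma_sets (space m) finite_dim_m \<subseteq> sets m"
    by (rule sets.sigma_sets_subset) (auto simp: finite_dim_m_def)
qed

lemma AE_m_of_M:
  assumes "AE x in M. P x"
  shows "AE z in m. P (fst (snd z))"
proof -
  interpret mm: sigma_finite_measure "maharam_measure M"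
    by (rule sigma_finite_maharam_measure[OF nonsingular])
  show ?thesis
    unfolding m_def
    by (intro AE_pair_snd mm.sigma_finite_measure_axioms)
      (unfold maharam_measure_def, intro AE_pair_fst sigma_finite_exp_measure assms)
qed

lemma emeasure_upper_finite: "emeasure m {z\<in>space m. a \<le> snd (snd z)} < \<infinity>"
proof -
  have "{z\<in>space m. a \<le> snd (snd z)} = {z\<in>space m. fst (snd z) \<in> space M \<and> snd (snd z) \<in> {a..}}"
    by (auto simp: space_m)
  then have "emeasure m {z\<in>space m. a \<le> snd (snd z)} = emeasure exp_measure {a..}"
    by (simp only:) (subst emeasure_m_rectangle, auto simp: emeasure_space_1)
  also have "emeasure exp_measure {a..} = (\<integral>\<^sup>+s. indicator {a..} s \<partial>exp_measure)" by simp
  also have "\<dots> = (\<integral>\<^sup>+s. indicator {0..} (- a + s) \<partial>exp_measure)"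
    by (intro nn_integral_cong) (simp add: indicator_def)
  also have "\<dots> = ennreal (exp (- a)) * (\<integral>\<^sup>+s. indicator {0..} s \<partial>exp_measure)"
    by (rule nn_integral_exp_measure_shift) measurable
  also have "(\<integral>\<^sup>+s. indicator {0..} s \<partial>exp_measure) = (1::ennreal)"
    using nn_intergal_power_times_exp_Ici[of 0]
    by (subst nn_integral_density) (auto simp: )
  finally show ?thesis by (simp add: ennreal_mult_less_top)
qed

text \<open>The set \<open>B\<close> of the Hopf argument is a half line in the real coordinate: it has finite measure, and two orbits with
equal real coordinates visit it at the same times.\<close>

lemma AE_flip_invariant:
  assumes A [measurable]: "A \<in> sets m" and inv: "\<And>g. AE z in m. \<tau> g z \<in> A \<longleftrightarrow> z \<in> A" and i: "i \<in> I"
  shows "AE z in m. \<theta> i z \<in> A \<longleftrightarrow> z \<in> A"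
proof -
  obtain \<sigma>' :: int and n0 :: nat where \<sigma>': "\<sigma>' \<in> {1, -1}" and base: "\<And>n. n0 \<le> n \<Longrightarrow> q (\<pi> (\<sigma>' * int n) i) = base"
    using base_direction[OF i] by blast
  define \<sigma> where "\<sigma> = - \<sigma>'"
  have \<sigma>: "\<sigma> \<in> {1, -1}" using \<sigma>' by (auto simp: \<sigma>_def)
  have ln_eq: "AE z in m. \<forall>n\<ge>n0. ln (rn_cocycle M act (\<sigma> * int n) (flip i (fst (snd z)))) + shift i (c i (fst (snd z)))
      = ln (rn_cocycle M act (\<sigma> * int n) (fst (snd z)))"
  proof (rule AE_m_of_M, unfold AE_all_countable, intro allI)
    fix n
    show "AE x in M. n0 \<le> n \<longrightarrow> ln (rn_cocycle M act (\<sigma> * int n) (flip i x)) + shift i (c i x)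
      = ln (rn_cocycle M act (\<sigma> * int n) x)"
    proof (cases "n0 \<le> n")
      case True
      interpret D: coin_flip "distr M M (act (- (\<sigma> * int n)))" I c "\<lambda>i. q (\<pi> (- (\<sigma> * int n)) i)" flip \<delta>
        by (rule coin_flip_distr_act)
      have *: "q (\<pi> (- (\<sigma> * int n)) i) = base" using base[OF True] by (simp add: \<sigma>_def)
      show ?thesis
        using AE_rn_cocycle_flip[OF i, of "\<sigma> * int n"]
        by eventually_elim (auto simp: D.odds_def * shift_def)
    qed simp
  qed
  have key: "AE z in m. z \<in> {z\<in>space m. a \<le> snd (snd z)} \<and> \<theta> i z \<in> {z\<in>space m. a \<le> snd (snd z)} \<longrightarrow> (\<theta> i z \<in> A \<longleftrightarrow> z \<in> A)"
    for a :: real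
  proof -
    let ?B = "{z\<in>space m. a \<le> snd (snd z)}"
    have B [measurable]: "?B \<in> sets m" by measurable
    show ?thesis
    proof (rule AE_asymptotic_invariance[OF B AE_visits[OF \<sigma> B] \<theta>_measurable[OF i] _ nn_integral_\<theta>_le[OF i] _ A inv])
      show "AE z in m. \<forall>n\<ge>n0. \<tau> (\<sigma> * int n) (\<theta> i z) \<in> ?B \<longleftrightarrow> \<tau> (\<sigma> * int n) z \<in> ?B"
        using ln_eq AE_space
      proof eventually_elim
        case (elim z)
        obtain y x s where z: "z = (y, x, s)" by (cases z) auto
        have sp: "z \<in> space m" "\<theta> i z \<in> space m"
          using elim(2) measurable_space[OF \<theta>_measurable[OF i]] by auto
        show ?case
        proof (intro allI impI)
          fix n assume "n0 \<le> n"
          then have "ln (rn_cocycle M act (\<sigma> * int n) (flip i x)) + shift i (c i x)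
              = ln (rn_cocycle M act (\<sigma> * int n) x)" using elim(1) by (simp add: z)
          moreover have "\<tau> (\<sigma> * int n) z \<in> space m" "\<tau> (\<sigma> * int n) (\<theta> i z) \<in> space m"
            using sp measurable_space[OF act_measurable] by auto
          ultimately show "\<tau> (\<sigma> * int n) (\<theta> i z) \<in> ?B \<longleftrightarrow> \<tau> (\<sigma> * int n) z \<in> ?B"
            by (auto simp: z \<tau>_eq \<theta>_def)
        qed
      qed
    next
      fix \<epsilon> :: real assume \<epsilon>: "0 < \<epsilon>"
      let ?P = "density m (indicator ?B)"
      have finP: "finite_measure ?P"
        by (rule finite_measureI) (use emeasure_upper_finite[of a] in \<open>simp add: emeasure_density\<close>)
      have alg: "algebra (space ?P) finite_dim_m" "sets ?P = sigma_sets (space ?P) finite_dim_m"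
        using algebra_finite_dim_m sets_finite_dim_m by simp_all
      obtain A' where A': "A' \<in> finite_dim_m" "measure ?P (sym_diff A A') < \<epsilon>"
        using approximation_by_algebra[OF finP finP refl alg _ \<epsilon>, of A] A by auto
      have A'm [measurable]: "A' \<in> sets m" using A'(1) by (simp add: finite_dim_m_def)
      have "{z\<in>?B. \<not> (z \<in> A \<longleftrightarrow> z \<in> A')} = ?B \<inter> sym_diff A A'" by auto
      then have "emeasure m {z\<in>?B. \<not> (z \<in> A \<longleftrightarrow> z \<in> A')} = emeasure ?P (sym_diff A A')"
        by (simp only:) (subst emeasure_density, auto simp: indicator_inter_arith[symmetric] Int_commute)
      also have "\<dots> \<le> ennreal \<epsilon>"
        using A'(2) by (simp add: finite_measure.emeasure_eq_measure[OF finP] ennreal_leI)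
      finally have small: "emeasure m {z\<in>?B. \<not> (z \<in> A \<longleftrightarrow> z \<in> A')} \<le> ennreal \<epsilon>" .
      have "\<exists>N. AE z in m. \<forall>n\<ge>N. \<tau> (\<sigma> * int n) (\<theta> i z) \<in> A' \<longleftrightarrow> \<tau> (\<sigma> * int n) z \<in> A'"
        using A'(1)
      proof (rule finite_dim_mE)
        fix J assume J: "finite J" "J \<subseteq> I" and dep: "\<And>y x x' s. y \<in> space N \<Longrightarrow> x \<in> space M \<Longrightarrow> x' \<in> space M \<Longrightarrow>
          \<forall>j\<in>J. c j x = c j x' \<Longrightarrow> (y, x, s) \<in> A' \<longleftrightarrow> (y, x', s) \<in> A'"
        have "\<exists>n1. \<forall>n\<ge>n1. \<pi> (\<sigma> * int n) j \<noteq> i" if j: "j \<in> J" for j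
        proof (cases "\<exists>n. \<pi> (\<sigma> * int n) j = i")
          case True
          then obtain n where n: "\<pi> (\<sigma> * int n) j = i" ..
          have jI: "j \<in> I" using j J by auto
          have "k = n" if "\<pi> (\<sigma> * int k) j = i" for k
          proof -
            have "\<pi> (- (\<sigma> * int n) + \<sigma> * int k) j = \<pi> (- (\<sigma> * int n)) (\<pi> (\<sigma> * int n) j)"
              unfolding \<pi>_add[OF jI] by (simp add: that n)
            also have "\<dots> = j" by (rule \<pi>_cancel[OF jI])
            finally have "- (\<sigma> * int n) + \<sigma> * int k = 0" by (rule \<pi>_free[OF jI])
            then show ?thesis using \<sigma> by auto
          qed
          then show ?thesis by (intro exI[of _ "Suc n"]) auto
        qed auto
        then obtain n1 where n1: "\<And>j n. j \<in> J \<Longrightarrow> n1 j \<le> n \<Longrightarrow> \<pi> (\<sigma> * int n) j \<noteq> i" by metis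
        define n2 where "n2 = max n0 (Max (insert 0 (n1 ` J)))"
        have n2: "n1 j \<le> n2" if "j \<in> J" for j
          unfolding n2_def using J that by (intro max.coboundedI2 Max_ge) auto
        have "AE z in m. \<forall>n\<ge>n2. \<tau> (\<sigma> * int n) (\<theta> i z) \<in> A' \<longleftrightarrow> \<tau> (\<sigma> * int n) z \<in> A'"
          using ln_eq AE_space
        proof eventually_elim
          case (elim z)
          obtain y x s where z: "z = (y, x, s)" by (cases z) auto
          have x: "x \<in> space M" using elim(2) by (simp add: z space_m)
          show ?case
          proof (intro allI impI)
            fix n assume n: "n2 \<le> n"
            then have "ln (rn_cocycle M act (\<sigma> * int n) (flip i x)) + shift i (c i x)
                = ln (rn_cocycle M act (\<sigma> * int n) x)" using elim(1) by (simp add: z n2_def)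
            then have eq: "\<tau> (\<sigma> * int n) z = (act' (\<sigma> * int n) y, act (\<sigma> * int n) x, ln (rn_cocycle M act (\<sigma> * int n) x) + s)"
              "\<tau> (\<sigma> * int n) (\<theta> i z) = (act' (\<sigma> * int n) y, act (\<sigma> * int n) (flip i x), ln (rn_cocycle M act (\<sigma> * int n) x) + s)"
              by (simp_all add: z \<tau>_eq \<theta>_def algebra_simps)
            have "\<tau> (\<sigma> * int n) z \<in> space m" using elim(2) measurable_space[OF act_measurable] by auto
            then have y: "act' (\<sigma> * int n) y \<in> space N" by (simp add: eq space_m)
            have agree: "\<forall>j\<in>J. c j (act (\<sigma> * int n) (flip i x)) = c j (act (\<sigma> * int n) x)"
            proof
              fix j assume j: "j \<in> J"
              then have jI: "j \<in> I" using J by auto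
              have "\<pi> (\<sigma> * int n) j \<noteq> i" using n1[OF j] n2[OF j] n by auto
              then show "c j (act (\<sigma> * int n) (flip i x)) = c j (act (\<sigma> * int n) x)"
                using x i jI by (simp add: coord_act flip_space coord_flip \<pi>_I)
            qed
            show "\<tau> (\<sigma> * int n) (\<theta> i z) \<in> A' \<longleftrightarrow> \<tau> (\<sigma> * int n) z \<in> A'"
              unfolding eq by (rule dep[OF y _ _ agree]) (use x i in \<open>simp_all add: act_space flip_space\<close>)
          qed
        qed
        then show ?thesis ..
      qed
      with small A'm show "\<exists>A'\<in>sets m. emeasure m {z\<in>?B. \<not> (z \<in> A \<longleftrightarrow> z \<in> A')} \<le> ennreal \<epsilon> \<and>
        (\<exists>N. AE z in m. \<forall>n\<ge>N. \<tau> (\<sigma> * int n) (\<theta> i z) \<in> A' \<longleftrightarrow> \<tau> (\<sigma> * int n) z \<in> A')" by blast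
    qed simp
  qed
  have "AE z in m. \<forall>a::nat. z \<in> {z\<in>space m. - real a \<le> snd (snd z)} \<and> \<theta> i z \<in> {z\<in>space m. - real a \<le> snd (snd z)}
      \<longrightarrow> (\<theta> i z \<in> A \<longleftrightarrow> z \<in> A)"
    unfolding AE_all_countable by (intro allI key)
  with AE_space show ?thesis
  proof eventually_elim
    case (elim z)
    have sp: "\<theta> i z \<in> space m" using elim(1) measurable_space[OF \<theta>_measurable[OF i]] by auto
    obtain a :: nat where "max (- snd (snd z)) (- snd (snd (\<theta> i z))) \<le> real a" using real_arch_simple by blast
    then have "z \<in> {z\<in>space m. - real a \<le> snd (snd z)}" "\<theta> i z \<in> {z\<in>space m. - real a \<le> snd (snd z)}"
      using elim(1) sp by auto
    then show ?case using elim(2) by blast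
  qed
qed

end


section \<open>Flips and Lebesgue measure on the real coordinate\<close>

text \<open>A primitive of the indicator function of \<open>{0..<l}\<close>.\<close>

definition clamp :: "real \<Rightarrow> real \<Rightarrow> real" where
  "clamp l r = max 0 (min r l)"

text \<open>First order Taylor expansion of the primitive. The right-hand side has integral \<open>2 * \<sigma>\<^sup>2\<close>, of second order.\<close>

lemma clamp_difference:
  assumes "0 \<le> \<sigma>" "0 \<le> l"
  shows "\<bar>clamp l (r - \<sigma>) - clamp l r + \<sigma> * indicator {0..<l} r\<bar> \<le> \<sigma> * (indicator {0..\<sigma>} r + indicator {l..l+\<sigma>} r)"
  using assms by (auto simp: clamp_def indicator_def max_def min_def)

lemma indicator_difference:
  assumes "0 \<le> (\<sigma>::real)" "0 \<le> l"
  shows "\<bar>indicator {0..<l} (r - \<sigma>) - indicator {0..<l} r :: real\<bar> \<le> indicator {0..\<sigma>} r + indicator {l..l+\<sigma>} r"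
  using assms by (auto simp: indicator_def)

context driven_coin_system
begin

text \<open>Lebesgue measure on the real coordinate has the same null sets as \<open>exp (- s) ds\<close>, and flips preserve it up to the
odds of the coin.\<close>

definition mL :: "('b \<times> 'a \<times> real) measure" where
  "mL = N \<Otimes>\<^sub>M (M \<Otimes>\<^sub>M lborel)"

sublocale MR: pair_sigma_finite M lborel ..
sublocale NMR: pair_sigma_finite N "M \<Otimes>\<^sub>M lborel" ..
sublocale mL: sigma_finite_measure mL
  unfolding mL_def by (rule NMR.sigma_finite_measure_axioms)

lemma sets_mL [measurable_cong]: "sets mL = sets (N \<Otimes>\<^sub>M (M \<Otimes>\<^sub>M borel))"
  unfolding mL_def by (intro sets_pair_measure_cong) simp_all

lemma sets_mL_m: "sets mL = sets m"
  by (simp add: sets_mL sets_m)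

lemma space_mL: "space mL = space N \<times> space M \<times> UNIV"
  by (simp add: mL_def space_pair_measure)

lemma nn_integral_mL:
  assumes R: "R \<in> borel_measurable mL"
  shows "(\<integral>\<^sup>+z. R z \<partial>mL) = (\<integral>\<^sup>+y. \<integral>\<^sup>+x. \<integral>\<^sup>+s. R (y, x, s) \<partial>lborel \<partial>M \<partial>N)"
proof -
  have 1: "R \<in> borel_measurable (N \<Otimes>\<^sub>M (M \<Otimes>\<^sub>M lborel))" using R by (simp add: mL_def)
  have "(\<integral>\<^sup>+z. R z \<partial>mL) = (\<integral>\<^sup>+y. \<integral>\<^sup>+w. R (y, w) \<partial>(M \<Otimes>\<^sub>M lborel) \<partial>N)"
    unfolding mL_def by (rule MR.P.nn_integral_fst[OF 1, symmetric])
  also have "\<dots> = (\<integral>\<^sup>+y. \<integral>\<^sup>+x. \<integral>\<^sup>+s. R (y, x, s) \<partial>lborel \<partial>M \<partial>N)"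
  proof (rule nn_integral_cong)
    fix y assume y: "y \<in> space N"
    have "(\<lambda>w. R (y, w)) \<in> borel_measurable (M \<Otimes>\<^sub>M lborel)"
      by (rule measurable_compose[OF measurable_Pair1'[OF y] 1])
    then show "(\<integral>\<^sup>+w. R (y, w) \<partial>(M \<Otimes>\<^sub>M lborel)) = (\<integral>\<^sup>+x. \<integral>\<^sup>+s. R (y, x, s) \<partial>lborel \<partial>M)"
      by (rule lborel.nn_integral_fst[symmetric])
  qed
  finally show ?thesis .
qed

lemma AE_mL_iff: "(AE z in mL. P z) \<longleftrightarrow> (AE z in m. P z)"
proof -
  have "null_sets mL = null_sets m"
  proof -
    have "emeasure mL S = 0 \<longleftrightarrow> emeasure m S = 0" if S: "S \<in> sets m" for S
    proof -
      have [measurable]: "S \<in> sets mL" "S \<in> sets m" using S by (simp_all add: sets_mL_m)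
      have "emeasure m S = (\<integral>\<^sup>+z. indicator S z \<partial>m)" by simp
      also have "\<dots> = (\<integral>\<^sup>+y. \<integral>\<^sup>+x. \<integral>\<^sup>+s. indicator S (y, x, s) \<partial>exp_measure \<partial>M \<partial>N)"
        by (rule nn_integral_m) measurable
      also have "\<dots> = (\<integral>\<^sup>+y. \<integral>\<^sup>+x. \<integral>\<^sup>+s. ennreal (exp (- snd (snd (y, x, s)))) * indicator S (y, x, s) \<partial>lborel \<partial>M \<partial>N)"
      proof (intro nn_integral_cong)
        fix y x assume [measurable]: "y \<in> space N" "x \<in> space M"
        have "(\<lambda>s. indicator S (y, x, s) :: ennreal) \<in> borel_measurable borel" by measurable
        then show "(\<integral>\<^sup>+s. indicator S (y, x, s) \<partial>exp_measure) =
          (\<integral>\<^sup>+s. ennreal (exp (- snd (snd (y, x, s)))) * indicator S (y, x, s) \<partial>lborel)"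
          by (subst nn_integral_density) auto
      qed
      also have "\<dots> = (\<integral>\<^sup>+z. ennreal (exp (- snd (snd z))) * indicator S z \<partial>mL)"
        by (rule nn_integral_mL[symmetric]) measurable
      finally have "emeasure m S = 0 \<longleftrightarrow> (AE z in mL. ennreal (exp (- snd (snd z))) * indicator S z = 0)"
        by (simp add: nn_integral_0_iff_AE)
      also have "\<dots> \<longleftrightarrow> (AE z in mL. indicator S z = (0::ennreal))" by simp
      also have "\<dots> \<longleftrightarrow> emeasure mL S = 0"
        by (subst nn_integral_0_iff_AE[symmetric]) auto
      finally show ?thesis by simp
    qed
    then show ?thesis by (auto simp: null_sets_def sets_mL_m)
  qed
  then show ?thesis
    by (simp add: eventually_ae_filter space_mL space_m)
qed

lemma nn_integral_\<theta>:
  assumes i: "i \<in> I" and R [measurable]: "R \<in> borel_measurable mL"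
  shows "(\<integral>\<^sup>+z. R (\<theta> i z) \<partial>mL) = (\<integral>\<^sup>+z. R z * ennreal (odds i (c i (fst (snd z)))) \<partial>mL)"
proof -
  note [measurable] = flip_measurable[OF i] odds_measurable[OF i]
  have [measurable]: "\<theta> i \<in> mL \<rightarrow>\<^sub>M mL"
    using \<theta>_measurable[OF i] measurable_cong_sets[OF sets_mL_m sets_mL_m] by blast
  define od where "od x = ennreal (odds i (c i x))" for x
  have [measurable]: "od \<in> borel_measurable M" unfolding od_def by measurable
  define G where "G y x = (\<integral>\<^sup>+s. R (y, x, s) \<partial>lborel)" for y x
  have G [measurable]: "G y \<in> borel_measurable M" if "y \<in> space N" for y
    using that unfolding G_def by measurable
  have "(\<integral>\<^sup>+z. R (\<theta> i z) \<partial>mL) = (\<integral>\<^sup>+y. \<integral>\<^sup>+x. \<integral>\<^sup>+s. R (\<theta> i (y, x, s)) \<partial>lborel \<partial>M \<partial>N)"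
    by (rule nn_integral_mL) measurable
  also have "\<dots> = (\<integral>\<^sup>+y. \<integral>\<^sup>+x. G y (flip i x) \<partial>M \<partial>N)"
  proof (intro nn_integral_cong)
    fix y x assume [measurable]: "y \<in> space N" and x: "x \<in> space M"
    have [measurable]: "flip i x \<in> space M" using x i flip_space by simp
    have "G y (flip i x) = (\<integral>\<^sup>+s. R (y, flip i x, shift i (c i x) + 1 * s) \<partial>lborel)"
      unfolding G_def by (subst nn_integral_real_affine[where c = 1 and t = "shift i (c i x)"]) auto
    then show "(\<integral>\<^sup>+s. R (\<theta> i (y, x, s)) \<partial>lborel) = G y (flip i x)"
      by (simp add: \<theta>_def add.commute)
  qed
  also have "\<dots> = (\<integral>\<^sup>+y. \<integral>\<^sup>+x. G y x * od x \<partial>M \<partial>N)"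
    unfolding od_def by (intro nn_integral_cong nn_integral_flip[OF i] G)
  also have "\<dots> = (\<integral>\<^sup>+y. \<integral>\<^sup>+x. \<integral>\<^sup>+s. R (y, x, s) * od (fst (snd (y, x, s))) \<partial>lborel \<partial>M \<partial>N)"
  proof (intro nn_integral_cong)
    fix y x assume [measurable]: "y \<in> space N" "x \<in> space M"
    have [measurable]: "(\<lambda>s. R (y, x, s)) \<in> borel_measurable borel" by measurable
    show "G y x * od x = (\<integral>\<^sup>+s. R (y, x, s) * od (fst (snd (y, x, s))) \<partial>lborel)"
      unfolding G_def by (simp add: nn_integral_multc)
  qed
  also have "\<dots> = (\<integral>\<^sup>+z. R z * od (fst (snd z)) \<partial>mL)"
    by (rule nn_integral_mL[symmetric]) measurable
  finally show ?thesis by (simp add: od_def)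
qed

lemma integral_\<theta>:
  fixes R :: "'b \<times> 'a \<times> real \<Rightarrow> real"
  assumes i: "i \<in> I" and R [measurable]: "R \<in> borel_measurable mL"
  shows "(\<integral>z. R (\<theta> i z) \<partial>mL) = (\<integral>z. odds i (c i (fst (snd z))) * R z \<partial>mL)"
proof -
  define od where "od x = odds i (c i x)" for x
  have [measurable]: "od \<in> borel_measurable M" unfolding od_def by (rule odds_measurable[OF i])
  have od_nn: "0 \<le> od x" for x unfolding od_def using odds_pos[OF i] by (simp add: less_imp_le)
  have [measurable]: "\<theta> i \<in> mL \<rightarrow>\<^sub>M mL"
    using \<theta>_measurable[OF i] measurable_cong_sets[OF sets_mL_m sets_mL_m] by blast
  have "distr mL mL (\<theta> i) = density mL (\<lambda>z. ennreal (od (fst (snd z))))"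
  proof (rule measure_eqI)
    fix S assume "S \<in> sets (distr mL mL (\<theta> i))"
    then have [measurable]: "S \<in> sets mL" by simp
    have "emeasure (distr mL mL (\<theta> i)) S = (\<integral>\<^sup>+z. indicator S z \<partial>distr mL mL (\<theta> i))" by simp
    also have "\<dots> = (\<integral>\<^sup>+z. indicator S (\<theta> i z) \<partial>mL)" by (rule nn_integral_distr) measurable
    also have "\<dots> = (\<integral>\<^sup>+z. indicator S z * ennreal (od (fst (snd z))) \<partial>mL)"
      unfolding od_def by (rule nn_integral_\<theta>[OF i]) measurable
    also have "\<dots> = emeasure (density mL (\<lambda>z. ennreal (od (fst (snd z))))) S"
      by (simp add: emeasure_density mult.commute)
    finally show "emeasure (distr mL mL (\<theta> i)) S = emeasure (density mL (\<lambda>z. ennreal (od (fst (snd z))))) S" .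
  qed simp
  moreover have "(\<integral>z. R z \<partial>distr mL mL (\<theta> i)) = (\<integral>z. R (\<theta> i z) \<partial>mL)"
    by (rule integral_distr) measurable
  ultimately have "(\<integral>z. R (\<theta> i z) \<partial>mL) = (\<integral>z. R z \<partial>density mL (\<lambda>z. ennreal (od (fst (snd z)))))"
    by simp
  also have "\<dots> = (\<integral>z. od (fst (snd z)) * R z \<partial>mL)"
    by (subst integral_density) (auto simp: od_nn)
  finally show ?thesis by (simp add: od_def)
qed

lemma emeasure_mL_rectangle:
  assumes "Q \<in> sets N" "S \<in> sets M" "U \<in> sets borel"
  shows "emeasure mL {z\<in>space mL. fst z \<in> Q \<and> fst (snd z) \<in> S \<and> snd (snd z) \<in> U} = emeasure N Q * emeasure M S * emeasure lborel U"
proof -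
  have "{z\<in>space mL. fst z \<in> Q \<and> fst (snd z) \<in> S \<and> snd (snd z) \<in> U} = Q \<times> (S \<times> U)"
    using sets.sets_into_space[OF assms(1)] sets.sets_into_space[OF assms(2)] by (auto simp: space_mL)
  then show ?thesis
    using assms unfolding mL_def
    by (simp add: MR.P.emeasure_pair_measure_Times lborel.emeasure_pair_measure_Times mult.assoc)
qed

definition test_function :: "(real \<Rightarrow> real) \<Rightarrow> bool" where
  "test_function \<psi> \<longleftrightarrow> \<psi> \<in> borel_measurable borel \<and> (\<exists>B L. \<forall>s. \<bar>\<psi> s\<bar> \<le> B * indicator {-L..L} s)"

lemma integrable_box: "integrable mL (\<lambda>z. indicator {a..b} (snd (snd z)) :: real)"
proof -
  let ?S = "{z\<in>space mL. fst z \<in> space N \<and> fst (snd z) \<in> space M \<and> snd (snd z) \<in> {a..b}}"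
  have "integrable mL (indicator ?S :: _ \<Rightarrow> real)"
  proof (rule integrable_real_indicator)
    show "?S \<in> sets mL" by measurable
    show "emeasure mL ?S < \<infinity>"
      by (subst emeasure_mL_rectangle) (auto simp: emeasure_space_1 N.emeasure_space_1 emeasure_lborel_Icc_eq)
  qed
  then show ?thesis
    by (rule Bochner_Integration.integrable_cong[THEN iffD1, rotated -1]) (auto simp: space_mL indicator_def)
qed

lemma integral_rectangle:
  assumes S: "S \<in> sets M" and ab: "a \<le> b"
  shows "(\<integral>z. indicator S (fst (snd z)) * indicator {a..b} (snd (snd z)) \<partial>mL) = prob S * (b - a)"
proof -
  let ?S = "{z\<in>space mL. fst z \<in> space N \<and> fst (snd z) \<in> S \<and> snd (snd z) \<in> {a..b}}"
  have "(\<integral>z. indicator S (fst (snd z)) * indicator {a..b} (snd (snd z)) \<partial>mL) = (\<integral>z. indicator ?S z \<partial>mL :: real)"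
    by (intro Bochner_Integration.integral_cong) (auto simp: space_mL indicator_def)
  also have "\<dots> = measure mL ?S"
  proof -
    have "?S \<inter> space mL = ?S" by auto
    then show ?thesis by simp
  qed
  also have "\<dots> = prob S * (b - a)"
    unfolding measure_def using S ab
    by (subst emeasure_mL_rectangle)
      (auto simp: N.emeasure_space_1 emeasure_eq_measure ennreal_mult[symmetric] measure_nonneg)
  finally show ?thesis .
qed

lemma integrable_test:
  assumes \<psi>: "test_function \<psi>" and f [measurable]: "f \<in> borel_measurable mL" and f_le: "\<And>z. \<bar>f z\<bar> \<le> K"
  shows "integrable mL (\<lambda>z. f z * \<psi> (snd (snd z)) :: real)"
proof -
  obtain B L where [measurable]: "\<psi> \<in> borel_measurable borel" and BL: "\<And>s. \<bar>\<psi> s\<bar> \<le> B * indicator {-L..L} s"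
    using \<psi> by (auto simp: test_function_def)
  have K: "0 \<le> K" using f_le[of undefined] by linarith
  show ?thesis
  proof (rule Bochner_Integration.integrable_bound)
    show "integrable mL (\<lambda>z. K * (B * indicator {-L..L} (snd (snd z))))"
      by (intro integrable_mult_right integrable_box)
    show "AE z in mL. norm (f z * \<psi> (snd (snd z))) \<le> norm (K * (B * indicator {-L..L} (snd (snd z))))"
    proof (rule AE_I2)
      fix z
      have "norm (f z * \<psi> (snd (snd z))) \<le> K * (B * indicator {-L..L} (snd (snd z)))"
        unfolding real_norm_def abs_mult using K by (intro mult_mono f_le BL) auto
      then show "norm (f z * \<psi> (snd (snd z))) \<le> norm (K * (B * indicator {-L..L} (snd (snd z))))"
        by simp
    qed
  qed measurable
qed

text \<open>For fixed \<open>A\<close> this is a distribution in the real coordinate, obtained by integrating out \<open>y\<close> and \<open>x\<close>. It is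
bounded by Lebesgue measure.\<close>

definition U :: "('b \<times> 'a \<times> real) set \<Rightarrow> (real \<Rightarrow> real) \<Rightarrow> real" where
  "U A \<psi> = (\<integral>z. indicator A z * \<psi> (snd (snd z)) \<partial>mL)"

lemma integrable_U:
  assumes "test_function \<psi>" "A \<in> sets m"
  shows "integrable mL (\<lambda>z. indicator A z * \<psi> (snd (snd z)))"
  using assms by (intro integrable_test[where K = 1]) (auto simp: sets_mL_m indicator_def)

lemma U_le_boxes:
  assumes \<phi>: "test_function \<phi>" and A: "A \<in> sets m"
    and le: "\<And>s. \<bar>\<phi> s\<bar> \<le> k * (indicator {a..a+\<sigma>} s + indicator {b..b+\<sigma>} s + d * (indicator {a'..a'+\<sigma>} s + indicator {b'..b'+\<sigma>} s))"
    and pos: "0 \<le> k" "0 \<le> \<sigma>" "0 \<le> d"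
  shows "\<bar>U A \<phi>\<bar> \<le> k * (2 * \<sigma> * (1 + d))"
proof -
  have box: "(\<integral>z. indicator {a..a+\<sigma>} (snd (snd z)) \<partial>mL) = \<sigma>" for a
  proof -
    have "(\<integral>z. indicator {a..a+\<sigma>} (snd (snd z)) \<partial>mL) = (\<integral>z. indicator (space M) (fst (snd z)) * indicator {a..a+\<sigma>} (snd (snd z)) \<partial>mL :: real)"
      by (intro Bochner_Integration.integral_cong) (auto simp: space_mL)
    then show ?thesis using pos by (simp add: integral_rectangle prob_space)
  qed
  let ?g = "\<lambda>z. k * (indicator {a..a+\<sigma>} (snd (snd z)) + indicator {b..b+\<sigma>} (snd (snd z)) +
    d * (indicator {a'..a'+\<sigma>} (snd (snd z)) + indicator {b'..b'+\<sigma>} (snd (snd z)))) :: real"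
  have g: "integrable mL ?g"
    by (intro integrable_mult_right Bochner_Integration.integrable_add integrable_box)
  have "\<bar>U A \<phi>\<bar> \<le> (\<integral>z. ?g z \<partial>mL)"
    unfolding U_def
  proof (rule order_trans[OF integral_abs_bound integral_mono])
    show "integrable mL (\<lambda>z. \<bar>indicator A z * \<phi> (snd (snd z))\<bar>)"
      using integrable_U[OF \<phi> A] by (rule integrable_abs)
    show "\<bar>indicator A z * \<phi> (snd (snd z))\<bar> \<le> ?g z" for z
      using le[of "snd (snd z)"] by (cases "z \<in> A") auto
  qed (rule g)
  also have "\<dots> = k * (2 * \<sigma> * (1 + d))"
    by (simp add: integrable_box box) (simp add: algebra_simps)
  finally show ?thesis .
qed

text \<open>The flip of \<open>i\<close> exchanges the two halves of an invariant set in which the coin \<open>i\<close> shows \<open>True\<close> and \<open>False\<close>,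
and translates the real coordinate.\<close>

lemma U_flip:
  assumes i: "i \<in> I" and A: "A \<in> sets m" and inv: "AE z in m. \<theta> i z \<in> A \<longleftrightarrow> z \<in> A"
    and \<psi>: "test_function \<psi>"
  shows "odds i True * U {z\<in>A. c i (fst (snd z))} \<psi> = U {z\<in>A. \<not> c i (fst (snd z))} (\<lambda>s. \<psi> (s + shift i False))"
proof -
  have [measurable]: "A \<in> sets mL" "\<psi> \<in> borel_measurable borel"
    using A \<psi> by (simp_all add: sets_mL_m test_function_def)
  note [measurable] = coordinate_measurable[OF i]
  have S: "{z\<in>A. c i (fst (snd z))} = A \<inter> {z\<in>space mL. c i (fst (snd z))}"
    using sets.sets_into_space[OF \<open>A \<in> sets mL\<close>] by auto
  let ?R = "\<lambda>z. indicator {z\<in>A. c i (fst (snd z))} z * \<psi> (snd (snd z))"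
  have R: "?R \<in> borel_measurable mL" unfolding S by measurable
  have "U {z\<in>A. \<not> c i (fst (snd z))} (\<lambda>s. \<psi> (s + shift i False)) = (\<integral>z. ?R (\<theta> i z) \<partial>mL)"
    unfolding U_def
  proof (rule integral_cong_AE)
    show "(\<lambda>z. ?R (\<theta> i z)) \<in> borel_measurable mL"
      using \<theta>_measurable[OF i] measurable_cong_sets[OF sets_mL_m sets_mL_m]
      by (intro measurable_compose[OF _ R]) blast
    have "{z\<in>A. \<not> c i (fst (snd z))} = A \<inter> {z\<in>space mL. \<not> c i (fst (snd z))}"
      using sets.sets_into_space[OF \<open>A \<in> sets mL\<close>] by auto
    then have [measurable]: "{z\<in>A. \<not> c i (fst (snd z))} \<in> sets mL" by simp
    show "(\<lambda>z. indicator {z\<in>A. \<not> c i (fst (snd z))} z * \<psi> (snd (snd z) + shift i False)) \<in> borel_measurable mL"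
      by measurable
    show "AE z in mL. indicator {z\<in>A. \<not> c i (fst (snd z))} z * \<psi> (snd (snd z) + shift i False) = ?R (\<theta> i z)"
      using inv[folded AE_mL_iff] AE_space
    proof eventually_elim
      case (elim z)
      obtain y x s where z: "z = (y, x, s)" by (cases z) auto
      have "c i (flip i x) = (\<not> c i x)"
        using elim(2) i by (simp add: z space_mL coord_flip)
      then show ?case using elim(1) by (auto simp: z \<theta>_def indicator_def)
    qed
  qed
  also have "\<dots> = (\<integral>z. odds i (c i (fst (snd z))) * ?R z \<partial>mL)" by (rule integral_\<theta>[OF i R])
  also have "\<dots> = (\<integral>z. odds i True * ?R z \<partial>mL)"
    by (intro Bochner_Integration.integral_cong) (auto simp: indicator_def)
  also have "\<dots> = odds i True * U {z\<in>A. c i (fst (snd z))} \<psi>" by (simp add: U_def)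
  finally show ?thesis ..
qed

end


section \<open>A Bessel inequality\<close>

lemma box_bound_mono:
  fixes x s :: real
  assumes "\<bar>x\<bar> \<le> B * indicator {-L..L} s" "L \<le> L'"
  shows "\<bar>x\<bar> \<le> \<bar>B\<bar> * indicator {-L'..L'} s"
proof (cases "s \<in> {-L..L}")
  case True
  moreover from this have "s \<in> {-L'..L'}" using assms(2) by auto
  ultimately show ?thesis using assms(1) by simp
next
  case False
  then show ?thesis using assms(1) by simp
qed

context driven_coin_system
begin

lemma test_functionI:
  assumes "\<psi> \<in> borel_measurable borel" "\<And>s. \<bar>\<psi> s\<bar> \<le> B * indicator {-L..L} s"
  shows "test_function \<psi>"
  using assms unfolding test_function_def by blast

lemma test_function_shift:
  assumes "test_function \<psi>" shows "test_function (\<lambda>s. \<psi> (s + t))"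
proof -
  obtain B L where \<psi> [measurable]: "\<psi> \<in> borel_measurable borel" and le: "\<And>s. \<bar>\<psi> s\<bar> \<le> B * indicator {-L..L} s"
    using assms unfolding test_function_def by blast
  show ?thesis
  proof (rule test_functionI)
    fix s
    show "\<bar>\<psi> (s + t)\<bar> \<le> \<bar>B\<bar> * indicator {- (L + \<bar>t\<bar>)..L + \<bar>t\<bar>} s"
    proof (cases "s + t \<in> {-L..L}")
      case True
      then have "s \<in> {- (L + \<bar>t\<bar>)..L + \<bar>t\<bar>}" by auto
      then show ?thesis using le[of "s + t"] True by simp
    next
      case False
      then have "\<psi> (s + t) = 0" using le[of "s + t"] by simp
      then show ?thesis by simp
    qed
  qed measurable
qed measurable

lemma test_function_linear:
  assumes "test_function \<psi>" "test_function \<phi>" shows "test_function (\<lambda>s. x * \<psi> s + y * \<phi> s)"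
proof -
  obtain B L where \<psi> [measurable]: "\<psi> \<in> borel_measurable borel" and le: "\<And>s. \<bar>\<psi> s\<bar> \<le> B * indicator {-L..L} s"
    using assms(1) unfolding test_function_def by blast
  obtain B' L' where \<phi> [measurable]: "\<phi> \<in> borel_measurable borel" and le': "\<And>s. \<bar>\<phi> s\<bar> \<le> B' * indicator {-L'..L'} s"
    using assms(2) unfolding test_function_def by blast
  have *: "\<bar>f s\<bar> \<le> \<bar>b\<bar> * indicator {-max l l'..max l l'} s"
    if "\<And>s. \<bar>f s\<bar> \<le> b * indicator {-l..l} s" for f :: "real \<Rightarrow> real" and b l l' s
    by (rule box_bound_mono[OF that]) simp
  show ?thesis
  proof (rule test_functionI)
    fix s
    have "\<bar>x * \<psi> s + y * \<phi> s\<bar> \<le> \<bar>x\<bar> * \<bar>\<psi> s\<bar> + \<bar>y\<bar> * \<bar>\<phi> s\<bar>"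
      by (metis abs_mult abs_triangle_ineq)
    also have "\<dots> \<le> \<bar>x\<bar> * (\<bar>B\<bar> * indicator {-max L L'..max L L'} s) + \<bar>y\<bar> * (\<bar>B'\<bar> * indicator {-max L L'..max L L'} s)"
      using *[OF le, of s L'] *[OF le', of s L] by (intro add_mono mult_left_mono) (auto simp: max.commute)
    also have "\<dots> = (\<bar>x\<bar> * \<bar>B\<bar> + \<bar>y\<bar> * \<bar>B'\<bar>) * indicator {-max L L'..max L L'} s"
      by (simp add: algebra_simps)
    finally show "\<bar>x * \<psi> s + y * \<phi> s\<bar> \<le> (\<bar>x\<bar> * \<bar>B\<bar> + \<bar>y\<bar> * \<bar>B'\<bar>) * indicator {-max L L'..max L L'} s" .
  qed measurable
qed

lemma test_function_indicator: "test_function (indicator {a..<b})"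
  by (rule test_functionI[of _ 1 "\<bar>a\<bar> + \<bar>b\<bar>"]) (auto simp: indicator_def)

lemma U_linear:
  assumes "test_function \<psi>" "test_function \<phi>" "A \<in> sets m"
  shows "U A (\<lambda>s. x * \<psi> s + y * \<phi> s) = x * U A \<psi> + y * U A \<phi>"
proof -
  have "U A (\<lambda>s. x * \<psi> s + y * \<phi> s) =
    (\<integral>z. x * (indicator A z * \<psi> (snd (snd z))) + y * (indicator A z * \<phi> (snd (snd z))) \<partial>mL)"
    unfolding U_def by (intro Bochner_Integration.integral_cong) (auto simp: algebra_simps)
  also have "\<dots> = x * U A \<psi> + y * U A \<phi>"
    unfolding U_def using integrable_U[OF assms(1,3)] integrable_U[OF assms(2,3)] by simp
  finally show ?thesis .
qed

lemma coordinate_slice_sets: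
  assumes i: "i \<in> I" and A: "A \<in> sets m"
  shows "{z\<in>A. c i (fst (snd z))} \<in> sets m" "{z\<in>A. \<not> c i (fst (snd z))} \<in> sets m"
proof -
  note [measurable] = coordinate_measurable[OF i] A
  have "{z\<in>A. c i (fst (snd z))} = A \<inter> {z\<in>space m. c i (fst (snd z))}"
    "{z\<in>A. \<not> c i (fst (snd z))} = A \<inter> {z\<in>space m. \<not> c i (fst (snd z))}"
    using sets.sets_into_space[OF A] by auto
  then show "{z\<in>A. c i (fst (snd z))} \<in> sets m" "{z\<in>A. \<not> c i (fst (snd z))} \<in> sets m" by simp_all
qed

lemma U_split:
  assumes i: "i \<in> I" and A: "A \<in> sets m" and \<psi>: "test_function \<psi>"
  shows "U A \<psi> = U {z\<in>A. c i (fst (snd z))} \<psi> + U {z\<in>A. \<not> c i (fst (snd z))} \<psi>"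
proof -
  have "U A \<psi> = (\<integral>z. indicator {z\<in>A. c i (fst (snd z))} z * \<psi> (snd (snd z)) +
      indicator {z\<in>A. \<not> c i (fst (snd z))} z * \<psi> (snd (snd z)) \<partial>mL)"
    unfolding U_def by (intro Bochner_Integration.integral_cong) (auto simp: indicator_def)
  also have "\<dots> = U {z\<in>A. c i (fst (snd z))} \<psi> + U {z\<in>A. \<not> c i (fst (snd z))} \<psi>"
    unfolding U_def
    by (intro Bochner_Integration.integral_add integrable_U \<psi> coordinate_slice_sets[OF i A])
  finally show ?thesis .
qed

definition \<zeta> :: "'i \<Rightarrow> 'a \<Rightarrow> real" where
  "\<zeta> i x = (if c i x then 1 else 0) - pmf (q i) True"

lemma \<zeta>_measurable: "i \<in> I \<Longrightarrow> \<zeta> i \<in> borel_measurable M"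
  unfolding \<zeta>_def using coordinate_measurable[of i] by measurable

lemma abs_\<zeta>_le: "\<bar>\<zeta> i x\<bar> \<le> 1"
  using pmf_le_1[of "q i" True] by (auto simp: \<zeta>_def)

lemma integral_\<zeta>_\<zeta>:
  assumes i: "i \<in> I" and j: "j \<in> I" and L: "0 \<le> L"
  shows "(\<integral>z. \<zeta> i (fst (snd z)) * \<zeta> j (fst (snd z)) * indicator {-L..L} (snd (snd z)) \<partial>mL)
    = (if i = j then pmf (q i) True * (1 - pmf (q i) True) else 0) * (2 * L)"
proof -
  let ?C = "\<lambda>i. {x\<in>space M. c i x}" and ?k = "\<lambda>z. indicator {-L..L} (snd (snd z)) :: real"
  let ?p = "pmf (q i) True" and ?r = "pmf (q j) True"
  have C [measurable]: "?C i \<in> sets M" "?C j \<in> sets M"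
    using coordinate_sets[OF i, of True] coordinate_sets[OF j, of True] by simp_all
  have int: "integrable mL (\<lambda>z. indicator S (fst (snd z)) * ?k z)" if [measurable]: "S \<in> sets M" for S
  proof (rule Bochner_Integration.integrable_bound[OF integrable_box[of "-L" L]])
    show "(\<lambda>z. indicator S (fst (snd z)) * ?k z) \<in> borel_measurable mL" by measurable
  qed (auto simp: indicator_def)
  have pC: "prob (?C i) = ?p" "prob (?C j) = ?r"
    using prob_cylinder[of "{i}" "\<lambda>_. True"] prob_cylinder[of "{j}" "\<lambda>_. True"] i j by simp_all
  have pCC: "prob (?C i \<inter> ?C j) = (if i = j then ?p else ?p * ?r)"
  proof (cases "i = j")
    case False
    have "?C i \<inter> ?C j = {x\<in>space M. \<forall>l\<in>{i, j}. c l x = True}" by auto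
    then show ?thesis using prob_cylinder[of "{i, j}" "\<lambda>_. True"] i j False by simp
  qed (simp add: pC)
  have "(\<integral>z. \<zeta> i (fst (snd z)) * \<zeta> j (fst (snd z)) * ?k z \<partial>mL) =
    (\<integral>z. indicator (?C i \<inter> ?C j) (fst (snd z)) * ?k z - ?r * (indicator (?C i) (fst (snd z)) * ?k z)
      - ?p * (indicator (?C j) (fst (snd z)) * ?k z) + ?p * ?r * (indicator (space M) (fst (snd z)) * ?k z) \<partial>mL)"
    by (intro Bochner_Integration.integral_cong) (auto simp: \<zeta>_def indicator_def space_mL algebra_simps)
  also have "\<dots> = prob (?C i \<inter> ?C j) * (2 * L) - ?r * (prob (?C i) * (2 * L)) - ?p * (prob (?C j) * (2 * L)) + ?p * ?r * (2 * L)"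
    using L by (simp add: int integral_rectangle prob_space)
  also have "\<dots> = (if i = j then ?p * (1 - ?p) else 0) * (2 * L)"
    by (simp add: pC pCC algebra_simps)
  finally show ?thesis .
qed

definition coeff :: "('b \<times> 'a \<times> real) set \<Rightarrow> (real \<Rightarrow> real) \<Rightarrow> 'i \<Rightarrow> real" where
  "coeff A \<psi> i = (\<integral>z. \<zeta> i (fst (snd z)) * (indicator A z * \<psi> (snd (snd z))) \<partial>mL)"

text \<open>Centred coins are orthogonal. As the measure is infinite, they are cut off to an interval \<open>{-L..L}\<close> that contains
the support of \<open>\<psi>\<close>. The bound comes from expanding the square of the difference between \<open>A \<psi>\<close> and a linear combination \<open>a\<close>
of the cut off coins; the cut off coins have squared norm at most \<open>2 * L\<close>, hence the choice of \<open>a\<close>.\<close>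

lemma bessel:
  assumes A: "A \<in> sets m" and \<psi>: "test_function \<psi>"
  shows "\<exists>C. \<forall>J. finite J \<and> J \<subseteq> I \<longrightarrow> (\<Sum>i\<in>J. (coeff A \<psi> i)\<^sup>2) \<le> C"
proof -
  obtain B L0 where [measurable]: "\<psi> \<in> borel_measurable borel" and le0: "\<And>s. \<bar>\<psi> s\<bar> \<le> B * indicator {-L0..L0} s"
    using \<psi> unfolding test_function_def by blast
  define L where "L = \<bar>L0\<bar> + 1"
  have L: "0 < L" by (simp add: L_def)
  have le: "\<bar>\<psi> s\<bar> \<le> \<bar>B\<bar> * indicator {-L..L} s" for s
    by (rule box_bound_mono[OF le0]) (simp add: L_def)
  have [measurable]: "A \<in> sets mL" using A by (simp add: sets_mL_m)
  define f where "f z = indicator A z * \<psi> (snd (snd z))" for z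
  define k :: "'b \<times> 'a \<times> real \<Rightarrow> real" where "k z = indicator {-L..L} (snd (snd z))" for z
  have [measurable]: "f \<in> borel_measurable mL" "k \<in> borel_measurable mL"
    unfolding f_def k_def by measurable
  have f_le: "\<bar>f z\<bar> \<le> \<bar>B\<bar> * k z" for z
    using le[of "snd (snd z)"] by (auto simp: f_def k_def indicator_def split: if_splits)
  have k_int: "integrable mL k" unfolding k_def by (rule integrable_box)
  have bounded_int: "integrable mL g" if [measurable]: "g \<in> borel_measurable mL" and "\<And>z. \<bar>g z\<bar> \<le> K * k z" for g :: "_ \<Rightarrow> real" and K
  proof (rule Bochner_Integration.integrable_bound)
    show "integrable mL (\<lambda>z. K * k z)" using k_int by simp
    show "AE z in mL. norm (g z) \<le> norm (K * k z)"
      using that(2) by (intro AE_I2) (auto intro: order_trans[OF _ abs_ge_self])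
  qed measurable
  have f_int: "integrable mL f" by (rule bounded_int[OF _ f_le]) measurable
  have k2: "k z * k z = k z" "f z * k z = f z" for z
    using f_le[of z] by (cases "snd (snd z) \<in> {-L..L}"; simp add: k_def)+
  have k_val: "(\<integral>z. k z \<partial>mL) = 2 * L"
  proof -
    have "(\<integral>z. k z \<partial>mL) = (\<integral>z. indicator (space M) (fst (snd z)) * indicator {-L..L} (snd (snd z)) \<partial>mL)"
      unfolding k_def by (intro Bochner_Integration.integral_cong) (auto simp: space_mL)
    then show ?thesis using L by (simp add: integral_rectangle prob_space)
  qed
  have f2_le: "f z * f z \<le> \<bar>B\<bar> * \<bar>B\<bar> * k z" for z
  proof -
    have "f z * f z = \<bar>f z\<bar> * \<bar>f z\<bar>" by simp
    also have "\<dots> \<le> (\<bar>B\<bar> * k z) * (\<bar>B\<bar> * k z)" by (intro mult_mono f_le) (auto simp: k_def)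
    also have "\<dots> = \<bar>B\<bar> * \<bar>B\<bar> * (k z * k z)" by (simp add: ac_simps)
    finally show ?thesis by (simp add: k2)
  qed
  have f2_int: "integrable mL (\<lambda>z. f z * f z)"
    by (rule bounded_int[of _ "\<bar>B\<bar> * \<bar>B\<bar>"]) (use f2_le in \<open>auto simp: abs_mult\<close>)
  have f2_val: "(\<integral>z. f z * f z \<partial>mL) \<le> \<bar>B\<bar> * \<bar>B\<bar> * (2 * L)"
    unfolding k_val[symmetric] integral_mult_right_zero[symmetric]
    by (rule integral_mono[OF f2_int _ f2_le]) (simp add: k_int)
  have main: "(\<Sum>i\<in>J. (coeff A \<psi> i)\<^sup>2) \<le> \<bar>B\<bar> * \<bar>B\<bar> * (2 * L)\<^sup>2" if J: "finite J" "J \<subseteq> I" for J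
  proof -
    define Z where "Z i z = \<zeta> i (fst (snd z))" for i and z :: "'b \<times> 'a \<times> real"
    have Zm: "Z i \<in> borel_measurable mL" if "i \<in> J" for i
    proof -
      have [measurable]: "\<zeta> i \<in> borel_measurable M" using that J by (intro \<zeta>_measurable) auto
      show ?thesis unfolding Z_def by measurable
    qed
    have Z1: "\<bar>Z i z\<bar> \<le> 1" for i z unfolding Z_def by (rule abs_\<zeta>_le)
    \<comment> \<open>The coefficients of the orthogonal projection, with \<open>2 * L\<close> in place of the squared norms.\<close>
    define a where "a i = coeff A \<psi> i / (2 * L)" for i
    have e: "coeff A \<psi> i = (\<integral>z. Z i z * f z \<partial>mL)" for i
      by (simp add: coeff_def Z_def f_def)
    have int1: "integrable mL (\<lambda>z. Z i z * f z)" if i: "i \<in> J" for i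
    proof (rule bounded_int[of _ "\<bar>B\<bar>"])
      show "(\<lambda>z. Z i z * f z) \<in> borel_measurable mL" using Zm[OF i] by measurable
      show "\<bar>Z i z * f z\<bar> \<le> \<bar>B\<bar> * k z" for z
        using mult_mono[OF Z1[of i z] f_le[of z]] by (simp add: abs_mult)
    qed
    have int2: "integrable mL (\<lambda>z. Z i z * Z j z * k z)" if i: "i \<in> J" "j \<in> J" for i j
    proof (rule bounded_int[of _ 1])
      show "(\<lambda>z. Z i z * Z j z * k z) \<in> borel_measurable mL" using Zm[OF i(1)] Zm[OF i(2)] by measurable
      show "\<bar>Z i z * Z j z * k z\<bar> \<le> 1 * k z" for z
        using mult_mono[OF Z1[of i z] Z1[of j z]] unfolding abs_mult
        by (intro mult_mono) (auto simp: k_def)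
    qed
    have val2: "(\<integral>z. Z i z * Z j z * k z \<partial>mL) \<le> (if i = j then 2 * L else 0)"
      and val2': "i \<noteq> j \<Longrightarrow> (\<integral>z. Z i z * Z j z * k z \<partial>mL) = 0" if i: "i \<in> J" "j \<in> J" for i j
    proof -
      have *: "(\<integral>z. Z i z * Z j z * k z \<partial>mL) = (if i = j then pmf (q i) True * (1 - pmf (q i) True) else 0) * (2 * L)"
        unfolding Z_def k_def using i J L by (intro integral_\<zeta>_\<zeta>) auto
      have "pmf (q i) True * (1 - pmf (q i) True) \<le> 1"
        by (intro mult_le_one) (auto simp: pmf_le_1)
      then show "(\<integral>z. Z i z * Z j z * k z \<partial>mL) \<le> (if i = j then 2 * L else 0)"
        using * L by (auto simp: mult_le_cancel_right1)
      show "i \<noteq> j \<Longrightarrow> (\<integral>z. Z i z * Z j z * k z \<partial>mL) = 0" using * by simp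
    qed
    have expand: "(f z - (\<Sum>i\<in>J. a i * Z i z) * k z)\<^sup>2 =
        f z * f z - 2 * (\<Sum>i\<in>J. a i * (Z i z * f z)) + (\<Sum>i\<in>J. \<Sum>j\<in>J. a i * a j * (Z i z * Z j z * k z))" for z
    proof -
      have "(f z - (\<Sum>i\<in>J. a i * Z i z) * k z)\<^sup>2 = f z * f z - 2 * (\<Sum>i\<in>J. a i * Z i z) * (f z * k z)
          + (\<Sum>i\<in>J. a i * Z i z) * (\<Sum>j\<in>J. a j * Z j z) * (k z * k z)"
        by (simp add: power2_eq_square algebra_simps)
      also have "\<dots> = f z * f z - 2 * ((\<Sum>i\<in>J. a i * Z i z) * f z) + (\<Sum>i\<in>J. a i * Z i z) * (\<Sum>j\<in>J. a j * Z j z) * k z"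
        by (simp add: k2)
      also have "(\<Sum>i\<in>J. a i * Z i z) * f z = (\<Sum>i\<in>J. a i * (Z i z * f z))"
        by (simp add: sum_distrib_right mult.assoc)
      also have "(\<Sum>i\<in>J. a i * Z i z) * (\<Sum>j\<in>J. a j * Z j z) * k z = (\<Sum>i\<in>J. \<Sum>j\<in>J. a i * a j * (Z i z * Z j z * k z))"
        unfolding sum_product unfolding sum_distrib_right by (intro sum.cong refl) (simp add: ac_simps)
      finally show ?thesis .
    qed
    have "0 \<le> (\<integral>z. (f z - (\<Sum>i\<in>J. a i * Z i z) * k z)\<^sup>2 \<partial>mL)" by (rule Bochner_Integration.integral_nonneg) simp
    also have "\<dots> = (\<integral>z. f z * f z \<partial>mL) - 2 * (\<Sum>i\<in>J. a i * coeff A \<psi> i)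
        + (\<Sum>i\<in>J. \<Sum>j\<in>J. a i * a j * (\<integral>z. Z i z * Z j z * k z \<partial>mL))"
      unfolding expand e using f2_int int1 int2 by simp
    also have "(\<Sum>i\<in>J. \<Sum>j\<in>J. a i * a j * (\<integral>z. Z i z * Z j z * k z \<partial>mL)) \<le> (\<Sum>i\<in>J. a i * a i * (2 * L))"
    proof (rule sum_mono)
      fix i assume i: "i \<in> J"
      have "(\<Sum>j\<in>J. a i * a j * (\<integral>z. Z i z * Z j z * k z \<partial>mL)) = (\<Sum>j\<in>{i}. a i * a j * (\<integral>z. Z i z * Z j z * k z \<partial>mL))"
        using J i val2'[OF i] by (intro sum.mono_neutral_right) auto
      also have "\<dots> \<le> a i * a i * (2 * L)"
        using val2[OF i i] by (simp add: mult_left_mono)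
      finally show "(\<Sum>j\<in>J. a i * a j * (\<integral>z. Z i z * Z j z * k z \<partial>mL)) \<le> a i * a i * (2 * L)" .
    qed
    also have "(\<Sum>i\<in>J. a i * a i * (2 * L)) = (\<Sum>i\<in>J. (coeff A \<psi> i)\<^sup>2) / (2 * L)"
      using L unfolding a_def sum_divide_distrib by (intro sum.cong) (auto simp: power2_eq_square)
    also have "(\<Sum>i\<in>J. a i * coeff A \<psi> i) = (\<Sum>i\<in>J. (coeff A \<psi> i)\<^sup>2) / (2 * L)"
      unfolding a_def sum_divide_distrib by (intro sum.cong) (auto simp: power2_eq_square)
    finally have "(\<Sum>i\<in>J. (coeff A \<psi> i)\<^sup>2) / (2 * L) \<le> \<bar>B\<bar> * \<bar>B\<bar> * (2 * L)" using f2_val by simp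
    then show ?thesis using L by (simp add: divide_le_eq power2_eq_square mult.assoc)
  qed
  then show ?thesis by blast
qed

end


section \<open>Translation invariance in the real coordinate\<close>

context driven_coin_system
begin

definition drift :: "nat \<Rightarrow> real" where
  "drift n = ln (pmf base True / pmf base False) - ln (pmf (q (idx n)) True / pmf (q (idx n)) False)"

lemma drift_shift: "shift (idx n) False = - drift n"
  by (simp add: drift_def shift_def odds_def)

lemma U_slice_sum:
  assumes i: "i \<in> I" and A: "A \<in> sets m" and inv: "AE z in m. \<theta> i z \<in> A \<longleftrightarrow> z \<in> A"
    and \<psi>: "test_function \<psi>"
  shows "pmf (q i) False * U {z\<in>A. c i (fst (snd z))} \<psi> =
    pmf (q i) True * U {z\<in>A. \<not> c i (fst (snd z))} (\<lambda>s. \<psi> (s + shift i False))"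
  using U_flip[OF i A inv \<psi>] pmf_pos[OF i, of True] by (simp add: odds_def field_simps)

lemma coeff_eq:
  assumes i: "i \<in> I" and A: "A \<in> sets m" and \<psi>: "test_function \<psi>"
  shows "coeff A \<psi> i = pmf (q i) False * U {z\<in>A. c i (fst (snd z))} \<psi> - pmf (q i) True * U {z\<in>A. \<not> c i (fst (snd z))} \<psi>"
proof -
  have "coeff A \<psi> i = (\<integral>z. pmf (q i) False * (indicator {z\<in>A. c i (fst (snd z))} z * \<psi> (snd (snd z))) -
      pmf (q i) True * (indicator {z\<in>A. \<not> c i (fst (snd z))} z * \<psi> (snd (snd z))) \<partial>mL)"
    unfolding coeff_def
    by (intro Bochner_Integration.integral_cong) (auto simp: \<zeta>_def indicator_def pmf_False_conv_True algebra_simps)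
  also have "\<dots> = pmf (q i) False * U {z\<in>A. c i (fst (snd z))} \<psi> - pmf (q i) True * U {z\<in>A. \<not> c i (fst (snd z))} \<psi>"
    unfolding U_def
    using integrable_U[OF \<psi> coordinate_slice_sets(1)[OF i A]] integrable_U[OF \<psi> coordinate_slice_sets(2)[OF i A]]
    by simp
  finally show ?thesis .
qed

text \<open>The function \<open>\<psi>\<close> is a primitive of \<open>\<eta>\<close>. By \<open>U_flip\<close> the correlation of \<open>A\<close> with the centred coin is a difference
quotient: it compares \<open>\<psi>\<close> with its translate by the drift on the half \<open>F\<close> of \<open>A\<close> where the coin shows \<open>False\<close>.
To first order it is therefore the drift times the value at the derivative \<open>\<eta>\<close>. The weight of \<open>F\<close> in \<open>A\<close> is that of the coin
up to another error of first order, which the factor in front makes second order.\<close>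

lemma coeff_drift:
  assumes A: "A \<in> sets m" and inv: "AE z in m. \<theta> (idx n) z \<in> A \<longleftrightarrow> z \<in> A" and ab: "a \<le> b"
  defines "\<psi> \<equiv> \<lambda>s. clamp (b - a) (s - a) - (b - a) * clamp 1 s"
    and "\<eta> \<equiv> \<lambda>s. indicator {a..<b} s - (b - a) * indicator {0..<1} s"
  shows "\<delta>\<^sup>2 * drift n * \<bar>U A \<eta>\<bar> \<le> \<bar>coeff A \<psi> (idx n)\<bar> + 4 * (1 + (b - a)) * (drift n)\<^sup>2"
    and "test_function \<psi>" and "test_function \<eta>"
proof -
  define i where "i = idx n"
  define \<sigma> where "\<sigma> = drift n"
  define d where "d = b - a"
  define p where "p = pmf (q i) True"
  define F where "F = {z\<in>A. \<not> c i (fst (snd z))}"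
  define T where "T = {z\<in>A. c i (fst (snd z))}"
  have i: "i \<in> I" by (simp add: i_def idx_I)
  have F: "F \<in> sets m" and T: "T \<in> sets m" using coordinate_slice_sets[OF i A] by (simp_all add: F_def T_def)
  have \<sigma>: "0 \<le> \<sigma>" using drift_nonneg[of n] by (simp add: \<sigma>_def drift_def)
  have d: "0 \<le> d" using ab by (simp add: d_def)
  have p: "\<delta> \<le> p" "\<delta> \<le> 1 - p" "0 < p" "0 < 1 - p" "p \<le> 1"
    using \<delta>_le[OF i, of True] \<delta>_le[OF i, of False] \<delta>_pos pmf_le_1[of "q i" True]
    by (auto simp: p_def pmf_False_conv_True)
  have p0: "pmf (q i) False = 1 - p" by (simp add: p_def pmf_False_conv_True)
  show t\<psi>: "test_function \<psi>"
  proof (rule test_functionI)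
    show "\<psi> \<in> borel_measurable borel" unfolding \<psi>_def clamp_def by measurable
    fix s
    show "\<bar>\<psi> s\<bar> \<le> (2 * d) * indicator {- (\<bar>a\<bar> + \<bar>b\<bar> + 1)..\<bar>a\<bar> + \<bar>b\<bar> + 1} s"
    proof (cases "s \<in> {- (\<bar>a\<bar> + \<bar>b\<bar> + 1)..\<bar>a\<bar> + \<bar>b\<bar> + 1}")
      case True
      have "\<bar>clamp (b - a) (s - a)\<bar> \<le> d" "\<bar>clamp 1 s\<bar> \<le> 1" using ab by (auto simp: clamp_def d_def)
      moreover from this(2) have "\<bar>(b - a) * clamp 1 s\<bar> \<le> d"
        using d by (simp add: abs_mult d_def mult_left_le)
      ultimately show ?thesis using True by (simp add: \<psi>_def)
    next
      case False
      then have "s < a \<and> s < 0 \<or> b < s \<and> 1 < s" by auto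
      then have "\<psi> s = 0" using ab by (auto simp: \<psi>_def clamp_def)
      then show ?thesis using False by simp
    qed
  qed
  have t\<eta>': "test_function (\<lambda>s. 1 * indicator {a..<b} s + (- d) * indicator {0..<1} s)"
    by (intro test_function_linear test_function_indicator)
  moreover have "\<eta> = (\<lambda>s. 1 * indicator {a..<b} s + (- d) * indicator {0..<1} s)"
    by (simp add: \<eta>_def d_def fun_eq_iff algebra_simps)
  ultimately show t\<eta>: "test_function \<eta>" by (simp only:)
  have sh: "shift i False = - \<sigma>" by (simp add: i_def \<sigma>_def drift_shift)
  have flip: "(1 - p) * U T \<phi> = p * U F (\<lambda>s. \<phi> (s - \<sigma>))" if "test_function \<phi>" for \<phi>
    using U_slice_sum[OF i A _ that] inv by (simp add: i_def[symmetric] F_def T_def sh p0 p_def[symmetric])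
  define D where "D s = indicator {a..a+\<sigma>} s + indicator {b..b+\<sigma>} s + d * (indicator {0..0+\<sigma>} s + indicator {1..1+\<sigma>} s)" for s :: real
  have sub: "indicator {0..<b - a} (s - a) = (indicator {a..<b} s :: real)"
    "indicator {0..<b - a} (s - a - \<sigma>) = (indicator {a..<b} (s - \<sigma>) :: real)"
    "indicator {0..\<sigma>} (s - a) = (indicator {a..a+\<sigma>} s :: real)"
    "indicator {b-a..b-a+\<sigma>} (s - a) = (indicator {b..b+\<sigma>} s :: real)" for s
    by (auto simp: indicator_def)
  have e1: "\<bar>1 * \<psi> (s - \<sigma>) + (-1) * (1 * \<psi> s + (- \<sigma>) * \<eta> s)\<bar> \<le> \<sigma> * D s" for s
  proof -
    have "\<bar>clamp (b - a) (s - a - \<sigma>) - clamp (b - a) (s - a) + \<sigma> * indicator {a..<b} s\<bar>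
        \<le> \<sigma> * (indicator {a..a+\<sigma>} s + indicator {b..b+\<sigma>} s)"
      using clamp_difference[OF \<sigma>, of "b - a" "s - a"] ab by (simp add: sub)
    moreover have "\<bar>d * (clamp 1 (s - \<sigma>) - clamp 1 s + \<sigma> * indicator {0..<1} s)\<bar>
        \<le> d * (\<sigma> * (indicator {0..\<sigma>} s + indicator {1..1+\<sigma>} s))"
      unfolding abs_mult using clamp_difference[OF \<sigma>, of 1 s] d by (simp add: mult_left_mono)
    ultimately have "\<bar>(clamp (b - a) (s - a - \<sigma>) - clamp (b - a) (s - a) + \<sigma> * indicator {a..<b} s) -
        d * (clamp 1 (s - \<sigma>) - clamp 1 s + \<sigma> * indicator {0..<1} s)\<bar> \<le>
        \<sigma> * (indicator {a..a+\<sigma>} s + indicator {b..b+\<sigma>} s) + d * (\<sigma> * (indicator {0..\<sigma>} s + indicator {1..1+\<sigma>} s))"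
      by linarith
    also have "\<dots> = \<sigma> * D s" by (simp add: D_def algebra_simps)
    finally show ?thesis by (simp add: \<psi>_def \<eta>_def d_def algebra_simps)
  qed
  have e2: "\<bar>1 * \<eta> (s - \<sigma>) + (-1) * \<eta> s\<bar> \<le> 1 * D s" for s
  proof -
    have "\<bar>indicator {a..<b} (s - \<sigma>) - indicator {a..<b} s\<bar> \<le> (indicator {a..a+\<sigma>} s + indicator {b..b+\<sigma>} s :: real)"
      using indicator_difference[OF \<sigma>, of "b - a" "s - a"] ab by (simp add: sub)
    moreover have "\<bar>d * (indicator {0..<1} (s - \<sigma>) - indicator {0..<1} s)\<bar>
        \<le> d * (indicator {0..\<sigma>} s + indicator {1..1+\<sigma>} s)"
      unfolding abs_mult using indicator_difference[OF \<sigma>, of 1 s] d by (simp add: mult_left_mono)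
    ultimately have "\<bar>(indicator {a..<b} (s - \<sigma>) - indicator {a..<b} s) - d * (indicator {0..<1} (s - \<sigma>) - indicator {0..<1} s)\<bar>
        \<le> indicator {a..a+\<sigma>} s + indicator {b..b+\<sigma>} s + d * (indicator {0..\<sigma>} s + indicator {1..1+\<sigma>} s)"
      by linarith
    then show ?thesis by (simp add: D_def \<eta>_def d_def algebra_simps)
  qed
  have t\<psi>\<sigma>: "test_function (\<lambda>s. \<psi> (s - \<sigma>))" and t\<eta>\<sigma>: "test_function (\<lambda>s. \<eta> (s - \<sigma>))"
    using test_function_shift[OF t\<psi>, of "- \<sigma>"] test_function_shift[OF t\<eta>, of "- \<sigma>"] by simp_all
  have t1: "test_function (\<lambda>s. 1 * \<psi> s + (- \<sigma>) * \<eta> s)" by (intro test_function_linear t\<psi> t\<eta>)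
  define r1 where "r1 = U F (\<lambda>s. \<psi> (s - \<sigma>)) - (U F \<psi> - \<sigma> * U F \<eta>)"
  define r2 where "r2 = U F (\<lambda>s. \<eta> (s - \<sigma>)) - U F \<eta>"
  have r1: "\<bar>r1\<bar> \<le> \<sigma> * (2 * \<sigma> * (1 + d))"
  proof -
    have "r1 = U F (\<lambda>s. 1 * \<psi> (s - \<sigma>) + (-1) * (1 * \<psi> s + (- \<sigma>) * \<eta> s))"
      by (simp only: U_linear[OF t\<psi>\<sigma> t1 F] U_linear[OF t\<psi> t\<eta> F] r1_def) simp
    also have "\<bar>\<dots>\<bar> \<le> \<sigma> * (2 * \<sigma> * (1 + d))"
      by (rule U_le_boxes[OF test_function_linear[OF t\<psi>\<sigma> t1] F e1[unfolded D_def] \<sigma> \<sigma> d])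
    finally show ?thesis .
  qed
  have r2: "\<bar>r2\<bar> \<le> 2 * \<sigma> * (1 + d)"
  proof -
    have "r2 = U F (\<lambda>s. 1 * \<eta> (s - \<sigma>) + (-1) * \<eta> s)"
      by (simp add: U_linear[OF t\<eta>\<sigma> t\<eta> F, of 1 "-1", simplified] r2_def)
    also have "\<bar>\<dots>\<bar> \<le> 1 * (2 * \<sigma> * (1 + d))"
      by (rule U_le_boxes[OF test_function_linear[OF t\<eta>\<sigma> t\<eta>] F e2[unfolded D_def] _ \<sigma> d]) simp
    finally show ?thesis by simp
  qed
  have split: "U A \<eta> = U T \<eta> + U F \<eta>" unfolding T_def F_def by (rule U_split[OF i A t\<eta>])
  have UF: "U F \<eta> = (1 - p) * U A \<eta> - p * r2"
  proof -
    have "(1 - p) * U A \<eta> = (1 - p) * U T \<eta> + (1 - p) * U F \<eta>" by (simp add: split algebra_simps)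
    also have "(1 - p) * U T \<eta> = p * U F (\<lambda>s. \<eta> (s - \<sigma>))" by (rule flip[OF t\<eta>])
    also have "p * U F (\<lambda>s. \<eta> (s - \<sigma>)) + (1 - p) * U F \<eta> = U F \<eta> + p * r2"
      by (simp add: r2_def algebra_simps)
    finally show ?thesis by simp
  qed
  have "coeff A \<psi> i = p * U F (\<lambda>s. \<psi> (s - \<sigma>)) - p * U F \<psi>"
    unfolding coeff_eq[OF i A t\<psi>] F_def[symmetric] T_def[symmetric] p0 p_def[symmetric] by (simp add: flip[OF t\<psi>])
  also have "\<dots> = p * (r1 - \<sigma> * U F \<eta>)" by (simp add: r1_def algebra_simps)
  also have "\<dots> = p * (r1 + \<sigma> * p * r2) - p * (1 - p) * \<sigma> * U A \<eta>" by (simp add: UF algebra_simps)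
  finally have "p * (1 - p) * \<sigma> * U A \<eta> = p * (r1 + \<sigma> * p * r2) - coeff A \<psi> i" by simp
  then have "\<bar>p * (1 - p) * \<sigma> * U A \<eta>\<bar> \<le> \<bar>p * (r1 + \<sigma> * p * r2)\<bar> + \<bar>coeff A \<psi> i\<bar>" by simp
  also have "\<bar>p * (r1 + \<sigma> * p * r2)\<bar> \<le> 4 * (1 + d) * \<sigma>\<^sup>2"
  proof -
    have "\<bar>\<sigma> * p * r2\<bar> \<le> \<sigma> * 1 * (2 * \<sigma> * (1 + d))"
      unfolding abs_mult using \<sigma> p r2 d by (intro mult_mono) auto
    then have *: "\<bar>r1 + \<sigma> * p * r2\<bar> \<le> 4 * (1 + d) * \<sigma>\<^sup>2"
      using r1 by (simp add: power2_eq_square algebra_simps)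
    have "\<bar>p * (r1 + \<sigma> * p * r2)\<bar> \<le> 1 * \<bar>r1 + \<sigma> * p * r2\<bar>"
      unfolding abs_mult using p by (intro mult_right_mono) auto
    with * show ?thesis by simp
  qed
  finally have main: "\<bar>p * (1 - p) * \<sigma> * U A \<eta>\<bar> \<le> \<bar>coeff A \<psi> i\<bar> + 4 * (1 + d) * \<sigma>\<^sup>2" by simp
  have "\<delta>\<^sup>2 \<le> p * (1 - p)" using p \<delta>_pos by (simp add: power2_eq_square mult_mono)
  then have "\<delta>\<^sup>2 * (\<sigma> * \<bar>U A \<eta>\<bar>) \<le> p * (1 - p) * (\<sigma> * \<bar>U A \<eta>\<bar>)" using \<sigma> by (intro mult_right_mono) auto
  also have "\<dots> = \<bar>p * (1 - p) * \<sigma> * U A \<eta>\<bar>" using p \<sigma> by (simp add: abs_mult)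
  finally show "\<delta>\<^sup>2 * drift n * \<bar>U A \<eta>\<bar> \<le> \<bar>coeff A \<psi> (idx n)\<bar> + 4 * (1 + (b - a)) * (drift n)\<^sup>2"
    using main by (simp add: i_def \<sigma>_def d_def mult.assoc)
qed

text \<open>If the value at \<open>\<eta>\<close> were not 0, then \<open>coeff_drift\<close> would bound the drift by a multiple of the correlation,
eventually. The squares of the correlations are summable by \<open>bessel\<close>, those of the drift are not. The function
\<open>\<eta>\<close> has integral 0, so that its primitive has bounded support.\<close>

lemma U_interval:
  assumes A: "A \<in> sets m" and inv: "\<forall>\<^sub>F n in sequentially. AE z in m. \<theta> (idx n) z \<in> A \<longleftrightarrow> z \<in> A" and ab: "a \<le> b"
  shows "U A (indicator {a..<b}) = (b - a) * U A (indicator {0..<1})"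
proof -
  define \<psi> where "\<psi> s = clamp (b - a) (s - a) - (b - a) * clamp 1 s" for s
  define \<eta> where "\<eta> s = indicator {a..<b} s - (b - a) * indicator {0..<1} s" for s :: real
  obtain n0 where n0: "\<And>n. n0 \<le> n \<Longrightarrow> AE z in m. \<theta> (idx n) z \<in> A \<longleftrightarrow> z \<in> A"
    using inv by (auto simp: eventually_sequentially)
  have bound: "\<delta>\<^sup>2 * drift n * \<bar>U A \<eta>\<bar> \<le> \<bar>coeff A \<psi> (idx n)\<bar> + 4 * (1 + (b - a)) * (drift n)\<^sup>2" if "n0 \<le> n" for n
    using coeff_drift(1)[OF A n0[OF that] ab] unfolding \<psi>_def \<eta>_def .
  have \<psi>: "test_function \<psi>"
    using coeff_drift(2)[OF A n0[OF order_refl] ab] unfolding \<psi>_def .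
  have "U A \<eta> = 0"
  proof (rule ccontr)
    assume u0: "U A \<eta> \<noteq> 0"
    define u where "u = \<delta>\<^sup>2 * \<bar>U A \<eta>\<bar>"
    have u: "0 < u" using u0 \<delta>_pos by (simp add: u_def)
    obtain C where C: "\<And>J. finite J \<Longrightarrow> J \<subseteq> I \<Longrightarrow> (\<Sum>i\<in>J. (coeff A \<psi> i)\<^sup>2) \<le> C"
      using bessel[OF A \<psi>] by blast
    have "summable (\<lambda>n. (coeff A \<psi> (idx n))\<^sup>2)"
    proof (rule summableI_nonneg_bounded)
      fix n
      have "(\<Sum>k<n. (coeff A \<psi> (idx k))\<^sup>2) = (\<Sum>i\<in>idx ` {..<n}. (coeff A \<psi> i)\<^sup>2)"
        using inj_idx by (subst sum.reindex) (auto intro: inj_on_subset)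
      also have "\<dots> \<le> C" by (rule C) (auto simp: idx_I)
      finally show "(\<Sum>k<n. (coeff A \<psi> (idx k))\<^sup>2) \<le> C" .
    qed simp
    then have "summable (\<lambda>n. 4 / u\<^sup>2 * (coeff A \<psi> (idx n))\<^sup>2)" by (rule summable_mult)
    moreover have "\<forall>\<^sub>F n in sequentially. norm ((drift n)\<^sup>2) \<le> 4 / u\<^sup>2 * (coeff A \<psi> (idx n))\<^sup>2"
    proof -
      have "(\<lambda>n. 4 * (1 + (b - a)) * drift n) \<longlonglongrightarrow> 4 * (1 + (b - a)) * 0"
        unfolding drift_def by (intro tendsto_intros drift_tendsto)
      then have "\<forall>\<^sub>F n in sequentially. 4 * (1 + (b - a)) * drift n < u / 2"
        by (rule order_tendstoD(2)) (use u in simp)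
      then show ?thesis using eventually_ge_at_top[of n0]
      proof eventually_elim
        case (elim n)
        have dr: "0 \<le> drift n" using drift_nonneg by (simp add: drift_def)
        have "4 * (1 + (b - a)) * drift n * drift n \<le> u / 2 * drift n"
          using elim(1) dr by (intro mult_right_mono) auto
        moreover have "u * drift n \<le> \<bar>coeff A \<psi> (idx n)\<bar> + 4 * (1 + (b - a)) * drift n * drift n"
          using bound[OF elim(2)] by (simp add: u_def power2_eq_square ac_simps)
        ultimately have "u / 2 * drift n \<le> \<bar>coeff A \<psi> (idx n)\<bar>" by simp
        then have "(u / 2 * drift n)\<^sup>2 \<le> \<bar>coeff A \<psi> (idx n)\<bar>\<^sup>2"
          using u dr by (intro power_mono) auto
        then have "u\<^sup>2 / 4 * (drift n)\<^sup>2 \<le> (coeff A \<psi> (idx n))\<^sup>2" by (simp add: power_mult_distrib power_divide)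
        then show ?case using u by (simp add: field_simps)
      qed
    qed
    ultimately have "summable (\<lambda>n. (drift n)\<^sup>2)"
      by (rule summable_comparison_test_ev[rotated])
    with drift_square_divergent show False by (simp add: drift_def)
  qed
  moreover have "U A \<eta> = U A (\<lambda>s. 1 * indicator {a..<b} s + (- (b - a)) * indicator {0..<1} s)"
    by (rule arg_cong[where f = "U A"]) (simp add: \<eta>_def fun_eq_iff algebra_simps)
  moreover have "\<dots> = 1 * U A (indicator {a..<b}) + (- (b - a)) * U A (indicator {0..<1})"
    by (rule U_linear[OF test_function_indicator test_function_indicator A])
  ultimately show ?thesis by (simp add: algebra_simps)
qed

text \<open>Translations no longer matter, so the flip of \<open>i\<close> compares the two halves of \<open>A\<close> directly: they have the weights
of the two sides of the coin. The set \<open>J\<close> collects coins that have already been split off and whose flips no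
longer leave \<open>A\<close> invariant.\<close>

lemma U_coordinate:
  assumes A: "A \<in> sets m" and J: "finite J" and inv: "\<And>j. j \<in> I - J \<Longrightarrow> AE z in m. \<theta> j z \<in> A \<longleftrightarrow> z \<in> A"
    and i: "i \<in> I - J"
  shows "U {z\<in>A. c i (fst (snd z))} (indicator {0..<1}) = pmf (q i) True * U A (indicator {0..<1})"
proof -
  let ?T = "{z\<in>A. c i (fst (snd z))}" and ?F = "{z\<in>A. \<not> c i (fst (snd z))}"
  let ?s = "shift i False"
  have iI: "i \<in> I" using i by simp
  have F: "?F \<in> sets m" by (rule coordinate_slice_sets[OF iI A])
  have "\<forall>\<^sub>F n in sequentially. AE z in m. \<theta> (idx n) z \<in> ?F \<longleftrightarrow> z \<in> ?F"
  proof -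
    have "finite {n. idx n \<in> insert i J}"
      using finite_vimageI[OF _ inj_idx, of "insert i J"] J by (simp add: vimage_def)
    then have "\<forall>\<^sub>F n in sequentially. n \<notin> {n. idx n \<in> insert i J}"
      using eventually_cofinite[of "\<lambda>n. n \<notin> {n. idx n \<in> insert i J}"] by (simp add: cofinite_eq_sequentially)
    then show ?thesis
    proof eventually_elim
      case (elim n)
      then have n: "idx n \<in> I - J" "idx n \<noteq> i" using idx_I by auto
      show ?case using inv[OF n(1)] AE_space
      proof eventually_elim
        case (elim z)
        obtain y x s where z: "z = (y, x, s)" by (cases z) auto
        have "c i (flip (idx n) x) = c i x" using elim(2) n iI by (simp add: z space_m coord_flip idx_I)
        then show ?case using elim(1) by (simp add: z \<theta>_def)
      qed
    qed
  qed
  then have "U ?F (indicator {- ?s..<1 - ?s}) = (1 - ?s - - ?s) * U ?F (indicator {0..<1})"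
    by (rule U_interval[OF F]) simp
  moreover have "indicator {- ?s..<1 - ?s} = (\<lambda>s. indicator {0..<1} (s + ?s) :: real)"
    by (rule ext) (auto simp: indicator_def)
  ultimately have "pmf (q i) False * U ?T (indicator {0..<1}) = pmf (q i) True * U ?F (indicator {0..<1})"
    using U_slice_sum[OF iI A inv[OF i] test_function_indicator[of 0 1]] by simp
  moreover have "U A (indicator {0..<1}) = U ?T (indicator {0..<1}) + U ?F (indicator {0..<1})"
    by (rule U_split[OF iI A test_function_indicator])
  ultimately show ?thesis by (simp add: pmf_False_conv_True algebra_simps)
qed

lemma finite_cylinder_slice_sets:
  assumes A: "A \<in> sets m" and J: "finite J" "J \<subseteq> I"
  shows "{z\<in>A. \<forall>j\<in>J. c j (fst (snd z))} \<in> sets m"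
  using J
proof (induction J rule: finite_induct)
  case empty
  then show ?case using A by simp
next
  case (insert j J)
  have "{z\<in>A. \<forall>j\<in>insert j J. c j (fst (snd z))} = {z\<in>{z\<in>A. \<forall>j\<in>J. c j (fst (snd z))}. c j (fst (snd z))}" by auto
  then show ?case using insert coordinate_slice_sets(1)[of j "{z\<in>A. \<forall>j\<in>J. c j (fst (snd z))}"] by simp
qed

lemma AE_cylinder_invariant:
  assumes inv: "AE z in m. \<theta> i z \<in> A \<longleftrightarrow> z \<in> A" and J: "J \<subseteq> I" and i: "i \<in> I - J"
  shows "AE z in m. \<theta> i z \<in> {z\<in>A. \<forall>j\<in>J. c j (fst (snd z))} \<longleftrightarrow> z \<in> {z\<in>A. \<forall>j\<in>J. c j (fst (snd z))}"
  using inv AE_space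
proof eventually_elim
  case (elim z)
  obtain y x s where z: "z = (y, x, s)" by (cases z) auto
  have "c j (flip i x) = c j x" if "j \<in> J" for j
    using elim(2) i J that by (auto simp: z space_m coord_flip)
  then show ?case using elim(1) by (simp add: z \<theta>_def)
qed

lemma U_cylinder:
  assumes A: "A \<in> sets m" and inv: "\<And>i. i \<in> I \<Longrightarrow> AE z in m. \<theta> i z \<in> A \<longleftrightarrow> z \<in> A" and J: "finite J" "J \<subseteq> I"
  shows "U {z\<in>A. \<forall>j\<in>J. c j (fst (snd z))} (indicator {0..<1}) = (\<Prod>j\<in>J. pmf (q j) True) * U A (indicator {0..<1})"
  using J
proof (induction J rule: finite_induct)
  case (insert i J)
  have "{z\<in>A. \<forall>j\<in>insert i J. c j (fst (snd z))} = {z\<in>{z\<in>A. \<forall>j\<in>J. c j (fst (snd z))}. c i (fst (snd z))}" by auto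
  also have "U \<dots> (indicator {0..<1}) = pmf (q i) True * U {z\<in>A. \<forall>j\<in>J. c j (fst (snd z))} (indicator {0..<1})"
    using insert A
    by (intro U_coordinate[of _ J] finite_cylinder_slice_sets AE_cylinder_invariant inv) auto
  finally show ?case using insert by simp
qed simp

lemma U_cylinder_interval:
  assumes A: "A \<in> sets m" and inv: "\<And>i. i \<in> I \<Longrightarrow> AE z in m. \<theta> i z \<in> A \<longleftrightarrow> z \<in> A" and J: "finite J" "J \<subseteq> I"
    and ab: "a \<le> b"
  shows "U {z\<in>A. \<forall>j\<in>J. c j (fst (snd z))} (indicator {a..<b}) =
    (b - a) * ((\<Prod>j\<in>J. pmf (q j) True) * U A (indicator {0..<1}))"
proof -
  have "finite {n. idx n \<in> J}"
    using finite_vimageI[OF J(1) inj_idx] by (simp add: vimage_def)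
  then have "\<forall>\<^sub>F n in sequentially. n \<notin> {n. idx n \<in> J}"
    using eventually_cofinite[of "\<lambda>n. n \<notin> {n. idx n \<in> J}"] by (simp add: cofinite_eq_sequentially)
  then have "\<forall>\<^sub>F n in sequentially. AE z in m. \<theta> (idx n) z \<in> {z\<in>A. \<forall>j\<in>J. c j (fst (snd z))} \<longleftrightarrow> z \<in> {z\<in>A. \<forall>j\<in>J. c j (fst (snd z))}"
    by eventually_elim (intro AE_cylinder_invariant inv J(2), auto simp: idx_I)
  then show ?thesis
    using U_interval[OF finite_cylinder_slice_sets[OF A J] _ ab] U_cylinder[OF A inv J] by simp
qed

lemma emeasure_U:
  assumes A: "A \<in> sets m"
  shows "emeasure mL {z\<in>A. a \<le> snd (snd z) \<and> snd (snd z) < b} = ennreal (U A (indicator {a..<b}))"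
proof -
  let ?S = "{z\<in>A. a \<le> snd (snd z) \<and> snd (snd z) < b}"
  have [measurable]: "A \<in> sets mL" using A by (simp add: sets_mL_m)
  have S_eq: "?S = A \<inter> {z\<in>space mL. a \<le> snd (snd z) \<and> snd (snd z) < b}"
    using sets.sets_into_space[OF \<open>A \<in> sets mL\<close>] by auto
  have [measurable]: "?S \<in> sets mL" unfolding S_eq by measurable
  have "emeasure mL ?S = (\<integral>\<^sup>+z. indicator ?S z \<partial>mL)" by simp
  also have "\<dots> = (\<integral>\<^sup>+z. ennreal (indicator A z * indicator {a..<b} (snd (snd z))) \<partial>mL)"
    by (intro nn_integral_cong) (auto simp: indicator_def)
  also have "\<dots> = ennreal (U A (indicator {a..<b}))"
    unfolding U_def by (rule nn_integral_eq_integral[OF integrable_U[OF test_function_indicator A]]) simp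
  finally show ?thesis .
qed

end


section \<open>Ergodicity and weak mixing\<close>

lemma emeasure_exp_measure_UNIV: "emeasure exp_measure UNIV \<noteq> 0"
proof
  assume "emeasure exp_measure UNIV = 0"
  then have "AE s in lborel. ennreal (exp (- s)) = 0"
    by (simp add: emeasure_density nn_integral_0_iff_AE)
  then have "AE s in (lborel :: real measure). False" by eventually_elim simp
  then have "emeasure lborel (UNIV :: real set) = 0" by (simp add: AE_iff_measurable[OF _ refl])
  then show False by simp
qed

context driven_coin_system
begin

text \<open>The function \<open>k\<close> is the density of \<open>A\<close> in the fibre over \<open>y\<close>. By \<open>U_cylinder_interval\<close> the measures with
densities \<open>indicator A\<close> and \<open>k\<close> agree on boxes, so these densities are equal almost everywhere and \<open>A\<close> consists of full fibres.\<close>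

lemma flip_invariant_factor:
  assumes A: "A \<in> sets m" and inv: "\<And>i. i \<in> I \<Longrightarrow> AE z in m. \<theta> i z \<in> A \<longleftrightarrow> z \<in> A"
  shows "\<exists>Q\<in>sets N. AE z in m. z \<in> A \<longleftrightarrow> fst z \<in> Q"
proof -
  have AmL [measurable]: "A \<in> sets mL" using A by (simp add: sets_mL_m)
  define k :: "'b \<Rightarrow> ennreal" where "k y = (\<integral>\<^sup>+x. \<integral>\<^sup>+s. indicator A (y, x, s) * indicator {0..<1} s \<partial>lborel \<partial>M)" for y
  have [measurable]: "k \<in> borel_measurable N"
    unfolding k_def by measurable
  define G where "G Q J a b = {z\<in>space mL. fst z \<in> Q \<and> (\<forall>j\<in>J. c j (fst (snd z))) \<and> a \<le> snd (snd z) \<and> snd (snd z) < b}"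
    for Q J and a b :: real
  define \<G> where "\<G> = {G Q J a b | Q J a b. Q \<in> sets N \<and> finite J \<and> J \<subseteq> I}"
  have G_sets: "G Q J a b \<in> sets mL" if Q: "Q \<in> sets N" and J: "finite J" "J \<subseteq> I" for Q J a b
  proof -
    have [measurable]: "Q \<in> sets N" by fact
    have [measurable]: "{x\<in>space M. \<forall>j\<in>J. c j x = True} \<in> sets M" by (rule cylinder_sets[OF J])
    have "G Q J a b = {z\<in>space mL. fst z \<in> Q \<and> fst (snd z) \<in> {x\<in>space M. \<forall>j\<in>J. c j x = True} \<and> snd (snd z) \<in> {a..<b}}"
      by (auto simp: G_def space_mL)
    also have "\<dots> \<in> sets mL" by measurable
    finally show ?thesis .
  qed
  have \<G>_sub: "\<G> \<subseteq> sets mL" using G_sets by (auto simp: \<G>_def)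
  have gen: "sets mL = sigma_sets (space mL) \<G>"
  proof (rule antisym)
    define S where "S = sigma (space mL) \<G>"
    have sub: "\<G> \<subseteq> Pow (space mL)" by (auto simp: \<G>_def G_def)
    have sets_S: "sets S = sigma_sets (space mL) \<G>" and space_S: "space S = space mL"
      using sub by (auto simp: S_def)
    have GS [measurable]: "G Q J a b \<in> sets S" if "Q \<in> sets N" "finite J" "J \<subseteq> I" for Q J a b
    proof -
      have "G Q J a b \<in> \<G>" unfolding \<G>_def using that by blast
      then show ?thesis unfolding sets_S by (rule sigma_sets.Basic)
    qed
    have cover: "\<exists>n::nat. - real n \<le> s \<and> s < real n" for s :: real
    proof -
      obtain n where "\<bar>s\<bar> < real n" using reals_Archimedean2 by blast
      then show ?thesis by (intro exI[of _ n]) auto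
    qed
    have 1: "fst \<in> S \<rightarrow>\<^sub>M N"
    proof (rule measurableI)
      fix Q assume Q: "Q \<in> sets N"
      have "fst -` Q \<inter> space S = (\<Union>n::nat. G Q {} (- real n) (real n))"
        using cover by (auto simp: G_def space_S)
      also have "\<dots> \<in> sets S" using Q by (intro sets.countable_UN) (auto intro: GS)
      finally show "fst -` Q \<inter> space S \<in> sets S" .
    qed (auto simp: space_S space_mL)
    have 2: "(\<lambda>z. fst (snd z)) \<in> S \<rightarrow>\<^sub>M M"
    proof (rule coordinate_map_measurable)
      fix i assume i: "i \<in> I"
      have "{z\<in>space S. c i (fst (snd z))} = (\<Union>n::nat. G (space N) {i} (- real n) (real n))"
        using cover by (auto simp: G_def space_S space_mL)
      also have "\<dots> \<in> sets S" using i by (intro sets.countable_UN) (auto intro: GS)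
      finally show "Measurable.pred S (\<lambda>z. c i (fst (snd z)))" unfolding pred_def .
    qed (auto simp: space_S space_mL)
    have 3: "(\<lambda>z. snd (snd z)) \<in> S \<rightarrow>\<^sub>M borel"
      unfolding borel_measurable_iff_less
    proof
      fix a :: real
      have "{z\<in>space S. snd (snd z) < a} = (\<Union>n::nat. G (space N) {} (- real n) a)"
      proof (intro equalityI subsetI)
        fix z assume z: "z \<in> {z\<in>space S. snd (snd z) < a}"
        obtain n :: nat where "- real n \<le> snd (snd z)" using cover by blast
        then show "z \<in> (\<Union>n::nat. G (space N) {} (- real n) a)"
          using z by (auto simp: G_def space_S space_mL)
      qed (auto simp: G_def space_S)
      also have "\<dots> \<in> sets S" by (intro sets.countable_UN) (auto intro: GS)
      finally show "{z\<in>space S. snd (snd z) < a} \<in> sets S" .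
    qed
    have id: "(\<lambda>z. z) \<in> S \<rightarrow>\<^sub>M N \<Otimes>\<^sub>M (M \<Otimes>\<^sub>M borel)"
      by (intro measurable_pair) (use 1 2 3 in \<open>simp_all add: comp_def\<close>)
    show "sets mL \<subseteq> sigma_sets (space mL) \<G>"
    proof
      fix B assume B: "B \<in> sets mL"
      then have "(\<lambda>z. z) -` B \<inter> space S \<in> sets S"
        using sets_mL by (intro measurable_sets[OF id]) simp
      moreover have "(\<lambda>z. z) -` B \<inter> space S = B" using sets.sets_into_space[OF B] space_S by auto
      ultimately show "B \<in> sigma_sets (space mL) \<G>" using sets_S by simp
    qed
    show "sigma_sets (space mL) \<G> \<subseteq> sets mL"
      using \<G>_sub by (rule sets.sigma_sets_subset)
  qed
  have k_Q: "(\<integral>\<^sup>+y. k y * indicator Q y \<partial>N) = ennreal (U {z\<in>A. fst z \<in> Q} (indicator {0..<1}))"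
    and AQ: "{z\<in>A. fst z \<in> Q} \<in> sets m" if Q [measurable]: "Q \<in> sets N" for Q
  proof -
    have eq: "{z\<in>A. fst z \<in> Q} = A \<inter> {z\<in>space m. fst z \<in> Q}"
      using sets.sets_into_space[OF A] by auto
    have [measurable]: "A \<in> sets m" by (rule A)
    show AQ: "{z\<in>A. fst z \<in> Q} \<in> sets m" unfolding eq by measurable
    have [measurable]: "{z\<in>{z\<in>A. fst z \<in> Q}. 0 \<le> snd (snd z) \<and> snd (snd z) < 1} \<in> sets mL"
    proof -
      have "{z\<in>{z\<in>A. fst z \<in> Q}. 0 \<le> snd (snd z) \<and> snd (snd z) < 1} = A \<inter> {z\<in>space mL. fst z \<in> Q \<and> 0 \<le> snd (snd z) \<and> snd (snd z) < 1}"
        using sets.sets_into_space[OF AmL] by auto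
      then show ?thesis by simp
    qed
    have "ennreal (U {z\<in>A. fst z \<in> Q} (indicator {0..<1})) =
        (\<integral>\<^sup>+z. indicator {z\<in>{z\<in>A. fst z \<in> Q}. 0 \<le> snd (snd z) \<and> snd (snd z) < 1} z \<partial>mL)"
      unfolding emeasure_U[OF AQ, symmetric] by simp
    also have "\<dots> = (\<integral>\<^sup>+y. \<integral>\<^sup>+x. \<integral>\<^sup>+s. indicator {z\<in>{z\<in>A. fst z \<in> Q}. 0 \<le> snd (snd z) \<and> snd (snd z) < 1} (y, x, s) \<partial>lborel \<partial>M \<partial>N)"
      by (rule nn_integral_mL) measurable
    also have "\<dots> = (\<integral>\<^sup>+y. k y * indicator Q y \<partial>N)"
    proof (rule nn_integral_cong)
      fix y assume "y \<in> space N"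
      show "(\<integral>\<^sup>+x. \<integral>\<^sup>+s. indicator {z\<in>{z\<in>A. fst z \<in> Q}. 0 \<le> snd (snd z) \<and> snd (snd z) < 1} (y, x, s) \<partial>lborel \<partial>M) = k y * indicator Q y"
        unfolding k_def
        by (cases "y \<in> Q") (auto intro!: nn_integral_cong simp: indicator_def)
    qed
    finally show "(\<integral>\<^sup>+y. k y * indicator Q y \<partial>N) = ennreal (U {z\<in>A. fst z \<in> Q} (indicator {0..<1}))" ..
  qed
  have cyl_p: "emeasure M {x\<in>space M. \<forall>j\<in>J. c j x} = ennreal (\<Prod>j\<in>J. pmf (q j) True)" if "finite J" "J \<subseteq> I" for J
    using prob_cylinder[OF that, of "\<lambda>_. True"] by (simp add: emeasure_eq_measure)
  have eq: "emeasure (density mL (indicator A)) (G Q J a b) = emeasure (density mL (\<lambda>z. k (fst z))) (G Q J a b)"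
    if Q: "Q \<in> sets N" and J: "finite J" "J \<subseteq> I" for Q J a b
  proof (cases "a \<le> b")
    case False
    then have "G Q J a b = {}" by (auto simp: G_def)
    then show ?thesis by simp
  next
    case True
    note [measurable] = G_sets[OF Q J, of a b] Q
    have invQ: "AE z in m. \<theta> i z \<in> {z\<in>A. fst z \<in> Q} \<longleftrightarrow> z \<in> {z\<in>A. fst z \<in> Q}" if "i \<in> I" for i
      using inv[OF that] by eventually_elim (auto simp: \<theta>_def)
    have "emeasure (density mL (indicator A)) (G Q J a b) = emeasure mL (A \<inter> G Q J a b)"
      by (subst emeasure_density) (auto simp: indicator_inter_arith[symmetric])
    also have "A \<inter> G Q J a b = {z\<in>{z\<in>{z\<in>A. fst z \<in> Q}. \<forall>j\<in>J. c j (fst (snd z))}. a \<le> snd (snd z) \<and> snd (snd z) < b}"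
      using sets.sets_into_space[OF AmL] by (auto simp: G_def)
    also have "emeasure mL \<dots> = ennreal (U {z\<in>{z\<in>A. fst z \<in> Q}. \<forall>j\<in>J. c j (fst (snd z))} (indicator {a..<b}))"
      by (rule emeasure_U[OF finite_cylinder_slice_sets[OF AQ[OF Q] J]])
    also have "\<dots> = ennreal ((b - a) * ((\<Prod>j\<in>J. pmf (q j) True) * U {z\<in>A. fst z \<in> Q} (indicator {0..<1})))"
      using U_cylinder_interval[OF AQ[OF Q] invQ J True] by simp
    also have "\<dots> = (\<integral>\<^sup>+y. k y * indicator Q y \<partial>N) * (emeasure M {x\<in>space M. \<forall>j\<in>J. c j x} * ennreal (b - a))"
    proof -
      have "0 \<le> U {z\<in>A. fst z \<in> Q} (indicator {0..<1})"
        unfolding U_def by (rule Bochner_Integration.integral_nonneg) simp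
      then show ?thesis
        unfolding k_Q[OF Q] cyl_p[OF J] using True
        by (simp add: ennreal_mult[symmetric] prod_nonneg ac_simps)
    qed
    also have "\<dots> = (\<integral>\<^sup>+y. \<integral>\<^sup>+x. \<integral>\<^sup>+s. k y * indicator (G Q J a b) (y, x, s) \<partial>lborel \<partial>M \<partial>N)"
    proof -
      have [measurable]: "{x\<in>space M. \<forall>j\<in>J. c j x} \<in> sets M" using cylinder_sets[OF J, of "\<lambda>_. True"] by simp
      have "(\<integral>\<^sup>+y. \<integral>\<^sup>+x. \<integral>\<^sup>+s. k y * indicator (G Q J a b) (y, x, s) \<partial>lborel \<partial>M \<partial>N) =
        (\<integral>\<^sup>+y. \<integral>\<^sup>+x. \<integral>\<^sup>+s. k y * indicator Q y * (indicator {x\<in>space M. \<forall>j\<in>J. c j x} x * indicator {a..<b} s) \<partial>lborel \<partial>M \<partial>N)"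
        by (intro nn_integral_cong) (auto simp: G_def space_mL indicator_def)
      also have "\<dots> = (\<integral>\<^sup>+y. k y * indicator Q y \<partial>N) * (emeasure M {x\<in>space M. \<forall>j\<in>J. c j x} * ennreal (b - a))"
        using True by (simp add: nn_integral_cmult nn_integral_multc)
      finally show ?thesis ..
    qed
    also have "\<dots> = (\<integral>\<^sup>+z. k (fst z) * indicator (G Q J a b) z \<partial>mL)"
      by (subst nn_integral_mL) auto
    also have "\<dots> = emeasure (density mL (\<lambda>z. k (fst z))) (G Q J a b)"
      by (rule emeasure_density[symmetric]) measurable
    finally show ?thesis .
  qed
  have "density mL (indicator A) = density mL (\<lambda>z. k (fst z))"
  proof (rule measure_eqI_generator_eq[where E = \<G> and \<Omega> = "space mL" and A = "\<lambda>n. G (space N) {} (- real n) (real n)"])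
    show "Int_stable \<G>"
    proof (rule Int_stableI)
      fix X Y assume "X \<in> \<G>" "Y \<in> \<G>"
      then obtain Q J a b Q' J' a' b' where *: "X = G Q J a b" "Q \<in> sets N" "finite J" "J \<subseteq> I"
        "Y = G Q' J' a' b'" "Q' \<in> sets N" "finite J'" "J' \<subseteq> I" by (auto simp: \<G>_def)
      have "X \<inter> Y = G (Q \<inter> Q') (J \<union> J') (max a a') (min b b')"
        unfolding * by (auto simp: G_def)
      moreover have "Q \<inter> Q' \<in> sets N" "finite (J \<union> J')" "J \<union> J' \<subseteq> I" using * by auto
      ultimately show "X \<inter> Y \<in> \<G>" unfolding \<G>_def by blast
    qed
    show "\<G> \<subseteq> Pow (space mL)" by (auto simp: \<G>_def G_def)
    show "emeasure (density mL (indicator A)) X = emeasure (density mL (\<lambda>z. k (fst z))) X" if "X \<in> \<G>" for X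
      using that eq by (auto simp: \<G>_def)
    show "range (\<lambda>n. G (space N) {} (- real n) (real n)) \<subseteq> \<G>" unfolding \<G>_def by blast
    show "(\<Union>n. G (space N) {} (- real n) (real n)) = space mL"
    proof (intro equalityI subsetI)
      fix z assume z: "z \<in> space mL"
      obtain n where "\<bar>snd (snd z)\<bar> < real n" using reals_Archimedean2 by blast
      then show "z \<in> (\<Union>n. G (space N) {} (- real n) (real n))"
        using z by (intro UN_I[of n]) (auto simp: G_def space_mL)
    qed (auto simp: G_def)
    show "emeasure (density mL (indicator A)) (G (space N) {} (- real n) (real n)) \<noteq> \<infinity>" for n
    proof -
      note [measurable] = G_sets[of "space N" "{}" "- real n" "real n", simplified]
      have "emeasure (density mL (indicator A)) (G (space N) {} (- real n) (real n)) =
        emeasure mL (A \<inter> G (space N) {} (- real n) (real n))"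
        by (subst emeasure_density) (auto simp: indicator_inter_arith[symmetric])
      also have "A \<inter> G (space N) {} (- real n) (real n) = {z\<in>A. - real n \<le> snd (snd z) \<and> snd (snd z) < real n}"
        using sets.sets_into_space[OF AmL] by (auto simp: G_def space_mL)
      also have "emeasure mL \<dots> = ennreal (U A (indicator {- real n..<real n}))" by (rule emeasure_U[OF A])
      finally show ?thesis by simp
    qed
  qed (simp_all add: gen)
  then have "AE z in mL. indicator A z = k (fst z)"
    by (subst (asm) mL.density_unique_iff) auto
  then have "AE z in m. indicator A z = k (fst z)" by (simp add: AE_mL_iff)
  then have "AE z in m. z \<in> A \<longleftrightarrow> fst z \<in> {y\<in>space N. k y = 1}"
    using AE_space
  proof eventually_elim
    case (elim z)
    then show ?case by (cases "z \<in> A") (auto simp: space_m)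
  qed
  moreover have "{y\<in>space N. k y = 1} \<in> sets N" by measurable
  ultimately show ?thesis by blast
qed

lemma ergodic_diagonal:
  assumes erg: "ergodic_action N act'"
  shows "ergodic_action (N \<Otimes>\<^sub>M maharam_measure M) (diagonal_action act' (maharam_action M act))"
  unfolding ergodic_action_def m_def[symmetric] \<tau>_def[symmetric]
proof (intro ballI impI)
  fix A assume A: "A \<in> sets m" and inv0: "\<forall>g. AE z in m. \<tau> g z \<in> A \<longleftrightarrow> z \<in> A"
  then have inv: "AE z in m. \<tau> g z \<in> A \<longleftrightarrow> z \<in> A" for g by blast
  interpret mm: sigma_finite_measure "maharam_measure M"
    by (rule sigma_finite_maharam_measure[OF nonsingular])
  obtain Q where Q [measurable]: "Q \<in> sets N" and AQ: "AE z in m. z \<in> A \<longleftrightarrow> fst z \<in> Q"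
    using flip_invariant_factor[OF A AE_flip_invariant[OF A inv]] by blast
  have act'_m [measurable]: "act' g \<in> N \<rightarrow>\<^sub>M N" for g
    using pmp by (simp add: pmp_action_def nonsingular_action_def)
  have AE_N: "AE y in N. P y" if ae: "AE z in m. P (fst z)" and [measurable]: "{y\<in>space N. \<not> P y} \<in> sets N" for P
  proof -
    let ?Y = "{y\<in>space N. \<not> P y}"
    have "AE z in m. z \<notin> ?Y \<times> space (maharam_measure M)" using ae by eventually_elim auto
    then have "?Y \<times> space (maharam_measure M) \<in> null_sets m"
      by (subst AE_iff_null_sets) (auto simp: m_def)
    then have "emeasure N ?Y * emeasure (maharam_measure M) (space (maharam_measure M)) = 0"
      by (simp add: m_def null_sets_def mm.emeasure_pair_measure_Times)
    moreover have "emeasure (maharam_measure M) (space (maharam_measure M)) \<noteq> 0"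
      using emeasure_exp_measure_UNIV
      by (simp add: maharam_measure_def space_pair_measure Exp.emeasure_pair_measure_Times emeasure_space_1)
    ultimately have "?Y \<in> null_sets N" by (auto simp: null_sets_def)
    then show ?thesis by (rule AE_I') auto
  qed
  have "AE y in N. act' g y \<in> Q \<longleftrightarrow> y \<in> Q" for g
  proof (rule AE_N)
    show "AE z in m. act' g (fst z) \<in> Q \<longleftrightarrow> fst z \<in> Q"
      using AQ AE_act[OF AQ] inv[of g]
    proof eventually_elim
      case (elim z)
      have "fst (\<tau> g z) = act' g (fst z)" by (cases z) (auto simp: \<tau>_def diagonal_action_def)
      then show ?case using elim(1) elim(2)[rule_format, of g] elim(3) by simp
    qed
  qed measurable
  then have "Q \<in> null_sets N \<or> space N - Q \<in> null_sets N"
    using erg Q by (simp add: ergodic_action_def)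
  then show "A \<in> null_sets m \<or> space m - A \<in> null_sets m"
  proof
    assume "Q \<in> null_sets N"
    then have "AE z in m. fst z \<notin> Q"
      unfolding m_def by (intro AE_pair_fst mm.sigma_finite_measure_axioms AE_not_in)
    with AQ have "AE z in m. z \<notin> A" by eventually_elim auto
    then have "A \<in> null_sets m" using A by (simp add: AE_iff_null_sets)
    then show ?thesis ..
  next
    assume "space N - Q \<in> null_sets N"
    then have "AE z in m. fst z \<notin> space N - Q"
      unfolding m_def by (intro AE_pair_fst mm.sigma_finite_measure_axioms AE_not_in)
    with AQ AE_space have "AE z in m. z \<notin> space m - A" by eventually_elim (auto simp: space_m)
    then have "space m - A \<in> null_sets m" using A by (simp add: AE_iff_null_sets)
    then show ?thesis ..
  qed
qed

end

context coin_system
begin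

lemma ergodic_diagonal_maharam:
  fixes N :: "'b measure"
  assumes pmp: "pmp_action N act'" and erg: "ergodic_action N act'"
  shows "ergodic_action (N \<Otimes>\<^sub>M maharam_measure M) (diagonal_action act' (maharam_action M act))"
proof -
  interpret driven_coin_system M I c q flip \<delta> act \<pi> E base C\<^sub>E idx N act'
    by unfold_locales (rule pmp)
  show ?thesis by (rule ergodic_diagonal[OF erg])
qed

text \<open>The one-point system serves as \<open>N\<close>.\<close>

lemma ergodic_maharam: "ergodic_action (maharam_measure M) (maharam_action M act)"
  unfolding ergodic_action_def
proof (intro ballI impI)
  interpret mm: sigma_finite_measure "maharam_measure M"
    by (rule sigma_finite_maharam_measure[OF nonsingular])
  fix A assume A: "A \<in> sets (maharam_measure M)"
    and inv: "\<forall>g. AE z in maharam_measure M. maharam_action M act g z \<in> A \<longleftrightarrow> z \<in> A"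
  define N where "N = return (count_space UNIV) ()"
  interpret N: prob_space N unfolding N_def by (rule prob_space_return) simp
  define act' :: "int \<Rightarrow> unit \<Rightarrow> unit" where "act' g y = y" for g y
  have act'_id: "act' g = (\<lambda>y. y)" for g by (simp add: act'_def fun_eq_iff)
  have "pmp_action N act'"
    unfolding pmp_action_def nonsingular_action_def act'_id distr_id
    by (intro conjI allI ballI N.prob_space_axioms N.sigma_finite_measure_axioms measurable_ident_sets refl)
  moreover have "ergodic_action N act'"
    unfolding ergodic_action_def
  proof (intro ballI impI)
    fix S assume "S \<in> sets N"
    have "S = {} \<or> space N - S = {}" by (auto simp: N_def)
    then show "S \<in> null_sets N \<or> space N - S \<in> null_sets N"
      by (elim disjE) (simp_all only: null_sets.empty_sets simp_thms)
  qed
  ultimately have erg: "ergodic_action (N \<Otimes>\<^sub>M maharam_measure M) (diagonal_action act' (maharam_action M act))"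
    by (rule ergodic_diagonal_maharam)
  let ?A = "space N \<times> A"
  have "AE z in N \<Otimes>\<^sub>M maharam_measure M. diagonal_action act' (maharam_action M act) g z \<in> ?A \<longleftrightarrow> z \<in> ?A" for g
  proof -
    have "AE z in N \<Otimes>\<^sub>M maharam_measure M. maharam_action M act g (snd z) \<in> A \<longleftrightarrow> snd z \<in> A"
      using inv by (intro AE_pair_snd mm.sigma_finite_measure_axioms) blast
    then show ?thesis
      using AE_space by eventually_elim (auto simp: diagonal_action_def act'_def space_pair_measure)
  qed
  moreover have "?A \<in> sets (N \<Otimes>\<^sub>M maharam_measure M)" using A by simp
  ultimately have "?A \<in> null_sets (N \<Otimes>\<^sub>M maharam_measure M) \<or>
      space (N \<Otimes>\<^sub>M maharam_measure M) - ?A \<in> null_sets (N \<Otimes>\<^sub>M maharam_measure M)"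
    using erg by (simp add: ergodic_action_def)
  moreover have "space (N \<Otimes>\<^sub>M maharam_measure M) - ?A = space N \<times> (space (maharam_measure M) - A)"
    by (auto simp: space_pair_measure)
  ultimately show "A \<in> null_sets (maharam_measure M) \<or> space (maharam_measure M) - A \<in> null_sets (maharam_measure M)"
    using A by (auto simp: null_sets_def mm.emeasure_pair_measure_Times N.emeasure_space_1)
qed

lemma ergodic: "ergodic_action M act"
  unfolding ergodic_action_def
proof (intro ballI impI)
  interpret Exp: sigma_finite_measure exp_measure by (rule sigma_finite_exp_measure)
  fix A assume A: "A \<in> sets M" and inv: "\<forall>g. AE x in M. act g x \<in> A \<longleftrightarrow> x \<in> A"
  let ?A = "A \<times> (UNIV :: real set)"
  have A': "?A \<in> sets (maharam_measure M)" unfolding maharam_measure_def using A by simp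
  have "AE z in maharam_measure M. maharam_action M act g z \<in> ?A \<longleftrightarrow> z \<in> ?A" for g
  proof -
    have "AE z in maharam_measure M. act g (fst z) \<in> A \<longleftrightarrow> fst z \<in> A"
      unfolding maharam_measure_def using inv by (intro AE_pair_fst sigma_finite_exp_measure) blast
    then show ?thesis by eventually_elim (auto simp: maharam_action_def)
  qed
  then have "?A \<in> null_sets (maharam_measure M) \<or> space (maharam_measure M) - ?A \<in> null_sets (maharam_measure M)"
    using ergodic_maharam A' by (simp add: ergodic_action_def)
  moreover have "space (maharam_measure M) - ?A = (space M - A) \<times> (UNIV :: real set)"
    by (auto simp: maharam_measure_def space_pair_measure)
  moreover note emeasure_exp_measure_UNIV
  moreover have "S \<times> (UNIV :: real set) \<in> null_sets (maharam_measure M) \<Longrightarrow> emeasure M S * emeasure exp_measure UNIV = 0"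
    if "S \<in> sets M" for S
    using that unfolding maharam_measure_def null_sets_def
    by (simp add: Exp.emeasure_pair_measure_Times[symmetric])
  ultimately show "A \<in> null_sets M \<or> space M - A \<in> null_sets M"
    using A by (auto simp: null_sets_def)
qed

lemma shift_properties:
  "nonsingular_action M act" "essentially_free M act" "ergodic_action M act" "type_III1 M act"
  "weakly_mixing TYPE('y) (maharam_measure M) (maharam_action M act)"
proof -
  show 1: "nonsingular_action M act" by (rule nonsingular)
  show 2: "essentially_free M act" unfolding essentially_free_def using fixed_points_null by blast
  show 3: "ergodic_action M act" by (rule ergodic)
  show "type_III1 M act" unfolding type_III1_def using 1 2 3 ergodic_maharam by blast
  show "weakly_mixing TYPE('y) (maharam_measure M) (maharam_action M act)"
    unfolding weakly_mixing_def using ergodic_diagonal_maharam by blast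
qed

end


section \<open>A slowly vanishing bias\<close>

definition bias :: "int \<Rightarrow> int \<Rightarrow> real" where
  "bias n\<^sub>0 n = (if n\<^sub>0 \<le> n then 1 / sqrt (real_of_int n * ln (real_of_int n)) else 0)"

context
  fixes n\<^sub>0 :: int
  assumes n0: "2 \<le> n\<^sub>0"
begin

lemma n_ln_pos: "n\<^sub>0 \<le> n \<Longrightarrow> 0 < real_of_int n * ln (real_of_int n)"
  using n0 by simp

lemma bias_nonneg: "0 \<le> bias n\<^sub>0 n"
  using n_ln_pos[of n] by (cases "n\<^sub>0 \<le> n") (simp_all add: bias_def less_imp_le)

lemma bias_square: "n\<^sub>0 \<le> n \<Longrightarrow> (bias n\<^sub>0 n)\<^sup>2 = 1 / (real_of_int n * ln (real_of_int n))"
  using n_ln_pos[of n] by (simp add: bias_def power_divide)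

lemma bias_antimono:
  assumes "n\<^sub>0 \<le> i" "i \<le> j" shows "bias n\<^sub>0 j \<le> bias n\<^sub>0 i"
proof -
  have "real_of_int i * ln (real_of_int i) \<le> real_of_int j * ln (real_of_int j)"
    using assms n0 by (intro mult_mono) auto
  then show ?thesis
    using assms n_ln_pos[of i] n_ln_pos[of j] by (auto simp: bias_def intro!: divide_left_mono)
qed

lemma bias_le_start: "bias n\<^sub>0 n \<le> bias n\<^sub>0 n\<^sub>0"
  using bias_antimono[of n\<^sub>0 n] bias_nonneg[of n\<^sub>0] by (cases "n\<^sub>0 \<le> n") (auto simp: bias_def)

text \<open>The squared norm of the first \<open>n\<close> biases; it controls the energy of the \<open>n\<close>-th shift.\<close>

definition square_sum :: "nat \<Rightarrow> real" where
  "square_sum n = (\<Sum>i<n. (bias n\<^sub>0 (n\<^sub>0 + int i))\<^sup>2)"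

lemma sum_shift_difference:
  fixes f :: "nat \<Rightarrow> real"
  assumes "\<And>i. 0 \<le> f i"
  shows "(\<Sum>i<R. f i - f (i + n)) \<le> (\<Sum>i<n. f i)"
proof -
  have "(\<Sum>i<R. f i) \<le> (\<Sum>i<n + R. f i)"
    using assms by (intro sum_mono2) auto
  also have "\<dots> = (\<Sum>i<n. f i) + (\<Sum>i<R. f (i + n))"
    by (induction R) (simp_all add: add.commute)
  finally show ?thesis by (simp add: sum_subtractf)
qed

text \<open>The coins up to \<open>n\<^sub>0 + n\<close> contribute at most twice the sum of the first \<open>n\<close> squares. Beyond, the sequence decreases,
so the square of a difference is at most the difference times the first value, and the differences telescope to
at most \<open>n\<close> terms.\<close>

lemma bias_energy:
  assumes J: "finite J"
  shows "(\<Sum>j\<in>J. (bias n\<^sub>0 (j + int n) - bias n\<^sub>0 j)\<^sup>2) \<le> 3 * square_sum n"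
proof -
  let ?c = "bias n\<^sub>0"
  let ?t = "\<lambda>j. (?c (j + int n) - ?c j)\<^sup>2"
  define J0 J1 J2 J3 where "J0 = {j\<in>J. j < n\<^sub>0 - int n}" and "J1 = {j\<in>J. n\<^sub>0 - int n \<le> j \<and> j < n\<^sub>0}"
    and "J2 = {j\<in>J. n\<^sub>0 \<le> j \<and> j < n\<^sub>0 + int n}" and "J3 = {j\<in>J. n\<^sub>0 + int n \<le> j}"
  have fin: "finite J0" "finite J1" "finite J2" "finite J3" using J by (auto simp: J0_def J1_def J2_def J3_def)
  have J_eq: "J = J0 \<union> (J1 \<union> (J2 \<union> J3))" by (auto simp: J0_def J1_def J2_def J3_def)
  have "(\<Sum>j\<in>J. ?t j) = (\<Sum>j\<in>J0. ?t j) + ((\<Sum>j\<in>J1. ?t j) + ((\<Sum>j\<in>J2. ?t j) + (\<Sum>j\<in>J3. ?t j)))"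
    unfolding J_eq using fin
    by (subst sum.union_disjoint; (simp add: J0_def J1_def J2_def J3_def; fastforce)?)+
  moreover have "(\<Sum>j\<in>J0. ?t j) = 0"
    by (rule sum.neutral) (auto simp: J0_def bias_def)
  moreover have "(\<Sum>j\<in>J1. ?t j) \<le> square_sum n"
  proof -
    have "(\<Sum>j\<in>J1. ?t j) = (\<Sum>j\<in>J1. (?c (n\<^sub>0 + int (nat (j + int n - n\<^sub>0))))\<^sup>2)"
      by (intro sum.cong) (auto simp: J1_def bias_def)
    also have "\<dots> = (\<Sum>i\<in>(\<lambda>j. nat (j + int n - n\<^sub>0)) ` J1. (?c (n\<^sub>0 + int i))\<^sup>2)"
      by (subst sum.reindex) (auto simp: J1_def inj_on_def)
    also have "\<dots> \<le> square_sum n" unfolding square_sum_def by (rule sum_mono2) (auto simp: J1_def)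
    finally show ?thesis .
  qed
  moreover have "(\<Sum>j\<in>J2. ?t j) \<le> square_sum n"
  proof -
    have "(\<Sum>j\<in>J2. ?t j) \<le> (\<Sum>j\<in>J2. (?c (n\<^sub>0 + int (nat (j - n\<^sub>0))))\<^sup>2)"
    proof (rule sum_mono)
      fix j assume "j \<in> J2"
      then have j: "n\<^sub>0 \<le> j" by (simp add: J2_def)
      have "?c (j + int n) \<le> ?c j" using j by (intro bias_antimono) auto
      then have "\<bar>?c (j + int n) - ?c j\<bar> \<le> \<bar>?c j\<bar>" using bias_nonneg[of "j + int n"] by simp
      then show "?t j \<le> (?c (n\<^sub>0 + int (nat (j - n\<^sub>0))))\<^sup>2" using j by (simp add: abs_le_square_iff)
    qed
    also have "\<dots> = (\<Sum>i\<in>(\<lambda>j. nat (j - n\<^sub>0)) ` J2. (?c (n\<^sub>0 + int i))\<^sup>2)"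
      by (subst sum.reindex) (auto simp: J2_def inj_on_def)
    also have "\<dots> \<le> square_sum n" unfolding square_sum_def by (rule sum_mono2) (auto simp: J2_def)
    finally show ?thesis .
  qed
  moreover have "(\<Sum>j\<in>J3. ?t j) \<le> square_sum n"
  proof -
    define f where "f i = ?c (n\<^sub>0 + int n + int i)" for i :: nat
    have f_mono: "f (i + n) \<le> f i" for i unfolding f_def by (intro bias_antimono) auto
    have f0: "f i \<le> f 0" for i unfolding f_def by (intro bias_antimono) auto
    have f_nn: "0 \<le> f i" for i unfolding f_def by (rule bias_nonneg)
    let ?h = "\<lambda>j. nat (j - n\<^sub>0 - int n)"
    obtain R where R: "?h ` J3 \<subseteq> {..<R}"
      using finite_nat_bounded[of "?h ` J3"] fin(4) by auto
    have "(\<Sum>j\<in>J3. ?t j) = (\<Sum>i\<in>?h ` J3. (f (i + n) - f i)\<^sup>2)"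
      by (subst sum.reindex) (auto simp: J3_def inj_on_def f_def ac_simps intro!: sum.cong)
    also have "\<dots> \<le> (\<Sum>i<R. (f (i + n) - f i)\<^sup>2)" by (rule sum_mono2) (use R in auto)
    also have "\<dots> \<le> (\<Sum>i<R. f 0 * (f i - f (i + n)))"
    proof (rule sum_mono)
      fix i
      have "(f (i + n) - f i)\<^sup>2 = (f i - f (i + n)) * (f i - f (i + n))" by (simp add: power2_eq_square algebra_simps)
      also have "\<dots> \<le> f 0 * (f i - f (i + n))"
        using f_mono[of i] f0[of i] f_nn[of "i + n"] by (intro mult_right_mono) auto
      finally show "(f (i + n) - f i)\<^sup>2 \<le> f 0 * (f i - f (i + n))" .
    qed
    also have "\<dots> = f 0 * (\<Sum>i<R. f i - f (i + n))" by (simp add: sum_distrib_left)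
    also have "\<dots> \<le> f 0 * (\<Sum>i<n. f i)"
      by (intro mult_left_mono sum_shift_difference f_nn)
    also have "\<dots> \<le> f 0 * (\<Sum>i<n. f 0)" by (intro mult_left_mono sum_mono f0 f_nn)
    also have "\<dots> = (\<Sum>i<n. (f 0)\<^sup>2)" by (simp add: power2_eq_square)
    also have "\<dots> \<le> square_sum n"
      unfolding square_sum_def f_def by (intro sum_mono power_mono bias_antimono bias_nonneg) auto
    finally show ?thesis .
  qed
  ultimately show ?thesis by simp
qed

lemma bias_energy_int:
  assumes J: "finite J"
  shows "(\<Sum>j\<in>J. (bias n\<^sub>0 (j - g) - bias n\<^sub>0 j)\<^sup>2) \<le> 3 * square_sum (nat \<bar>g\<bar>)"
proof (cases "0 \<le> g")
  case True
  have "(\<Sum>j\<in>J. (bias n\<^sub>0 (j - g) - bias n\<^sub>0 j)\<^sup>2) =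
      (\<Sum>j\<in>(\<lambda>j. j - g) ` J. (bias n\<^sub>0 (j + int (nat \<bar>g\<bar>)) - bias n\<^sub>0 j)\<^sup>2)"
    using True by (subst sum.reindex) (auto simp: inj_on_def power2_commute)
  then show ?thesis using bias_energy[of "(\<lambda>j. j - g) ` J" "nat \<bar>g\<bar>"] J by simp
next
  case False
  then show ?thesis using bias_energy[OF J, of "nat \<bar>g\<bar>"] by simp
qed

lemma bias_tendsto: "(\<lambda>n. bias n\<^sub>0 (n\<^sub>0 + int n)) \<longlonglongrightarrow> 0"
proof -
  have "(\<lambda>n::nat. 1 / sqrt ((of_int n\<^sub>0 + real n) * ln (of_int n\<^sub>0 + real n))) \<longlonglongrightarrow> 0"
    by real_asymp
  then show ?thesis by (simp add: bias_def)
qed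

lemma square_sum_growth:
  assumes \<eta>: "0 < \<eta>"
  shows "\<exists>C. \<forall>n>0. square_sum n \<le> \<eta> * ln (real n) + C"
proof -
  have "(\<lambda>n::nat. (real n + 1) / ((of_int n\<^sub>0 + real n) * ln (of_int n\<^sub>0 + real n))) \<longlonglongrightarrow> 0"
    by real_asymp
  then have "\<forall>\<^sub>F n in sequentially. (real n + 1) / ((of_int n\<^sub>0 + real n) * ln (of_int n\<^sub>0 + real n)) < \<eta>"
    using \<eta> by (rule order_tendstoD(2))
  then obtain k where k: "\<And>n. k \<le> n \<Longrightarrow> (real n + 1) / ((of_int n\<^sub>0 + real n) * ln (of_int n\<^sub>0 + real n)) < \<eta>"
    by (auto simp: eventually_sequentially)
  have le: "(bias n\<^sub>0 (n\<^sub>0 + int i))\<^sup>2 \<le> \<eta> * inverse (real (Suc i)) + (if i < k then (bias n\<^sub>0 (n\<^sub>0 + int i))\<^sup>2 else 0)" for i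
  proof (cases "i < k")
    case True
    then show ?thesis using \<eta> by simp
  next
    case False
    have "(bias n\<^sub>0 (n\<^sub>0 + int i))\<^sup>2 = 1 / ((of_int n\<^sub>0 + real i) * ln (of_int n\<^sub>0 + real i))"
      by (simp add: bias_square)
    also have "\<dots> = (real i + 1) / ((of_int n\<^sub>0 + real i) * ln (of_int n\<^sub>0 + real i)) * inverse (real (Suc i))"
      by (simp add: field_simps)
    also have "\<dots> \<le> \<eta> * inverse (real (Suc i))"
      using k[of i] False by (intro mult_right_mono) auto
    finally show ?thesis using False by simp
  qed
  have "square_sum n \<le> \<eta> * ln (real n) + (\<eta> + square_sum k)" if n: "0 < n" for n
  proof -
    have "square_sum n \<le> (\<Sum>i<n. \<eta> * inverse (real (Suc i)) + (if i < k then (bias n\<^sub>0 (n\<^sub>0 + int i))\<^sup>2 else 0))"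
      unfolding square_sum_def by (rule sum_mono) (rule le)
    also have "\<dots> = \<eta> * harm n + (\<Sum>i<n. if i < k then (bias n\<^sub>0 (n\<^sub>0 + int i))\<^sup>2 else 0)"
      by (simp add: sum.distrib harm_def sum_distrib_left[symmetric] sum.atLeast1_atMost_eq)
    also have "(\<Sum>i<n. if i < k then (bias n\<^sub>0 (n\<^sub>0 + int i))\<^sup>2 else 0) \<le> square_sum k"
      unfolding square_sum_def by (subst sum.inter_filter[symmetric]) (auto intro!: sum_mono2)
    also have "harm n \<le> ln (real n) + 1"
    proof -
      obtain l where "n = Suc l" using n by (cases n) auto
      then show ?thesis using decseqD[OF decseq_harm_diff_ln, of 0 l] by (simp add: harm_expand)
    qed
    finally show ?thesis using \<eta> by (simp add: algebra_simps)
  qed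
  then show ?thesis by blast
qed

text \<open>Comparison with the increments of \<open>ln (ln n)\<close>.\<close>

lemma bias_square_divergent: "\<not> summable (\<lambda>n. (bias n\<^sub>0 (n\<^sub>0 + int n))\<^sup>2)"
proof
  let ?a = "\<lambda>n::nat. real_of_int n\<^sub>0 + real n"
  assume "summable (\<lambda>n. (bias n\<^sub>0 (n\<^sub>0 + int n))\<^sup>2)"
  then have bd: "(\<Sum>i<n. (bias n\<^sub>0 (n\<^sub>0 + int i))\<^sup>2) \<le> (\<Sum>i. (bias n\<^sub>0 (n\<^sub>0 + int i))\<^sup>2)" for n
    by (intro sum_le_suminf) auto
  have step: "ln (ln (?a (Suc i))) - ln (ln (?a i)) \<le> (bias n\<^sub>0 (n\<^sub>0 + int i))\<^sup>2" for i
  proof -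
    have a: "1 < ?a i" "0 < ln (?a i)" "0 < ln (?a (Suc i))" "0 < ?a i" using n0 by auto
    have "ln (?a (Suc i)) - ln (?a i) = ln (1 + 1 / ?a i)"
      using a by (subst ln_divide_pos[symmetric]) (auto simp: field_simps)
    also have "\<dots> \<le> 1 / ?a i" using a by (intro ln_add_one_self_le_self) auto
    finally have 1: "ln (?a (Suc i)) - ln (?a i) \<le> 1 / ?a i" .
    have "ln (ln (?a (Suc i))) - ln (ln (?a i)) = ln (ln (?a (Suc i)) / ln (?a i))"
      using a by (subst ln_divide_pos) auto
    also have "\<dots> \<le> ln (?a (Suc i)) / ln (?a i) - 1" using a by (intro ln_le_minus_one) auto
    also have "\<dots> = (ln (?a (Suc i)) - ln (?a i)) / ln (?a i)" using a by (simp add: diff_divide_distrib)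
    also have "\<dots> \<le> (1 / ?a i) / ln (?a i)" using 1 a by (intro divide_right_mono) auto
    finally show ?thesis by (simp add: bias_square)
  qed
  have "ln (ln (?a n)) - ln (ln (?a 0)) \<le> (\<Sum>i. (bias n\<^sub>0 (n\<^sub>0 + int i))\<^sup>2)" for n
  proof -
    have "ln (ln (?a n)) - ln (ln (?a 0)) = (\<Sum>i<n. ln (ln (?a (Suc i))) - ln (ln (?a i)))"
      by (rule sum_lessThan_telescope[symmetric])
    also have "\<dots> \<le> (\<Sum>i<n. (bias n\<^sub>0 (n\<^sub>0 + int i))\<^sup>2)" by (rule sum_mono) (rule step)
    also note bd
    finally show ?thesis .
  qed
  then have "\<And>n. ln (ln (?a n)) \<le> (\<Sum>i. (bias n\<^sub>0 (n\<^sub>0 + int i))\<^sup>2) + ln (ln (?a 0))"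
    by (simp add: algebra_simps)
  moreover have "filterlim (\<lambda>n. ln (ln (?a n))) at_top sequentially" by real_asymp
  then have "\<forall>\<^sub>F n in sequentially. (\<Sum>i. (bias n\<^sub>0 (n\<^sub>0 + int i))\<^sup>2) + ln (ln (?a 0)) < ln (ln (?a n))"
    by (rule filterlim_at_top_dense[THEN iffD1, rule_format])
  then obtain n where "(\<Sum>i. (bias n\<^sub>0 (n\<^sub>0 + int i))\<^sup>2) + ln (ln (?a 0)) < ln (ln (?a n))"
    by (auto simp: eventually_sequentially)
  ultimately show False by (meson not_le)
qed

end


section \<open>Bernoulli shifts and their powers\<close>

lemma coin_flip_bernoulli_space:
  assumes \<delta>: "0 < \<delta>" "\<And>n b. \<delta> \<le> pmf (\<mu> n) b"
  shows "coin_flip (bernoulli_space \<mu>) UNIV (\<lambda>n x. x n) \<mu> (\<lambda>n x. x(n := \<not> x n)) \<delta>"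
proof -
  interpret P: product_prob_space "\<lambda>n. measure_pmf (\<mu> n)" UNIV ..
  have sp: "space (bernoulli_space \<mu>) = UNIV"
    by (auto simp: bernoulli_space_def space_PiM)
  interpret prob_space "bernoulli_space \<mu>"
    unfolding bernoulli_space_def by (rule P.P.prob_space_axioms)
  show ?thesis
  proof
    let ?G = "{{x \<in> space (bernoulli_space \<mu>). x i} |i. i \<in> UNIV}"
    show "sets (bernoulli_space \<mu>) = sigma_sets (space (bernoulli_space \<mu>)) ?G"
    proof (rule antisym)
      define S where "S = sigma (UNIV :: (int \<Rightarrow> bool) set) ?G"
      have sets_S: "sets S = sigma_sets UNIV ?G" and space_S: "space S = UNIV" by (simp_all add: S_def)
      have "(\<lambda>x. x) \<in> S \<rightarrow>\<^sub>M bernoulli_space \<mu>"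
        unfolding bernoulli_space_def
      proof (rule measurable_PiM_single')
        fix n :: int
        have "{x\<in>space S. x n} \<in> sets S" unfolding sets_S space_S by (rule sigma_sets.Basic) (auto simp: sp)
        then have "Measurable.pred S (\<lambda>x. x n)" by (simp add: pred_def)
        then show "(\<lambda>x. x n) \<in> S \<rightarrow>\<^sub>M measure_pmf (\<mu> n)" by simp
      qed (auto simp: space_S)
      then show "sets (bernoulli_space \<mu>) \<subseteq> sigma_sets (space (bernoulli_space \<mu>)) ?G"
        using measurable_sets[of "\<lambda>x. x" S "bernoulli_space \<mu>"] by (auto simp: sp space_S sets_S)
      show "sigma_sets (space (bernoulli_space \<mu>)) ?G \<subseteq> sets (bernoulli_space \<mu>)"
      proof (rule sets.sigma_sets_subset, safe)
        fix n :: int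
        show "{x \<in> space (bernoulli_space \<mu>). x n} \<in> sets (bernoulli_space \<mu>)"
          unfolding bernoulli_space_def by measurable
      qed
    qed
  next
    fix J :: "int set" and v assume J: "finite J"
    have "emeasure (bernoulli_space \<mu>) {x\<in>space (bernoulli_space \<mu>). \<forall>j\<in>J. x j = v j} =
        (\<Prod>j\<in>J. emeasure (measure_pmf (\<mu> j)) {v j})"
      unfolding bernoulli_space_def using P.emeasure_PiM_Collect[of J "\<lambda>j. {v j}"] J by simp
    also have "\<dots> = ennreal (\<Prod>j\<in>J. pmf (\<mu> j) (v j))"
      by (simp add: emeasure_pmf_single prod_ennreal)
    finally show "prob {x\<in>space (bernoulli_space \<mu>). \<forall>j\<in>J. x j = v j} = (\<Prod>j\<in>J. pmf (\<mu> j) (v j))"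
      by (simp add: measure_def prod_nonneg)
  qed (use \<delta> in \<open>auto simp: sp\<close>)
qed

lemma coin_flip_power_space:
  assumes "coin_flip M I c q flip \<delta>"
  shows "coin_flip (power_space k M) ({1..k} \<times> I) (\<lambda>(l, j) x. c j (x l)) (\<lambda>(l, j). q j)
    (\<lambda>(l, j) x. x(l := flip j (x l))) \<delta>"
proof -
  interpret coin_flip M I c q flip \<delta> by fact
  interpret P: product_prob_space "\<lambda>_. M" "{1..k}" by unfold_locales
  interpret Pk: prob_space "power_space k M"
    unfolding power_space_def by (rule P.P.prob_space_axioms)
  have sp: "space (power_space k M) = (\<Pi>\<^sub>E l\<in>{1..k}. space M)"
    by (simp add: power_space_def space_PiM)
  show ?thesis
  proof
    let ?G = "{{x \<in> space (power_space k M). (\<lambda>(l, j) x. c j (x l)) i x} |i. i \<in> {1..k} \<times> I}"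
    have G_sub: "?G \<subseteq> Pow (space (power_space k M))" by auto
    show "sets (power_space k M) = sigma_sets (space (power_space k M)) ?G"
    proof (rule antisym)
      define S where "S = sigma (space (power_space k M)) ?G"
      have sets_S: "sets S = sigma_sets (space (power_space k M)) ?G" and space_S: "space S = space (power_space k M)"
        using G_sub by (simp_all add: S_def)
      have id: "(\<lambda>x. x) \<in> S \<rightarrow>\<^sub>M power_space k M"
        unfolding power_space_def
      proof (rule measurable_PiM_single')
        fix l assume l: "l \<in> {1..k}"
        show "(\<lambda>x. x l) \<in> S \<rightarrow>\<^sub>M M"
        proof (rule coordinate_map_measurable)
          show "(\<lambda>x. x l) \<in> space S \<rightarrow> space M" using l by (auto simp: space_S sp)
          fix j assume j: "j \<in> I"
          have "{x\<in>space S. c j (x l)} \<in> sets S"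
            unfolding sets_S space_S by (rule sigma_sets.Basic) (use l j in force)
          then show "Measurable.pred S (\<lambda>x. c j (x l))" unfolding pred_def .
        qed
      qed (auto simp: space_S sp)
      show "sets (power_space k M) \<subseteq> sigma_sets (space (power_space k M)) ?G"
      proof
        fix B assume B: "B \<in> sets (power_space k M)"
        then have "(\<lambda>x. x) -` B \<inter> space S \<in> sets S" by (rule measurable_sets[OF id])
        moreover have "(\<lambda>x. x) -` B \<inter> space S = B" using sets.sets_into_space[OF B] space_S by auto
        ultimately show "B \<in> sigma_sets (space (power_space k M)) ?G" by (simp add: sets_S)
      qed
      show "sigma_sets (space (power_space k M)) ?G \<subseteq> sets (power_space k M)"
      proof (rule sets.sigma_sets_subset, rule subsetI)
        fix B assume "B \<in> ?G"
        then obtain l j where lj: "l \<in> {1..k}" "j \<in> I" "B = {x\<in>space (power_space k M). c j (x l)}" by auto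
        note [measurable] = coordinate_measurable[OF lj(2)] lj(1)
        show "B \<in> sets (power_space k M)" unfolding lj(3) power_space_def by measurable
      qed
    qed
  next
    fix J and v :: "nat \<times> 'b \<Rightarrow> bool" assume J: "finite J" "J \<subseteq> {1..k} \<times> I"
    define K where "K l = {j. (l, j) \<in> J}" for l
    have K: "finite (K l)" "K l \<subseteq> I" for l
    proof -
      have "K l \<subseteq> snd ` J" by (force simp: K_def)
      then show "finite (K l)" using J(1) finite_subset by blast
      show "K l \<subseteq> I" using J(2) by (auto simp: K_def)
    qed
    have J_Sigma: "J = Sigma {1..k} K" using J(2) by (auto simp: K_def)
    let ?B = "\<lambda>l. {y\<in>space M. \<forall>j\<in>K l. c j y = v (l, j)}"
    have "{x\<in>space (power_space k M). \<forall>i\<in>J. (\<lambda>(l, j) x. c j (x l)) i x = v i} =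
        {x\<in>space (\<Pi>\<^sub>M l\<in>{1..k}. M). \<forall>l\<in>{1..k}. x l \<in> ?B l}"
      unfolding J_Sigma by (auto simp: power_space_def space_PiM)
    then have "emeasure (power_space k M) {x\<in>space (power_space k M). \<forall>i\<in>J. (\<lambda>(l, j) x. c j (x l)) i x = v i} =
        (\<Prod>l\<in>{1..k}. emeasure M (?B l))"
      unfolding power_space_def using K by (simp only:) (intro P.emeasure_PiM_Collect cylinder_sets, auto)
    also have "\<dots> = (\<Prod>l\<in>{1..k}. ennreal (\<Prod>j\<in>K l. pmf (q j) (v (l, j))))"
      using K prob_cylinder[OF K, of _ "\<lambda>j. v (_, j)"] by (intro prod.cong) (simp_all add: emeasure_eq_measure)
    also have "\<dots> = ennreal (\<Prod>l\<in>{1..k}. \<Prod>j\<in>K l. pmf (q j) (v (l, j)))"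
      by (simp add: prod_ennreal prod_nonneg)
    also have "(\<Prod>l\<in>{1..k}. \<Prod>j\<in>K l. pmf (q j) (v (l, j))) = (\<Prod>i\<in>J. pmf ((\<lambda>(l, j). q j) i) (v i))"
      unfolding J_Sigma using K by (subst prod.Sigma) (auto intro!: prod.cong)
    finally show "Pk.prob {x\<in>space (power_space k M). \<forall>i\<in>J. (\<lambda>(l, j) x. c j (x l)) i x = v i} =
        (\<Prod>i\<in>J. pmf ((\<lambda>(l, j). q j) i) (v i))"
      by (simp add: measure_def prod_nonneg)
  next
    fix i x assume "i \<in> {1..k} \<times> I" "x \<in> space (power_space k M)"
    then show "(\<lambda>(l, j) x. x(l := flip j (x l))) i x \<in> space (power_space k M)"
      by (auto simp: sp PiE_iff flip_space extensional_def)
  next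
    fix i i' x assume i: "i \<in> {1..k} \<times> I" "i' \<in> {1..k} \<times> I" and x: "x \<in> space (power_space k M)"
    obtain l j l' j' where lj: "i = (l, j)" "i' = (l', j')" by (cases i, cases i')
    have *: "j \<in> I" "j' \<in> I" "x l \<in> space M" using i x by (auto simp: lj sp PiE_iff)
    show "(\<lambda>(l, j) x. c j (x l)) i' ((\<lambda>(l, j) x. x(l := flip j (x l))) i x) =
        ((\<lambda>(l, j) x. c j (x l)) i' x \<noteq> (i = i'))"
      by (cases "l' = l") (auto simp: lj coord_flip[OF *])
  next
    fix x y assume xy: "x \<in> space (power_space k M)" "y \<in> space (power_space k M)"
      and eq: "\<And>i. i \<in> {1..k} \<times> I \<Longrightarrow> (\<lambda>(l, j) x. c j (x l)) i x = (\<lambda>(l, j) x. c j (x l)) i y"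
    show "x = y"
    proof (rule PiE_ext)
      show "x \<in> (\<Pi>\<^sub>E l\<in>{1..k}. space M)" "y \<in> (\<Pi>\<^sub>E l\<in>{1..k}. space M)" using xy by (simp_all add: sp)
      fix l assume l: "l \<in> {1..k}"
      show "x l = y l"
        using xy l eq[of "(l, _)"] by (intro separation) (auto simp: sp)
    qed
  next
    show "0 < \<delta>" by (rule \<delta>_pos)
    show "\<delta> \<le> pmf ((\<lambda>(l, j). q j) i) b" if "i \<in> {1..k} \<times> I" for i b
      using that \<delta>_le by auto
  qed
qed

lemma generated_action_power_shift:
  fixes a :: "nat \<Rightarrow> int"
  assumes x: "x \<in> space (power_space k (bernoulli_space \<mu>))"
  shows "generated_action (power_space k (bernoulli_space \<mu>))
      (product_map k (\<lambda>i. generated_action (bernoulli_space \<mu>) bernoulli_shift (a i))) g x =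
    (\<lambda>l\<in>{1..k}. \<lambda>n. x l (n - a l * g))"
proof -
  let ?X = "space (power_space k (bernoulli_space \<mu>))"
  let ?S = "product_map k (\<lambda>i. generated_action (bernoulli_space \<mu>) bernoulli_shift (a i))"
  have sp: "?X = (\<Pi>\<^sub>E l\<in>{1..k}. UNIV)"
    by (auto simp: power_space_def bernoulli_space_def space_PiM PiE_def)
  have S: "?S y = (\<lambda>l\<in>{1..k}. \<lambda>n. y l (n - a l))" for y
    by (simp add: product_map_def generated_action_bernoulli_shift)
  have inX: "restrict f {1..k} \<in> ?X" for f by (simp add: sp)
  have pos: "(?S ^^ m) y = (\<lambda>l\<in>{1..k}. \<lambda>n. y l (n - a l * int m))" if "y \<in> ?X" for m y
  proof (induction m)
    case 0
    have "(\<lambda>l\<in>{1..k}. y l) = y" using that by (simp add: sp PiE_restrict)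
    then show ?case by simp
  next
    case (Suc m)
    then show ?case by (auto simp: S algebra_simps restrict_def)
  qed
  have inj: "inj_on ?S ?X"
  proof (rule inj_onI)
    fix y z assume y: "y \<in> ?X" and z: "z \<in> ?X" and eq: "?S y = ?S z"
    show "y = z"
    proof (rule PiE_ext)
      show "y \<in> (\<Pi>\<^sub>E l\<in>{1..k}. UNIV)" "z \<in> (\<Pi>\<^sub>E l\<in>{1..k}. UNIV)" using y z by (simp_all add: sp)
      fix l assume l: "l \<in> {1..k}"
      show "y l = z l"
      proof
        fix n
        show "y l n = z l n"
          using fun_cong[OF fun_cong[OF eq, of l], of "n + a l"] l by (simp add: S)
      qed
    qed
  qed
  have inv: "inv_into ?X ?S y = (\<lambda>l\<in>{1..k}. \<lambda>n. y l (n + a l))" if "y \<in> ?X" for y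
  proof (rule inv_into_f_eq[OF inj inX])
    have "(\<lambda>l\<in>{1..k}. y l) = y" using that by (simp add: sp PiE_restrict)
    then show "?S (\<lambda>l\<in>{1..k}. \<lambda>n. y l (n + a l)) = y" by (simp add: S cong: restrict_cong)
  qed
  have neg: "(inv_into ?X ?S ^^ m) y = (\<lambda>l\<in>{1..k}. \<lambda>n. y l (n + a l * int m))" if "y \<in> ?X" for m y
  proof (induction m)
    case 0
    have "(\<lambda>l\<in>{1..k}. y l) = y" using that by (simp add: sp PiE_restrict)
    then show ?case by simp
  next
    case (Suc m)
    have "(inv_into ?X ?S ^^ Suc m) y = inv_into ?X ?S (\<lambda>l\<in>{1..k}. \<lambda>n. y l (n + a l * int m))"
      by (simp only: funpow.simps comp_apply Suc)
    also have "\<dots> = (\<lambda>l\<in>{1..k}. \<lambda>n. (\<lambda>l\<in>{1..k}. \<lambda>n. y l (n + a l * int m)) l (n + a l))"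
      by (rule inv[OF inX])
    also have "\<dots> = (\<lambda>l\<in>{1..k}. \<lambda>n. y l (n + a l * int (Suc m)))"
      by (intro restrict_ext) (simp add: algebra_simps)
    finally show ?case .
  qed
  show ?thesis
    unfolding generated_action_def[of "power_space k (bernoulli_space \<mu>)" ?S g]
    by (cases "0 \<le> g") (simp_all only: pos[OF x] neg[OF x] if_True if_False, simp_all)
qed

locale vanishing_bias =
  fixes lam :: real and n\<^sub>0 :: int and \<mu> :: "int \<Rightarrow> bool pmf"
  assumes lam: "0 < lam" and n\<^sub>0: "2 \<le> n\<^sub>0" and start: "lam + bias n\<^sub>0 n\<^sub>0 < 1"
    and pmf_False: "\<And>n. pmf (\<mu> n) False = lam + bias n\<^sub>0 n"
begin

definition \<delta> :: real where "\<delta> = min lam (1 - lam - bias n\<^sub>0 n\<^sub>0)"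

lemma \<delta>_gt_0: "0 < \<delta>" using lam start by (simp add: \<delta>_def)

lemma pmf_True: "pmf (\<mu> n) True = 1 - lam - bias n\<^sub>0 n"
  using pmf_False[of n] by (simp add: pmf_False_conv_True)

lemma pmf_ge_\<delta>: "\<delta> \<le> pmf (\<mu> n) b"
  using bias_nonneg[OF n\<^sub>0, of n] bias_le_start[OF n\<^sub>0, of n]
  by (cases b) (auto simp: pmf_False pmf_True \<delta>_def)

lemma stationary_left: "n < n\<^sub>0 \<Longrightarrow> \<mu> n = \<mu> (n\<^sub>0 - 1)"
proof (rule pmf_eqI)
  fix b assume "n < n\<^sub>0"
  then show "pmf (\<mu> n) b = pmf (\<mu> (n\<^sub>0 - 1)) b"
    by (cases b) (simp_all add: pmf_True pmf_False bias_def)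
qed

lemma pmf_base: "pmf (\<mu> (n\<^sub>0 - 1)) True = 1 - lam" "pmf (\<mu> (n\<^sub>0 - 1)) False = lam"
  by (simp_all add: pmf_True pmf_False bias_def)

definition drift :: "nat \<Rightarrow> real" where
  "drift n = ln (pmf (\<mu> (n\<^sub>0 - 1)) True / pmf (\<mu> (n\<^sub>0 - 1)) False) -
    ln (pmf (\<mu> (n\<^sub>0 + int n)) True / pmf (\<mu> (n\<^sub>0 + int n)) False)"

lemma drift_eq:
  "drift n = (ln (lam + bias n\<^sub>0 (n\<^sub>0 + int n)) - ln lam) + (ln (1 - lam) - ln (1 - lam - bias n\<^sub>0 (n\<^sub>0 + int n)))"
proof -
  let ?b = "bias n\<^sub>0 (n\<^sub>0 + int n)"
  have "0 \<le> ?b" "?b \<le> bias n\<^sub>0 n\<^sub>0" by (rule bias_nonneg[OF n\<^sub>0], rule bias_le_start[OF n\<^sub>0])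
  then have "0 < lam" "0 < 1 - lam" "0 < lam + ?b" "0 < 1 - lam - ?b" using lam start bias_nonneg[OF n\<^sub>0, of n\<^sub>0] by auto
  then show ?thesis unfolding drift_def unfolding pmf_base unfolding pmf_True pmf_False by (simp add: ln_divide_pos)
qed

lemma drift_ge_bias: "bias n\<^sub>0 (n\<^sub>0 + int n) \<le> drift n"
proof -
  let ?b = "bias n\<^sub>0 (n\<^sub>0 + int n)"
  have b: "0 \<le> ?b" "?b \<le> bias n\<^sub>0 n\<^sub>0" by (rule bias_nonneg[OF n\<^sub>0], rule bias_le_start[OF n\<^sub>0])
  then have pos: "0 < 1 - lam" "1 - lam < 1" "0 < 1 - lam - ?b" using lam start bias_nonneg[OF n\<^sub>0, of n\<^sub>0] by auto
  have "0 \<le> ln (lam + ?b) - ln lam" using lam b by simp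
  moreover have "?b \<le> ln (1 - lam) - ln (1 - lam - ?b)"
  proof -
    have "ln (1 - lam - ?b) - ln (1 - lam) = ln ((1 - lam - ?b) / (1 - lam))"
      using pos by (subst ln_divide_pos) auto
    also have "\<dots> \<le> (1 - lam - ?b) / (1 - lam) - 1" using pos by (intro ln_le_minus_one) auto
    also have "\<dots> = - (?b / (1 - lam))" using pos by (simp add: field_simps)
    also have "?b / (1 - lam) \<ge> ?b / 1" using b pos by (intro divide_left_mono) auto
    then have "- (?b / (1 - lam)) \<le> - ?b" by simp
    finally show ?thesis by simp
  qed
  ultimately show ?thesis unfolding drift_eq by linarith
qed

lemma drift_properties:
  "0 \<le> drift n" "drift \<longlonglongrightarrow> 0" "\<not> summable (\<lambda>n. (drift n)\<^sup>2)"
proof -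
  show "0 \<le> drift n" using bias_nonneg[OF n\<^sub>0, of "n\<^sub>0 + int n"] drift_ge_bias[of n] by linarith
  have l1: "0 < 1 - lam" using start bias_nonneg[OF n\<^sub>0, of n\<^sub>0] by linarith
  have "(\<lambda>n. (ln (lam + bias n\<^sub>0 (n\<^sub>0 + int n)) - ln lam) + (ln (1 - lam) - ln (1 - lam - bias n\<^sub>0 (n\<^sub>0 + int n))))
      \<longlonglongrightarrow> (ln (lam + 0) - ln lam) + (ln (1 - lam) - ln (1 - lam - 0))"
    using lam l1 by (intro tendsto_intros bias_tendsto[OF n\<^sub>0]) auto
  then show "drift \<longlonglongrightarrow> 0" by (simp add: drift_eq[abs_def])
  show "\<not> summable (\<lambda>n. (drift n)\<^sup>2)"
  proof
    assume "summable (\<lambda>n. (drift n)\<^sup>2)"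
    then have "summable (\<lambda>n. (bias n\<^sub>0 (n\<^sub>0 + int n))\<^sup>2)"
      by (rule summable_comparison_test'[where N = 0])
        (simp add: power_mono[OF drift_ge_bias bias_nonneg[OF n\<^sub>0]])
    then show False using bias_square_divergent[OF n\<^sub>0] by simp
  qed
qed

text \<open>The \<open>l\<close>-th factor of the product moves its coins by \<open>a l\<close>, and energies add up. As the energy of one factor is
at most \<open>\<eta> ln n\<close> for every \<open>\<eta> > 0\<close>, up to a constant, the number of factors and the constant \<open>\<delta>\<close> can be absorbed.\<close>

lemma energy_growth:
  assumes k: "finite K" and a: "\<And>l. l \<in> K \<Longrightarrow> a l \<noteq> (0::int)"
  shows "\<exists>C. \<forall>n::nat. 0 < n \<longrightarrow> exp ((\<Sum>l\<in>K. 3 * square_sum n\<^sub>0 (nat \<bar>a l * - int n\<bar>)) / \<delta>\<^sup>2) \<le> C * real n powr (1 / 8)"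
proof -
  \<comment> \<open>The exponent \<open>1 / 8\<close> and the factor 3 of \<open>bias_energy\<close> give 24; adding 1 allows an empty set of factors.\<close>
  define \<eta> where "\<eta> = \<delta>\<^sup>2 / (24 * (real (card K) + 1))"
  have \<eta>: "0 < \<eta>" using \<delta>_gt_0 by (simp add: \<eta>_def)
  obtain C0 where C0: "\<And>n. 0 < n \<Longrightarrow> square_sum n\<^sub>0 n \<le> \<eta> * ln (real n) + C0"
    using square_sum_growth[OF n\<^sub>0 \<eta>] by blast
  define D where "D = (\<Sum>l\<in>K. 3 * (\<eta> * ln (real_of_int \<bar>a l\<bar>) + C0))"
  have "exp ((\<Sum>l\<in>K. 3 * square_sum n\<^sub>0 (nat \<bar>a l * - int n\<bar>)) / \<delta>\<^sup>2) \<le> exp (D / \<delta>\<^sup>2) * real n powr (1 / 8)"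
    if n: "0 < n" for n :: nat
  proof -
    have "(\<Sum>l\<in>K. 3 * square_sum n\<^sub>0 (nat \<bar>a l * - int n\<bar>)) \<le>
        (\<Sum>l\<in>K. 3 * (\<eta> * ln (real_of_int \<bar>a l\<bar>) + C0) + 3 * \<eta> * ln (real n))"
    proof (rule sum_mono)
      fix l assume l: "l \<in> K"
      have pos: "0 < \<bar>a l\<bar>" using a[OF l] by simp
      have N: "real (nat \<bar>a l * - int n\<bar>) = real_of_int \<bar>a l\<bar> * real n" by (simp add: abs_mult)
      have "0 < nat \<bar>a l * - int n\<bar>" using pos n by simp
      then have "square_sum n\<^sub>0 (nat \<bar>a l * - int n\<bar>) \<le> \<eta> * ln (real_of_int \<bar>a l\<bar> * real n) + C0"
        using C0[of "nat \<bar>a l * - int n\<bar>"] unfolding N by simp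
      also have "ln (real_of_int \<bar>a l\<bar> * real n) = ln (real_of_int \<bar>a l\<bar>) + ln (real n)"
        using pos n by (intro ln_mult_pos) auto
      finally show "3 * square_sum n\<^sub>0 (nat \<bar>a l * - int n\<bar>) \<le> 3 * (\<eta> * ln (real_of_int \<bar>a l\<bar>) + C0) + 3 * \<eta> * ln (real n)"
        by (simp add: algebra_simps)
    qed
    also have "\<dots> = D + 3 * \<eta> * real (card K) * ln (real n)"
      by (simp add: D_def sum.distrib)
    also have "3 * \<eta> * real (card K) * ln (real n) \<le> \<delta>\<^sup>2 / 8 * ln (real n)"
    proof (rule mult_right_mono)
      have "3 * \<eta> * real (card K) \<le> 3 * \<eta> * (real (card K) + 1)" using \<eta> by simp
      also have "\<dots> = \<delta>\<^sup>2 / 8" by (simp add: \<eta>_def field_simps)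
      finally show "3 * \<eta> * real (card K) \<le> \<delta>\<^sup>2 / 8" .
      show "0 \<le> ln (real n)" using n by simp
    qed
    finally have "(\<Sum>l\<in>K. 3 * square_sum n\<^sub>0 (nat \<bar>a l * - int n\<bar>)) / \<delta>\<^sup>2 \<le> (D + \<delta>\<^sup>2 / 8 * ln (real n)) / \<delta>\<^sup>2"
      by (intro divide_right_mono) auto
    also have "\<dots> = D / \<delta>\<^sup>2 + 1 / 8 * ln (real n)" using \<delta>_gt_0 by (simp add: field_simps)
    finally have "exp ((\<Sum>l\<in>K. 3 * square_sum n\<^sub>0 (nat \<bar>a l * - int n\<bar>)) / \<delta>\<^sup>2) \<le> exp (D / \<delta>\<^sup>2 + 1 / 8 * ln (real n))" by simp
    also have "\<dots> = exp (D / \<delta>\<^sup>2) * real n powr (1 / 8)" using n by (simp add: exp_add powr_def)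
    finally show ?thesis .
  qed
  then show ?thesis by blast
qed

lemma coin_system_shift:
  "\<exists>C. coin_system (bernoulli_space \<mu>) UNIV (\<lambda>n x. x n) \<mu> (\<lambda>n x. x(n := \<not> x n)) \<delta>
    (generated_action (bernoulli_space \<mu>) bernoulli_shift) (\<lambda>g n. n - g) (\<lambda>g. 3 * square_sum n\<^sub>0 (nat \<bar>g\<bar>))
    (\<mu> (n\<^sub>0 - 1)) C (\<lambda>n. n\<^sub>0 + int n)"
proof -
  interpret coin_flip "bernoulli_space \<mu>" UNIV "\<lambda>n x. x n" \<mu> "\<lambda>n x. x(n := \<not> x n)" \<delta>
    by (rule coin_flip_bernoulli_space[OF \<delta>_gt_0 pmf_ge_\<delta>])
  have sp: "space (bernoulli_space \<mu>) = UNIV"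
    by (auto simp: bernoulli_space_def space_PiM)
  obtain C where C: "\<And>n::nat. 0 < n \<Longrightarrow> exp (3 * square_sum n\<^sub>0 (nat \<bar>- int n\<bar>) / \<delta>\<^sup>2) \<le> C * real n powr (1 / 8)"
    using energy_growth[of "{()}" "\<lambda>_. 1"] by auto
  show ?thesis
  proof (intro exI[of _ C] coin_system.intro coin_action.intro coin_flip_axioms coin_action_axioms.intro coin_system_axioms.intro)
    fix g :: int and J :: "int set" assume "finite J"
    then show "(\<Sum>j\<in>J. (pmf (\<mu> (j - g)) True - pmf (\<mu> j) True)\<^sup>2) \<le> 3 * square_sum n\<^sub>0 (nat \<bar>g\<bar>)"
      using bias_energy_int[OF n\<^sub>0, of J g] by (simp add: pmf_True power2_commute)
  next
    fix i :: int
    have "\<mu> (i - 1 * int n) = \<mu> (n\<^sub>0 - 1)" if "nat (i - n\<^sub>0 + 1) \<le> n" for n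
      by (rule stationary_left) (use that in linarith)
    then show "\<exists>\<sigma>\<in>{1, - 1}. \<exists>n0. \<forall>n\<ge>n0. \<mu> (i - \<sigma> * int n) = \<mu> (n\<^sub>0 - 1)" by blast
  next
    show "(\<lambda>n. ln (pmf (\<mu> (n\<^sub>0 - 1)) True / pmf (\<mu> (n\<^sub>0 - 1)) False) -
        ln (pmf (\<mu> (n\<^sub>0 + int n)) True / pmf (\<mu> (n\<^sub>0 + int n)) False)) \<longlonglongrightarrow> 0"
      using drift_properties(2) unfolding drift_def .
  qed (use C drift_properties(1,3) lam start bias_nonneg[OF n\<^sub>0, of n\<^sub>0] \<delta>_gt_0 pmf_ge_\<delta>[of "n\<^sub>0 - 1"] in
    \<open>auto simp: sp generated_action_bernoulli_shift drift_def inj_def infinite_UNIV_int intro: less_le_trans\<close>)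
qed

text \<open>The coins of the factor \<open>l\<close> become stationary in the time direction given by the sign of \<open>a l\<close>. The drift is
taken from the first factor.\<close>

lemma coin_system_power_shift:
  assumes k: "1 \<le> k" and a: "\<And>l. l \<in> {1..k} \<Longrightarrow> a l \<noteq> (0::int)"
  shows "\<exists>C. coin_system (power_space k (bernoulli_space \<mu>)) ({1..k} \<times> UNIV) (\<lambda>(l, j) x. x l j) (\<lambda>(l, j). \<mu> j)
    (\<lambda>(l, j) x. x(l := (x l)(j := \<not> x l j))) \<delta>
    (generated_action (power_space k (bernoulli_space \<mu>))
      (product_map k (\<lambda>i. generated_action (bernoulli_space \<mu>) bernoulli_shift (a i))))
    (\<lambda>g (l, j). (l, j - a l * g)) (\<lambda>g. \<Sum>l\<in>{1..k}. 3 * square_sum n\<^sub>0 (nat \<bar>a l * g\<bar>))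
    (\<mu> (n\<^sub>0 - 1)) C (\<lambda>n. (1, n\<^sub>0 + int n))"
proof -
  let ?Xk = "power_space k (bernoulli_space \<mu>)"
  interpret coin_flip ?Xk "{1..k} \<times> UNIV" "\<lambda>(l, j) x. x l j" "\<lambda>(l, j). \<mu> j" "\<lambda>(l, j) x. x(l := (x l)(j := \<not> x l j))" \<delta>
    by (rule coin_flip_power_space[OF coin_flip_bernoulli_space[OF \<delta>_gt_0 pmf_ge_\<delta>]])
  have sp: "space ?Xk = (\<Pi>\<^sub>E l\<in>{1..k}. UNIV)"
    by (auto simp: power_space_def bernoulli_space_def space_PiM PiE_def)
  obtain C where C: "\<And>n::nat. 0 < n \<Longrightarrow> exp ((\<Sum>l\<in>{1..k}. 3 * square_sum n\<^sub>0 (nat \<bar>a l * - int n\<bar>)) / \<delta>\<^sup>2) \<le> C * real n powr (1 / 8)"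
    using energy_growth[of "{1..k}" a] a by auto
  show ?thesis
  proof (intro exI[of _ C] coin_system.intro coin_action.intro coin_flip_axioms coin_action_axioms.intro coin_system_axioms.intro)
    fix g x assume "x \<in> space ?Xk"
    then show "generated_action ?Xk (product_map k (\<lambda>i. generated_action (bernoulli_space \<mu>) bernoulli_shift (a i))) g x \<in> space ?Xk"
      by (simp add: generated_action_power_shift) (simp add: sp)
  next
    fix g i x assume "i \<in> {1..k} \<times> (UNIV :: int set)" "x \<in> space ?Xk"
    then show "(\<lambda>(l, j) x. x l j) i (generated_action ?Xk (product_map k (\<lambda>i. generated_action (bernoulli_space \<mu>) bernoulli_shift (a i))) g x)
        = (\<lambda>(l, j) x. x l j) ((\<lambda>(l, j). (l, j - a l * g)) i) x"
      by (auto simp: generated_action_power_shift)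
  next
    fix g and i :: "nat \<times> int" assume "i \<in> {1..k} \<times> UNIV" "(\<lambda>(l, j). (l, j - a l * g)) i = i"
    then show "g = 0" using a by auto
  next
    show "infinite ({1..k} \<times> (UNIV :: int set))" using k by (auto simp: finite_cartesian_product_iff infinite_UNIV_int)
  next
    fix g :: int and J :: "(nat \<times> int) set" assume J: "finite J" "J \<subseteq> {1..k} \<times> UNIV"
    let ?t = "\<lambda>l j. (bias n\<^sub>0 (j - a l * g) - bias n\<^sub>0 j)\<^sup>2"
    have "(\<Sum>i\<in>J. (pmf ((\<lambda>(l, j). \<mu> j) ((\<lambda>(l, j). (l, j - a l * g)) i)) True - pmf ((\<lambda>(l, j). \<mu> j) i) True)\<^sup>2) =
        (\<Sum>(l, j)\<in>J. ?t l j)"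
      by (intro sum.cong) (auto simp: pmf_True power2_commute)
    also have "\<dots> \<le> (\<Sum>(l, j)\<in>{1..k} \<times> snd ` J. ?t l j)"
      by (rule sum_mono2) (use J in \<open>force+\<close>)
    also have "\<dots> = (\<Sum>l\<in>{1..k}. \<Sum>j\<in>snd ` J. ?t l j)" by (rule sum.cartesian_product[symmetric])
    also have "\<dots> \<le> (\<Sum>l\<in>{1..k}. 3 * square_sum n\<^sub>0 (nat \<bar>a l * g\<bar>))"
      by (intro sum_mono bias_energy_int[OF n\<^sub>0]) (use J in auto)
    finally show "(\<Sum>i\<in>J. (pmf ((\<lambda>(l, j). \<mu> j) ((\<lambda>(l, j). (l, j - a l * g)) i)) True - pmf ((\<lambda>(l, j). \<mu> j) i) True)\<^sup>2)
        \<le> (\<Sum>l\<in>{1..k}. 3 * square_sum n\<^sub>0 (nat \<bar>a l * g\<bar>))" .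
  next
    fix i assume i: "i \<in> {1..k} \<times> (UNIV :: int set)"
    obtain l j where lj: "i = (l, j)" "l \<in> {1..k}" using i by auto
    define \<sigma> where "\<sigma> = sgn (a l)"
    have \<sigma>: "\<sigma> \<in> {1, -1}" "1 \<le> a l * \<sigma>" using a[OF lj(2)] by (auto simp: \<sigma>_def sgn_if)
    have "\<mu> (j - a l * (\<sigma> * int n)) = \<mu> (n\<^sub>0 - 1)" if n: "nat (j - n\<^sub>0 + 1) \<le> n" for n
    proof (rule stationary_left)
      have "1 * int n \<le> (a l * \<sigma>) * int n" using \<sigma>(2) by (rule mult_right_mono) simp
      then show "j - a l * (\<sigma> * int n) < n\<^sub>0" using n by (simp add: mult.assoc)
    qed
    then show "\<exists>\<sigma>\<in>{1, - 1}. \<exists>n0. \<forall>n\<ge>n0. (\<lambda>(l, j). \<mu> j) ((\<lambda>(l, j). (l, j - a l * (\<sigma> * int n))) i) = \<mu> (n\<^sub>0 - 1)"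
      by (intro bexI[OF _ \<sigma>(1)] exI[of _ "nat (j - n\<^sub>0 + 1)"]) (simp add: lj(1))
  next
    show "(\<lambda>n. ln (pmf (\<mu> (n\<^sub>0 - 1)) True / pmf (\<mu> (n\<^sub>0 - 1)) False) -
        ln (pmf ((\<lambda>(l, j). \<mu> j) (1::nat, n\<^sub>0 + int n)) True / pmf ((\<lambda>(l, j). \<mu> j) (1::nat, n\<^sub>0 + int n)) False)) \<longlonglongrightarrow> 0"
      using drift_properties(2) unfolding drift_def by simp
  qed (use k C drift_properties(1,3) \<delta>_gt_0 pmf_ge_\<delta>[of "n\<^sub>0 - 1"] in
    \<open>auto simp: drift_def inj_def algebra_simps intro: less_le_trans\<close>)
qed

end

theorem corollary6p2:
  fixes lam :: real and n\<^sub>0 :: int and \<mu> :: "int \<Rightarrow> bool pmf"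
    and X :: "(int \<Rightarrow> bool) measure" and T :: "(int \<Rightarrow> bool) \<Rightarrow> int \<Rightarrow> bool"
  assumes "0 < lam" and "lam < 1"
    and "n\<^sub>0 = \<lceil>1 / (1 - lam)\<^sup>2\<rceil>"
    and "lam + 1 / sqrt (real_of_int n\<^sub>0 * ln (real_of_int n\<^sub>0)) < 1"
    and "\<And>n. pmf (\<mu> n) False =
           (if n\<^sub>0 \<le> n then lam + 1 / sqrt (real_of_int n * ln (real_of_int n)) else lam)"
    and "X = bernoulli_space \<mu>"
    and "T = bernoulli_shift"
  shows "(let act = generated_action X T in
            nonsingular_action X act \<and> essentially_free X act \<and> ergodic_action X act \<and>
            type_III1 X act \<and>
            weakly_mixing TYPE('y) (maharam_measure X) (maharam_action X act)) \<and>
         (\<forall>(k::nat) (a :: nat \<Rightarrow> int). 1 \<le> k \<and> (\<forall>i\<in>{1..k}. a i \<noteq> 0) \<longrightarrow>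
            (let Xk = power_space k X;
                 act = generated_action Xk (product_map k (\<lambda>i. generated_action X T (a i))) in
               nonsingular_action Xk act \<and> ergodic_action Xk act \<and> type_III1 Xk act \<and>
               weakly_mixing TYPE('y) (maharam_measure Xk) (maharam_action Xk act)))"
proof -
  have "(1 - lam)\<^sup>2 < 1"
    using assms(1,2) by (simp add: power_less_one_iff)
  then have "1 < 1 / (1 - lam)\<^sup>2" using assms(2) by (simp add: less_divide_eq)
  then have n\<^sub>0: "2 \<le> n\<^sub>0" unfolding assms(3) by linarith
  interpret vanishing_bias lam n\<^sub>0 \<mu>
    by unfold_locales (use assms(1,4,5) n\<^sub>0 in \<open>simp_all add: bias_def\<close>)
  obtain C where "coin_system X UNIV (\<lambda>n x. x n) \<mu> (\<lambda>n x. x(n := \<not> x n)) \<delta>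
      (generated_action X T) (\<lambda>g n. n - g) (\<lambda>g. 3 * square_sum n\<^sub>0 (nat \<bar>g\<bar>)) (\<mu> (n\<^sub>0 - 1)) C (\<lambda>n. n\<^sub>0 + int n)"
    using coin_system_shift unfolding assms(6,7) by blast
  note X = coin_system.shift_properties[OF this]
  have Xk: "nonsingular_action Xk act \<and> ergodic_action Xk act \<and> type_III1 Xk act \<and>
      weakly_mixing TYPE('y) (maharam_measure Xk) (maharam_action Xk act)"
    if k: "1 \<le> k" and a: "\<forall>i\<in>{1..k}. a i \<noteq> 0" and Xk: "Xk = power_space k X"
      and act: "act = generated_action Xk (product_map k (\<lambda>i. generated_action X T (a i)))" for k a Xk act
  proof -
    obtain C where "coin_system Xk ({1..k} \<times> UNIV) (\<lambda>(l, j) x. x l j) (\<lambda>(l, j). \<mu> j)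
        (\<lambda>(l, j) x. x(l := (x l)(j := \<not> x l j))) \<delta> act (\<lambda>g (l, j). (l, j - a l * g))
        (\<lambda>g. \<Sum>l\<in>{1..k}. 3 * square_sum n\<^sub>0 (nat \<bar>a l * g\<bar>)) (\<mu> (n\<^sub>0 - 1)) C (\<lambda>n. (1, n\<^sub>0 + int n))"
      using coin_system_power_shift[OF k, of a] a unfolding act Xk assms(6,7) by blast
    note props = coin_system.shift_properties[OF this]
    show ?thesis by (intro conjI props)
  qed
  show ?thesis
    unfolding Let_def
    by (rule conjI, intro conjI X, intro allI impI, elim conjE, rule Xk[OF _ _ refl refl])
qed

end
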